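(* Let $(G,\mathfrak S)$ be a hierarchically hyperbolic group with a BBF colouring and whose associated hyperbolic spaces $\mathcal C U$, $U\in\mathfrak S$, are quasi-trees. Then $G$ acts metrically properly by quasimedian isometries on a finite product of quasitrees.
   Context: HIERARCHICALLY HYPERBOLIC GROUPS. A hierarchically hyperbolic group (HHG) $(G,\mathfrak S)$ with constant $E$ consists of a finitely generated group $G$, with the word metric $\mathsf d_G$ of a fixed finite generating set, and a set $\mathfrak S$ of domains, such that the following hold. (1) Projections: each $U\in\mathfrak S$ has an $E$-hyperbolic geodesic space $\mathcal C U$ and an $(E,E)$-coarsely Lipschitz, $E$-coarsely onto coarse map $\pi_U:G\to\mathcal C U$ (points may be sent to nonempty sets of diameter at most $E$). Write $\mathsf d_U(x,y)=\mathsf d_{\mathcal C U}(\pi_U(x),\pi_U(y))$ for points or subsets $x,y$ of $G$, and $\mathsf d_U(x,b)=\mathsf d_{\mathcal C U}(\pi_U(x),b)$ for $b\subset\mathcal C U$. (2) Nesting: $\mathfrak S$ has a partial order $\sqsubseteq$ with a unique maximal element; $U\sqsubset V$ means $U\sqsubseteq V$ and $U\ne V$. If $U\sqsubset V$ there are a specified nonempty set $\rho^U_V\subset\mathcal C V$ of diameter at most $E$ and a coarse map $\rho^V_U:\mathcal C V\to\mathcal C U$. (3) Orthogonality: $\bot$ is a symmetric antireflexive relation on $\mathfrak S$; if $V\sqsubseteq W$ and $W\bot U$ then $V\bot U$; if $V\bot W$ then $V,W$ are not $\sqsubseteq$-comparable; for all $T\in\mathfrak S$ and $U\sqsubseteq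 T$ such that some $V\sqsubseteq T$ has $V\bot U$, there is $W\sqsubset T$ such that every $V\sqsubseteq T$ with $V\bot U$ satisfies $V\sqsubseteq W$. (4) Transversality and consistency: $U\pitchfork V$ (transverse) means $U,V$ are neither $\sqsubseteq$-comparable nor orthogonal; then there are specified nonempty sets $\rho^U_V\subset\mathcal C V$, $\rho^V_U\subset\mathcal C U$ of diameter at most $E$, with $\min\{\mathsf d_U(x,\rho^V_U),\mathsf d_V(x,\rho^U_V)\}\le E$ for all $x\in G$. If $U\sqsubset V$ then $\min\{\mathsf d_V(x,\rho^U_V),\operatorname{diam}(\pi_U(x)\cup\rho^V_U(\pi_V(x)))\}\le E$ for all $x\in G$. If $U\sqsubseteq V$ then $\mathsf d_{\mathcal C W}(\rho^U_W,\rho^V_W)\le E$ whenever $V\sqsubset W$, or $V\pitchfork W$ and $W\not\perp U$. (5) Finite complexity: $\sqsubset$-chains have uniformly bounded length. (6) Large links: there is $\lambda_0\ge1$ such that for $W\in\mathfrak S$, $x,x'\in G$ and $N=\lambda_0\mathsf d_W(x,x')+\lambda_0$, there are $T_1,\dots,T_{\lfloor N\rfloor}\sqsubset W$ such that every $T\sqsubset W$ satisfies $T\sqsubseteq T_j$ for some $j$ or $\mathsf d_T(x,x')<E$, and $\mathsf d_W(x,\rho^{T_j}_W)\le N$ for all $j$. (7) Bounded geodesic image: if $V\sqsubset W$ and $\gamma$ is a geodesic in $\mathcal C W$, then $\operatorname{diam}\rho^W_V(\gamma)\le E$ or $\gamma$ meets the $E$-neighbourhood of $\rho^V_W$. (8)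 Partial realisation: if $\{V_j\}$ are pairwise orthogonal and $p_j\in\pi_{V_j}(G)$, there is $x\in G$ with $\mathsf d_{V_j}(x,p_j)\le E$ for all $j$, and $\mathsf d_V(x,\rho^{V_j}_V)\le E$ whenever $V_j\sqsubset V$ or $V\pitchfork V_j$. (9) Uniqueness: there is a function $E:[0,\infty)\to[0,\infty)$ (with $E=E(0)$) such that if $\mathsf d_V(x,y)<\kappa$ for all $V\in\mathfrak S$ then $\mathsf d_G(x,y)<E(\kappa)$. (10) $G$ acts on $\mathfrak S$ with finitely many orbits, preserving $\sqsubseteq,\bot,\pitchfork$; each $g\in G$ has isometries $g:\mathcal C U\to\mathcal C gU$ ($U\in\mathfrak S$) such that the isometry of a product $g_1g_2$ is the composition of those of $g_1$ and $g_2$, and $g\pi_U(x)=\pi_{gU}(gx)$, $g\rho^U_V=\rho^{gU}_{gV}$ whenever $x\in G$ and $U\sqsubset V$ or $U\pitchfork V$. BBF COLOURING. A BBF colouring of $(G,\mathfrak S)$ is a decomposition $\mathfrak S=\bigsqcup_{i=1}^\chi\mathfrak S_i$ into finitely many $G$-invariant subsets such that any two distinct domains in the same $\mathfrak S_i$ are transverse. OTHER TERMS. A quasi-tree is a geodesic metric space quasiisometric to a tree. An action of $G$ by isometries on a metric space is metrically proper if every ball $B$ satisfies $|\{g\in G:gB\cap B\neq\emptyset\}|<\infty$. A finite product of quasi-trees is a coarse median space with componentwise coarse median, where the coarse median of three points in a hyperbolic space is a point uniformly close to all three sides of a geodesic triangle with these vertices. A map $\psi:Y\to X$ of coarse median spaces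 is quasimedian if there is $D$ with $\mathsf d_X(\psi m_Y(x,y,z),m_X(\psi(x),\psi(y),\psi(z)))\le D$ for all $x,y,z\in Y$. *)

theory Defs
  imports
    "HOL-Analysis.Abstract_Metric_Spaces"
    "HOL-Algebra.Group_Action"
    "HOL-Algebra.Generated_Groups"
begin

section \<open>Metric notions\<close>

definition diam_le :: "'p metric \<Rightarrow> 'p set \<Rightarrow> real \<Rightarrow> bool" where
  "diam_le X A r \<longleftrightarrow> (\<forall>a\<in>A. \<forall>b\<in>A. mdist X a b \<le> r)"

text \<open>The infimal distance. It is only meaningful for nonempty subsets of the space.\<close>

definition set_dist :: "'p metric \<Rightarrow> 'p set \<Rightarrow> 'p set \<Rightarrow> real" where
  "set_dist X A B = Inf {mdist X a b | a b. a \<in> A \<and> b \<in> B}"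

definition geodesic_segment :: "'p metric \<Rightarrow> 'p \<Rightarrow> 'p \<Rightarrow> 'p set \<Rightarrow> bool" where
  "geodesic_segment X x y A \<longleftrightarrow>
     (\<exists>L\<ge>0. \<exists>\<gamma>::real \<Rightarrow> 'p. \<gamma> ` {0..L} \<subseteq> mspace X \<and>
        (\<forall>s\<in>{0..L}. \<forall>t\<in>{0..L}. mdist X (\<gamma> s) (\<gamma> t) = \<bar>s - t\<bar>) \<and>
        \<gamma> 0 = x \<and> \<gamma> L = y \<and> A = \<gamma> ` {0..L})"

definition geodesic_space :: "'p metric \<Rightarrow> bool" where
  "geodesic_space X \<longleftrightarrow> (\<forall>x\<in>mspace X. \<forall>y\<in>mspace X. \<exists>A. geodesic_segment X x y A)"

definition geodesic_triangle ::
  "'p metric \<Rightarrow> 'p \<Rightarrow> 'p \<Rightarrow> 'p \<Rightarrow> 'p set \<Rightarrow> 'p set \<Rightarrow> 'p set \<Rightarrow> bool" where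
  "geodesic_triangle X x y z A B C \<longleftrightarrow>
     geodesic_segment X x y A \<and> geodesic_segment X y z B \<and> geodesic_segment X z x C"

text \<open>Slim triangles; as the vertices and sides are arbitrary, one side is enough.\<close>

definition hyperbolic_space :: "real \<Rightarrow> 'p metric \<Rightarrow> bool" where
  "hyperbolic_space \<delta> X \<longleftrightarrow>
     (\<forall>x y z A B C. geodesic_triangle X x y z A B C \<longrightarrow>
        (\<forall>a\<in>A. \<exists>b\<in>B \<union> C. mdist X a b \<le> \<delta>))"

definition isometry :: "'p metric \<Rightarrow> 'q metric \<Rightarrow> ('p \<Rightarrow> 'q) \<Rightarrow> bool" where
  "isometry X Y f \<longleftrightarrow> f ` mspace X = mspace Y \<and>
     (\<forall>x\<in>mspace X. \<forall>y\<in>mspace X. mdist Y (f x) (f y) = mdist X x y)"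

definition quasi_isometry :: "'p metric \<Rightarrow> 'q metric \<Rightarrow> ('p \<Rightarrow> 'q) \<Rightarrow> bool" where
  "quasi_isometry X Y f \<longleftrightarrow> f ` mspace X \<subseteq> mspace Y \<and>
     (\<exists>K\<ge>1. \<exists>c\<ge>0.
        (\<forall>x\<in>mspace X. \<forall>y\<in>mspace X.
           mdist X x y / K - c \<le> mdist Y (f x) (f y) \<and>
           mdist Y (f x) (f y) \<le> K * mdist X x y + c) \<and>
        (\<forall>y\<in>mspace Y. \<exists>x\<in>mspace X. mdist Y (f x) y \<le> c))"


section \<open>Quasi-trees\<close>

definition simple_path :: "'v rel \<Rightarrow> 'v \<Rightarrow> 'v list \<Rightarrow> 'v \<Rightarrow> bool" where
  "simple_path R u p v \<longleftrightarrow>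
     p \<noteq> [] \<and> hd p = u \<and> last p = v \<and> distinct p \<and> successively (\<lambda>a b. (a, b) \<in> R) p"

text \<open>The vertex set of a simplicial tree, with the path metric (unit edges).\<close>

definition tree_metric :: "'v metric \<Rightarrow> bool" where
  "tree_metric T \<longleftrightarrow> mspace T \<noteq> {} \<and>
     (\<exists>R \<subseteq> mspace T \<times> mspace T. sym R \<and> irrefl R \<and>
        (\<forall>u\<in>mspace T. \<forall>v\<in>mspace T.
           (\<exists>!p. simple_path R u p v) \<and>
           (\<forall>p. simple_path R u p v \<longrightarrow> mdist T u v = real (length p - 1))))"

text \<open>
  The type of the vertices of the tree is no restriction: let \<open>f\<close> be a quasi-isometry from \<open>X\<close>
  to a tree with vertices in any type, and \<open>x0\<close> a point of \<open>X\<close>. The union of the paths from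
  \<open>f x0\<close> to the vertices \<open>f x\<close> is a subtree with the restricted metric, \<open>f\<close> is a
  quasi-isometry onto it as well, and \<open>(x, k) \<mapsto>\<close> (the \<open>k\<close>-th vertex of the path from
  \<open>f x0\<close> to \<open>f x\<close>) maps a subset of \<open>'p \<times> nat\<close> onto its vertices.
\<close>

definition quasi_tree :: "'p metric \<Rightarrow> bool" where
  "quasi_tree X \<longleftrightarrow> geodesic_space X \<and>
     (\<exists>(T :: ('p \<times> nat) metric) f. tree_metric T \<and> quasi_isometry X T f)"


section \<open>Coarse medians and finite products\<close>

definition coarse_median :: "'p metric \<Rightarrow> ('p \<Rightarrow> 'p \<Rightarrow> 'p \<Rightarrow> 'p) \<Rightarrow> bool" where
  "coarse_median X m \<longleftrightarrow>
     (\<exists>k. \<forall>x\<in>mspace X. \<forall>y\<in>mspace X. \<forall>z\<in>mspace X. m x y z \<in> mspace X \<and>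
        (\<exists>A B C. geodesic_triangle X x y z A B C \<and>
           (\<forall>S\<in>{A, B, C}. \<exists>s\<in>S. mdist X (m x y z) s \<le> k)))"

definition quasimedian ::
  "'p metric \<Rightarrow> ('p \<Rightarrow> 'p \<Rightarrow> 'p \<Rightarrow> 'p) \<Rightarrow> 'q metric \<Rightarrow> ('q \<Rightarrow> 'q \<Rightarrow> 'q \<Rightarrow> 'q) \<Rightarrow> ('p \<Rightarrow> 'q) \<Rightarrow> bool"
  where
  "quasimedian Y mY X mX \<psi> \<longleftrightarrow>
     (\<exists>D. \<forall>x\<in>mspace Y. \<forall>y\<in>mspace Y. \<forall>z\<in>mspace Y.
        mdist X (\<psi> (mY x y z)) (mX (\<psi> x) (\<psi> y) (\<psi> z)) \<le> D)"

text \<open>Finite products carry the \<open>l1\<close> metric; the factors are indexed by \<open>{..<n}\<close>.\<close>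

definition l1_product :: "nat \<Rightarrow> (nat \<Rightarrow> 'p metric) \<Rightarrow> (nat \<Rightarrow> 'p) metric" where
  "l1_product n T =
     metric (\<Pi>\<^sub>E i\<in>{..<n}. mspace (T i), \<lambda>x y. \<Sum>i<n. mdist (T i) (x i) (y i))"

lemma Metric_space_l1_product:
  fixes n :: nat
  shows "Metric_space (\<Pi>\<^sub>E i\<in>{..<n}. mspace (T i)) (\<lambda>x y. \<Sum>i<n. mdist (T i) (x i) (y i))"
proof
  fix x y
  assume x: "x \<in> (\<Pi>\<^sub>E i\<in>{..<n}. mspace (T i))" and y: "y \<in> (\<Pi>\<^sub>E i\<in>{..<n}. mspace (T i))"
  have "(\<Sum>i<n. mdist (T i) (x i) (y i)) = 0 \<longleftrightarrow> (\<forall>i<n. mdist (T i) (x i) (y i) = 0)"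
    by (auto simp: sum_nonneg_eq_0_iff)
  also have "\<dots> \<longleftrightarrow> (\<forall>i<n. x i = y i)"
    using PiE_mem[OF x] PiE_mem[OF y] by simp
  also have "\<dots> \<longleftrightarrow> x = y"
    using PiE_ext[OF x y] by (metis lessThan_iff)
  finally show "(\<Sum>i<n. mdist (T i) (x i) (y i)) = 0 \<longleftrightarrow> x = y" .
next
  fix x y z
  assume "x \<in> (\<Pi>\<^sub>E i\<in>{..<n}. mspace (T i))" "y \<in> (\<Pi>\<^sub>E i\<in>{..<n}. mspace (T i))"
    "z \<in> (\<Pi>\<^sub>E i\<in>{..<n}. mspace (T i))"
  then show "(\<Sum>i<n. mdist (T i) (x i) (z i))
      \<le> (\<Sum>i<n. mdist (T i) (x i) (y i)) + (\<Sum>i<n. mdist (T i) (y i) (z i))"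
    unfolding sum.distrib[symmetric]
    by (intro sum_mono mdist_triangle) (auto simp: PiE_iff)
qed (auto simp: sum_nonneg mdist_commute)

lemma mspace_l1_product [simp]: "mspace (l1_product n T) = (\<Pi>\<^sub>E i\<in>{..<n}. mspace (T i))"
  unfolding l1_product_def by (rule Metric_space.mspace_metric[OF Metric_space_l1_product])

lemma mdist_l1_product [simp]:
  "mdist (l1_product n T) x y = (\<Sum>i<n. mdist (T i) (x i) (y i))"
  unfolding l1_product_def by (simp add: Metric_space.mdist_metric[OF Metric_space_l1_product])

definition product_median ::
  "nat \<Rightarrow> (nat \<Rightarrow> 'p \<Rightarrow> 'p \<Rightarrow> 'p \<Rightarrow> 'p) \<Rightarrow> (nat \<Rightarrow> 'p) \<Rightarrow> (nat \<Rightarrow> 'p) \<Rightarrow> (nat \<Rightarrow> 'p) \<Rightarrow> (nat \<Rightarrow> 'p)"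
  where
  "product_median n m x y z = (\<lambda>i\<in>{..<n}. m i (x i) (y i) (z i))"


section \<open>Groups\<close>

definition word_norm :: "('g, 'm) monoid_scheme \<Rightarrow> 'g set \<Rightarrow> 'g \<Rightarrow> nat" where
  "word_norm G S g =
     (LEAST n. \<exists>w. length w = n \<and> set w \<subseteq> S \<union> m_inv G ` S \<and> foldr (mult G) w (one G) = g)"

definition word_dist :: "('g, 'm) monoid_scheme \<Rightarrow> 'g set \<Rightarrow> 'g \<Rightarrow> 'g \<Rightarrow> real" where
  "word_dist G S g h = real (word_norm G S (inv\<^bsub>G\<^esub> g \<otimes>\<^bsub>G\<^esub> h))"

definition isometric_action ::
  "('g, 'm) monoid_scheme \<Rightarrow> 'p metric \<Rightarrow> ('g \<Rightarrow> 'p \<Rightarrow> 'p) \<Rightarrow> bool" where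
  "isometric_action G X \<phi> \<longleftrightarrow>
     group_action G (mspace X) \<phi> \<and> (\<forall>g\<in>carrier G. isometry X X (\<phi> g))"

definition metrically_proper ::
  "('g, 'm) monoid_scheme \<Rightarrow> 'p metric \<Rightarrow> ('g \<Rightarrow> 'p \<Rightarrow> 'p) \<Rightarrow> bool" where
  "metrically_proper G X \<phi> \<longleftrightarrow>
     (\<forall>x\<in>mspace X. \<forall>r.
        finite {g \<in> carrier G. \<phi> g ` mball_of X x r \<inter> mball_of X x r \<noteq> {}})"


section \<open>Hierarchically hyperbolic groups\<close>

definition transverse ::
  "('d \<Rightarrow> 'd \<Rightarrow> bool) \<Rightarrow> ('d \<Rightarrow> 'd \<Rightarrow> bool) \<Rightarrow> 'd \<Rightarrow> 'd \<Rightarrow> bool" where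
  "transverse nest orth U V \<longleftrightarrow> \<not> nest U V \<and> \<not> nest V U \<and> \<not> orth U V"

locale domain_relations =
  fixes nest :: "'d \<Rightarrow> 'd \<Rightarrow> bool" (infix "\<preceq>" 50)
    and orth :: "'d \<Rightarrow> 'd \<Rightarrow> bool" (infix "\<bottom>" 50)
begin

abbreviation properly_nested (infix "\<prec>" 50) where
  "U \<prec> V \<equiv> U \<preceq> V \<and> U \<noteq> V"

abbreviation transv (infix "\<pitchfork>" 50) where
  "U \<pitchfork> V \<equiv> transverse nest orth U V"

end

text \<open>
  \<open>S\<close> is the finite generating set defining the word metric, \<open>E\<close> is the uniqueness
  function, and \<open>E 0\<close> is the constant of the structure. All spaces \<open>C U\<close> have carriers in
  the common type \<open>'p\<close>. The two kinds of relative projections are kept apart: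
  \<open>\<rho> U V\<close> is the bounded subset of \<open>C V\<close> given for \<open>U \<prec> V\<close> or \<open>U \<pitchfork> V\<close>, and
  \<open>\<rho>map V U\<close> is the coarse map from \<open>C V\<close> to \<open>C U\<close> given for \<open>U \<prec> V\<close>.
  Coarse maps are maps into nonempty sets of diameter at most \<open>E 0\<close>. The isometry from
  \<open>C U\<close> to \<open>C (act g U)\<close> given by a group element \<open>g\<close> is \<open>isom g U\<close>.
\<close>

locale hierarchically_hyperbolic_group =
  group G + domain_relations nest orth + dom_act: group_action G Dom act
  for G :: "('g, 'm) monoid_scheme" (structure)
    and S :: "'g set"
    and E :: "real \<Rightarrow> real"
    and Dom :: "'d set"
    and C :: "'d \<Rightarrow> 'p metric"
    and \<pi> :: "'d \<Rightarrow> 'g \<Rightarrow> 'p set"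
    and nest :: "'d \<Rightarrow> 'd \<Rightarrow> bool" (infix "\<preceq>" 50)
    and orth :: "'d \<Rightarrow> 'd \<Rightarrow> bool" (infix "\<bottom>" 50)
    and \<rho> :: "'d \<Rightarrow> 'd \<Rightarrow> 'p set"
    and \<rho>map :: "'d \<Rightarrow> 'd \<Rightarrow> 'p \<Rightarrow> 'p set"
    and act :: "'g \<Rightarrow> 'd \<Rightarrow> 'd"
    and isom :: "'g \<Rightarrow> 'd \<Rightarrow> 'p \<Rightarrow> 'p" +
  assumes generating_set: "finite S" "S \<subseteq> carrier G" "generate G S = carrier G"
    and E_nonneg: "\<And>\<kappa>. \<kappa> \<ge> 0 \<Longrightarrow> E \<kappa> \<ge> 0"
    and hyperbolic: "\<And>U. U \<in> Dom \<Longrightarrow> geodesic_space (C U) \<and> hyperbolic_space (E 0) (C U)"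
    and \<pi>_coarse_map: "\<And>U x. U \<in> Dom \<Longrightarrow> x \<in> carrier G \<Longrightarrow>
          \<pi> U x \<subseteq> mspace (C U) \<and> \<pi> U x \<noteq> {} \<and> diam_le (C U) (\<pi> U x) (E 0)"
    and \<pi>_coarsely_Lipschitz: "\<And>U x y. U \<in> Dom \<Longrightarrow> x \<in> carrier G \<Longrightarrow> y \<in> carrier G \<Longrightarrow>
          set_dist (C U) (\<pi> U x) (\<pi> U y) \<le> E 0 * word_dist G S x y + E 0"
    and \<pi>_coarsely_onto: "\<And>U p. U \<in> Dom \<Longrightarrow> p \<in> mspace (C U) \<Longrightarrow>
          \<exists>x\<in>carrier G. \<exists>q\<in>\<pi> U x. mdist (C U) p q \<le> E 0"
    and nest_order: "reflp_on Dom nest" "antisymp_on Dom nest" "transp_on Dom nest"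
    and nest_maximal: "\<exists>!M. M \<in> Dom \<and> (\<forall>U\<in>Dom. M \<preceq> U \<longrightarrow> U = M)"
    and \<rho>map_coarse_map: "\<And>U V p. U \<in> Dom \<Longrightarrow> V \<in> Dom \<Longrightarrow> U \<prec> V \<Longrightarrow> p \<in> mspace (C V) \<Longrightarrow>
          \<rho>map V U p \<subseteq> mspace (C U) \<and> \<rho>map V U p \<noteq> {} \<and> diam_le (C U) (\<rho>map V U p) (E 0)"
    and \<rho>_bounded: "\<And>U V. U \<in> Dom \<Longrightarrow> V \<in> Dom \<Longrightarrow> U \<prec> V \<or> U \<pitchfork> V \<Longrightarrow>
          \<rho> U V \<subseteq> mspace (C V) \<and> \<rho> U V \<noteq> {} \<and> diam_le (C V) (\<rho> U V) (E 0)"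
    and orth_sym: "symp_on Dom orth" "irreflp_on Dom orth"
    and orth_nest: "\<And>U V W. U \<in> Dom \<Longrightarrow> V \<in> Dom \<Longrightarrow> W \<in> Dom \<Longrightarrow> V \<preceq> W \<Longrightarrow> W \<bottom> U \<Longrightarrow> V \<bottom> U"
    and orth_incomparable: "\<And>V W. V \<in> Dom \<Longrightarrow> W \<in> Dom \<Longrightarrow> V \<bottom> W \<Longrightarrow> \<not> V \<preceq> W \<and> \<not> W \<preceq> V"
    and orth_container: "\<And>T U. T \<in> Dom \<Longrightarrow> U \<in> Dom \<Longrightarrow> U \<preceq> T \<Longrightarrow>
          (\<exists>V\<in>Dom. V \<preceq> T \<and> V \<bottom> U) \<Longrightarrow>
          (\<exists>W\<in>Dom. W \<prec> T \<and> (\<forall>V\<in>Dom. V \<preceq> T \<and> V \<bottom> U \<longrightarrow> V \<preceq> W))"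
    and transverse_consistency: "\<And>U V x. U \<in> Dom \<Longrightarrow> V \<in> Dom \<Longrightarrow> U \<pitchfork> V \<Longrightarrow> x \<in> carrier G \<Longrightarrow>
          min (set_dist (C U) (\<pi> U x) (\<rho> V U)) (set_dist (C V) (\<pi> V x) (\<rho> U V)) \<le> E 0"
    and nest_consistency: "\<And>U V x. U \<in> Dom \<Longrightarrow> V \<in> Dom \<Longrightarrow> U \<prec> V \<Longrightarrow> x \<in> carrier G \<Longrightarrow>
          set_dist (C V) (\<pi> V x) (\<rho> U V) \<le> E 0 \<or>
          diam_le (C U) (\<pi> U x \<union> (\<Union>p\<in>\<pi> V x. \<rho>map V U p)) (E 0)"
    and \<rho>_consistency: "\<And>U V W. U \<in> Dom \<Longrightarrow> V \<in> Dom \<Longrightarrow> W \<in> Dom \<Longrightarrow> U \<preceq> V \<Longrightarrow>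
          V \<prec> W \<or> (V \<pitchfork> W \<and> \<not> W \<bottom> U) \<Longrightarrow> set_dist (C W) (\<rho> U W) (\<rho> V W) \<le> E 0"
    and finite_complexity: "\<exists>n. \<forall>A\<subseteq>Dom. (\<forall>U\<in>A. \<forall>V\<in>A. U \<preceq> V \<or> V \<preceq> U) \<longrightarrow> finite A \<and> card A \<le> n"
  \<comment> \<open>At most \<open>\<lfloor>N\<rfloor>\<close> domains are required: if \<open>W\<close> is minimal there are none, while \<open>N \<ge> 1\<close>.\<close>
    and large_links: "\<exists>L0\<ge>1. \<forall>W\<in>Dom. \<forall>x\<in>carrier G. \<forall>x'\<in>carrier G.
          let N = L0 * set_dist (C W) (\<pi> W x) (\<pi> W x') + L0 in
          \<exists>L\<subseteq>{T \<in> Dom. T \<prec> W}. finite L \<and> int (card L) \<le> \<lfloor>N\<rfloor> \<and>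
            (\<forall>T\<in>Dom. T \<prec> W \<longrightarrow> (\<exists>T'\<in>L. T \<preceq> T') \<or> set_dist (C T) (\<pi> T x) (\<pi> T x') < E 0) \<and>
            (\<forall>T'\<in>L. set_dist (C W) (\<pi> W x) (\<rho> T' W) \<le> N)"
    and bounded_geodesic_image: "\<And>V W p q \<gamma>. V \<in> Dom \<Longrightarrow> W \<in> Dom \<Longrightarrow> V \<prec> W \<Longrightarrow>
          geodesic_segment (C W) p q \<gamma> \<Longrightarrow>
          diam_le (C V) (\<Union>a\<in>\<gamma>. \<rho>map W V a) (E 0) \<or>
          (\<exists>a\<in>\<gamma>. set_dist (C W) {a} (\<rho> V W) \<le> E 0)"
    and partial_realisation: "\<And>A p. A \<subseteq> Dom \<Longrightarrow> pairwise orth A \<Longrightarrow>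
          (\<And>V. V \<in> A \<Longrightarrow> p V \<in> (\<Union>g\<in>carrier G. \<pi> V g)) \<Longrightarrow>
          \<exists>x\<in>carrier G. \<forall>V\<in>A. set_dist (C V) (\<pi> V x) {p V} \<le> E 0 \<and>
            (\<forall>W\<in>Dom. V \<prec> W \<or> W \<pitchfork> V \<longrightarrow> set_dist (C W) (\<pi> W x) (\<rho> V W) \<le> E 0)"
    and uniqueness: "\<And>\<kappa> x y. \<kappa> \<ge> 0 \<Longrightarrow> x \<in> carrier G \<Longrightarrow> y \<in> carrier G \<Longrightarrow>
          (\<And>V. V \<in> Dom \<Longrightarrow> set_dist (C V) (\<pi> V x) (\<pi> V y) < \<kappa>) \<Longrightarrow> word_dist G S x y < E \<kappa>"
  \<comment> \<open>Transversality is preserved because nesting and orthogonality are.\<close>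
    and finitely_many_orbits: "finite (orbits G Dom act)"
    and act_nest: "\<And>g U V. g \<in> carrier G \<Longrightarrow> U \<in> Dom \<Longrightarrow> V \<in> Dom \<Longrightarrow>
          act g U \<preceq> act g V \<longleftrightarrow> U \<preceq> V"
    and act_orth: "\<And>g U V. g \<in> carrier G \<Longrightarrow> U \<in> Dom \<Longrightarrow> V \<in> Dom \<Longrightarrow>
          act g U \<bottom> act g V \<longleftrightarrow> U \<bottom> V"
    and iso_isometry: "\<And>g U. g \<in> carrier G \<Longrightarrow> U \<in> Dom \<Longrightarrow> isometry (C U) (C (act g U)) (isom g U)"
    and iso_mult: "\<And>g h U p. g \<in> carrier G \<Longrightarrow> h \<in> carrier G \<Longrightarrow> U \<in> Dom \<Longrightarrow> p \<in> mspace (C U) \<Longrightarrow>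
          isom (g \<otimes> h) U p = isom g (act h U) (isom h U p)"
    and \<pi>_equivariant: "\<And>g U x. g \<in> carrier G \<Longrightarrow> U \<in> Dom \<Longrightarrow> x \<in> carrier G \<Longrightarrow>
          isom g U ` \<pi> U x = \<pi> (act g U) (g \<otimes> x)"
    and \<rho>_equivariant: "\<And>g U V. g \<in> carrier G \<Longrightarrow> U \<in> Dom \<Longrightarrow> V \<in> Dom \<Longrightarrow> U \<prec> V \<or> U \<pitchfork> V \<Longrightarrow>
          isom g V ` \<rho> U V = \<rho> (act g U) (act g V)"

definition BBF_colouring ::
  "('g, 'm) monoid_scheme \<Rightarrow> 'd set \<Rightarrow> ('d \<Rightarrow> 'd \<Rightarrow> bool) \<Rightarrow> ('d \<Rightarrow> 'd \<Rightarrow> bool) \<Rightarrow>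
   ('g \<Rightarrow> 'd \<Rightarrow> 'd) \<Rightarrow> nat \<Rightarrow> (nat \<Rightarrow> 'd set) \<Rightarrow> bool" where
  "BBF_colouring G Dom nest orth act k D \<longleftrightarrow>
     Dom = (\<Union>i\<in>{1..k}. D i) \<and> disjoint_family_on D {1..k} \<and>
     (\<forall>i\<in>{1..k}. (\<forall>g\<in>carrier G. act g ` D i = D i) \<and> pairwise (transverse nest orth) (D i))"

text \<open>
  A concrete type carrying the geometric realisation of any graph whose vertices are points of
  the spaces \<open>C U\<close>, such as a quasi-tree of metric spaces: a point is given by an edge
  (its two endpoints) together with a position on it.
\<close>

type_synonym ('d, 'p) graph_point = "('d \<times> 'p) \<times> ('d \<times> 'p) \<times> real"

end

theory Submission
  imports Defs "HOL-Library.Sublist"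
begin

text \<open>
  Fix a colour \<open>Y\<close>. Its domains satisfy the projection axioms of Bestvina, Bromberg and Fujiwara:
  Behrstock's inequality follows from consistency and partial realisation, and finiteness from large
  links. Saturating the projections makes the axioms exact: if \<open>V\<close> is between \<open>X\<close> and \<open>U\<close>, then \<open>X\<close>
  and \<open>V\<close> have equal projections to \<open>U\<close>.

  Let \<open>G\<close> act on the graph whose vertices are the points of the spaces \<open>C U\<close> with \<open>U \<in> Y\<close>, two of them
  being adjacent if all their projections are close. The domains in which the projections of \<open>x\<close>
  and \<open>y\<close> are far apart, and geodesics in their spaces, yield a path from \<open>x\<close> to \<open>y\<close>, and by the
  exact axioms and the bottleneck property of the quasi-trees \<open>C U\<close> every other path from \<open>x\<close> to \<open>y\<close>
  passes close to each of its vertices. Hence the components of the complements of balls around a base point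
  form a tree that is \<open>(1, c)\<close>-quasi-isometric to the graph. In particular the graph satisfies the
  four-point condition, so coarse medians exist, are coarsely unique, and are coarsely preserved by isometries.

  Adjacent vertices have close projections, so a bound on the displacement of a group element
  in the graphs of all colours bounds its displacement in all \<open>C U\<close>, hence by uniqueness in \<open>G\<close>.
  This is why the diagonal action on the product of the graphs is metrically proper.
\<close>

section \<open>Distances between bounded sets\<close>

text \<open>The number of domains between two vertices is unbounded, so coarse equalities of
  projections would accumulate errors along it. Exact projections turn these into equalities of
  sets, which inductions over domains pass on without loss.

  Adjacency refers to all domains of a colour at once and involves no choice. So the group acts by
  graph automorphisms, and the distance in the graph bounds the distance of projections linearly.

  Two comparisons with trees play different roles. The spaces \<open>C U\<close> resemble trees only
  up to multiplicative constants, and what is extracted from this is the bottleneck property. The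
  graph has to be compared with a tree up to an additive error alone, because such an error passes
  directly through the four-point condition.

  Constants must not depend on the domain, although each quasi-tree comes with its own; the
  finiteness of the set of orbits provides this.

  Coarse medians are arbitrary choices. An isometry still preserves them coarsely, because being
  almost between each two of three vertices determines a point up to bounded distance.\<close>

lemma mdist_self: "p \<in> mspace X \<Longrightarrow> mdist X p p = 0"
  by simp

text \<open>The infimal distance of sets violates the triangle inequality; the supremal one
  satisfies it for nonempty bounded sets. For sets of diameters at most \<open>r\<close> and
  \<open>s\<close> the two differ by at most \<open>r + s\<close>. The price is that the distance of
  a set from itself can be as large as its diameter, which causes much of the slack below.\<close>

definition sup_dist :: "'p metric \<Rightarrow> 'p set \<Rightarrow> 'p set \<Rightarrow> real" where
  "sup_dist X A B = Sup {mdist X a b | a b. a \<in> A \<and> b \<in> B}"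

definition small_set :: "'p metric \<Rightarrow> real \<Rightarrow> 'p set \<Rightarrow> bool" where
  "small_set X r A \<longleftrightarrow> A \<subseteq> mspace X \<and> A \<noteq> {} \<and> diam_le X A r"

lemma small_set_mono: "small_set X r A \<Longrightarrow> r \<le> s \<Longrightarrow> small_set X s A"
  by (auto simp: small_set_def diam_le_def dest: bspec intro: order_trans[of _ r s])

lemma small_set_singleton: "p \<in> mspace X \<Longrightarrow> 0 \<le> r \<Longrightarrow> small_set X r {p}"
  by (simp add: small_set_def diam_le_def mdist_self)

lemma sup_dist_commute: "sup_dist X A B = sup_dist X B A"
proof -
  have "{mdist X a b | a b. a \<in> A \<and> b \<in> B} = {mdist X b a | a b. a \<in> A \<and> b \<in> B}"
    by (simp add: mdist_commute)
  also have "\<dots> = {mdist X a b | a b. a \<in> B \<and> b \<in> A}" by blast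
  finally show ?thesis unfolding sup_dist_def by (rule arg_cong)
qed

lemma sup_dist_least:
  assumes "A \<noteq> {}" "B \<noteq> {}" "\<And>a b. a \<in> A \<Longrightarrow> b \<in> B \<Longrightarrow> mdist X a b \<le> r"
  shows "sup_dist X A B \<le> r"
  unfolding sup_dist_def using assms by (intro cSup_least) auto

lemma small_set_pair_bound:
  assumes "small_set X r A" "small_set X s B" "a \<in> A" "b \<in> B" "a' \<in> A" "b' \<in> B"
  shows "mdist X a b \<le> mdist X a' b' + r + s"
proof -
  have "a \<in> mspace X" "b \<in> mspace X" "a' \<in> mspace X" "b' \<in> mspace X"
    and "mdist X a a' \<le> r" "mdist X b' b \<le> s"
    using assms by (auto simp: small_set_def diam_le_def)
  then show ?thesis
    using mdist_triangle[of a X a' b] mdist_triangle[of a' X b' b] by linarith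
qed

lemma sup_dist_upper:
  assumes "small_set X r A" "small_set X s B" "a \<in> A" "b \<in> B"
  shows "mdist X a b \<le> sup_dist X A B"
  unfolding sup_dist_def
proof (rule cSup_upper)
  show "bdd_above {mdist X a b |a b. a \<in> A \<and> b \<in> B}"
    using small_set_pair_bound[OF assms(1,2) _ _ assms(3,4)]
    by (intro bdd_aboveI[of _ "mdist X a b + r + s"]) auto
qed (use assms in auto)

lemma sup_dist_triangle:
  assumes "small_set X r A" "small_set X s B" "small_set X t Z"
  shows "sup_dist X A Z \<le> sup_dist X A B + sup_dist X B Z"
proof (rule sup_dist_least)
  fix a z assume az: "a \<in> A" "z \<in> Z"
  obtain b where b: "b \<in> B" using assms by (auto simp: small_set_def)
  have "mdist X a z \<le> mdist X a b + mdist X b z"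
    using assms az b by (intro mdist_triangle) (auto simp: small_set_def)
  then show "mdist X a z \<le> sup_dist X A B + sup_dist X B Z"
    using sup_dist_upper[OF assms(1,2) az(1) b] sup_dist_upper[OF assms(2,3) b az(2)] by linarith
qed (use assms in \<open>auto simp: small_set_def\<close>)

lemma sup_dist_self: "small_set X r A \<Longrightarrow> sup_dist X A A \<le> r"
  by (rule sup_dist_least) (auto simp: small_set_def diam_le_def)

lemma sup_dist_le_mdist:
  assumes "small_set X r A" "small_set X s B" "a \<in> A" "b \<in> B"
  shows "sup_dist X A B \<le> mdist X a b + r + s"
  by (rule sup_dist_least) (use small_set_pair_bound[OF assms(1,2) _ _ assms(3,4)] assms in auto)

lemma sup_dist_singletons [simp]: "sup_dist X {a} {b} = mdist X a b"
  by (simp add: sup_dist_def)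

lemma sup_dist_le_set_dist:
  assumes "small_set X r A" "small_set X s B"
  shows "sup_dist X A B \<le> set_dist X A B + r + s"
proof -
  have "sup_dist X A B - r - s \<le> set_dist X A B"
    unfolding set_dist_def
  proof (rule cInf_greatest)
    show "{mdist X a b |a b. a \<in> A \<and> b \<in> B} \<noteq> {}"
      using assms by (auto simp: small_set_def)
  next
    fix x assume "x \<in> {mdist X a b |a b. a \<in> A \<and> b \<in> B}"
    then obtain a b where "a \<in> A" "b \<in> B" "x = mdist X a b" by auto
    then show "sup_dist X A B - r - s \<le> x"
      using sup_dist_le_mdist[OF assms, of a b] by auto
  qed
  then show ?thesis by linarith
qed

lemma set_dist_le_sup_dist:
  assumes "small_set X r A" "small_set X s B"
  shows "set_dist X A B \<le> sup_dist X A B"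
proof -
  obtain a b where ab: "a \<in> A" "b \<in> B" using assms by (auto simp: small_set_def)
  have "set_dist X A B \<le> mdist X a b"
    unfolding set_dist_def
    by (rule cInf_lower) (use ab in \<open>auto intro!: bdd_belowI[of _ 0]\<close>)
  then show ?thesis using sup_dist_upper[OF assms ab] by linarith
qed

lemma sup_dist_isometry:
  assumes "isometry X Z f" "A \<subseteq> mspace X" "B \<subseteq> mspace X"
  shows "sup_dist Z (f ` A) (f ` B) = sup_dist X A B"
proof -
  have "{mdist Z a b |a b. a \<in> f ` A \<and> b \<in> f ` B} = {mdist X a b |a b. a \<in> A \<and> b \<in> B}"
  proof (intro Set.set_eqI iffI)
    fix t assume "t \<in> {mdist Z a b |a b. a \<in> f ` A \<and> b \<in> f ` B}"
    then obtain a b where "a \<in> A" "b \<in> B" "t = mdist Z (f a) (f b)" by auto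
    then show "t \<in> {mdist X a b |a b. a \<in> A \<and> b \<in> B}"
      using assms unfolding isometry_def by (auto simp: subset_iff)
  next
    fix t assume "t \<in> {mdist X a b |a b. a \<in> A \<and> b \<in> B}"
    then obtain a b where ab: "a \<in> A" "b \<in> B" "t = mdist X a b" by auto
    then have "t = mdist Z (f a) (f b)"
      using assms unfolding isometry_def by (auto simp: subset_iff)
    then show "t \<in> {mdist Z a b |a b. a \<in> f ` A \<and> b \<in> f ` B}" using ab by blast
  qed
  then show ?thesis by (simp add: sup_dist_def)
qed

section \<open>Paths in graphs\<close>

text \<open>Connectedness in the subgraph induced by \<open>A\<close>. Membership of the end points
  is demanded separately because the reflexive closure relates every point to itself.\<close>

definition conn :: "('v \<Rightarrow> 'v \<Rightarrow> bool) \<Rightarrow> 'v set \<Rightarrow> 'v \<Rightarrow> 'v \<Rightarrow> bool" where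
  "conn adj A x y \<longleftrightarrow> x \<in> A \<and> y \<in> A \<and> (\<lambda>u v. adj u v \<and> u \<in> A \<and> v \<in> A)\<^sup>*\<^sup>* x y"

lemma conn_refl: "x \<in> A \<Longrightarrow> conn adj A x x"
  by (simp add: conn_def)

lemma conn_mono:
  assumes "conn adj A x y" "A \<subseteq> B"
  shows "conn adj B x y"
proof -
  have "(\<lambda>u v. adj u v \<and> u \<in> A \<and> v \<in> A)\<^sup>*\<^sup>* \<le> (\<lambda>u v. adj u v \<and> u \<in> B \<and> v \<in> B)\<^sup>*\<^sup>*"
    using assms(2) by (intro rtranclp_mono) auto
  then show ?thesis using assms unfolding conn_def by auto
qed

lemma conn_trans: "conn adj A x y \<Longrightarrow> conn adj A y z \<Longrightarrow> conn adj A x z"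
  unfolding conn_def by (meson rtranclp_trans)

lemma conn_step: "adj x y \<Longrightarrow> x \<in> A \<Longrightarrow> y \<in> A \<Longrightarrow> conn adj A x y"
  unfolding conn_def by (simp add: r_into_rtranclp)

lemma conn_sym:
  assumes "symp adj" "conn adj A x y"
  shows "conn adj A y x"
proof -
  have "symp (\<lambda>u v. adj u v \<and> u \<in> A \<and> v \<in> A)"
    by (rule sympI) (use assms(1) in \<open>blast dest: sympD\<close>)
  then show ?thesis
    using assms(2) unfolding conn_def by (blast intro: sympD[OF symp_rtranclp])
qed

lemma conn_path:
  assumes "conn adj A x y"
  obtains f n where "f 0 = x" "f n = y" "\<And>i. i \<le> n \<Longrightarrow> f i \<in> A"
    "\<And>i. i < n \<Longrightarrow> adj (f i) (f (Suc i))"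
proof -
  obtain n where "((\<lambda>u v. adj u v \<and> u \<in> A \<and> v \<in> A) ^^ n) x y"
    using assms unfolding conn_def by (meson rtranclp_imp_relpowp)
  then obtain f where f: "f 0 = x" "f n = y"
    and step: "\<And>i. i < n \<Longrightarrow> adj (f i) (f (Suc i)) \<and> f i \<in> A \<and> f (Suc i) \<in> A"
    unfolding relpowp_fun_conv by blast
  have "f i \<in> A" if "i \<le> n" for i
  proof (cases "i = n")
    case True
    then show ?thesis using f assms by (simp add: conn_def)
  next
    case False
    then show ?thesis using step[of i] that by simp
  qed
  then show thesis using that f step by blast
qed

lemma path_conn:
  assumes "\<And>i. i \<le> n \<Longrightarrow> f i \<in> A" "\<And>i. i < n \<Longrightarrow> adj (f i) (f (Suc i)) \<or> f i = f (Suc i)"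
  shows "conn adj A (f 0) (f n)"
  using assms
proof (induction n)
  case 0
  then show ?case by (simp add: conn_refl)
next
  case (Suc n)
  have "conn adj A (f n) (f (Suc n))"
    using Suc.prems(1)[of n] Suc.prems(1)[of "Suc n"] Suc.prems(2)[of n] conn_step[of adj "f n" "f (Suc n)" A]
      conn_refl[of "f n" A adj] by auto
  moreover have "conn adj A (f 0) (f n)"
    using Suc.IH Suc.prems by simp
  ultimately show ?case by (rule conn_trans[rotated])
qed

text \<open>Discrete connectedness: the predecessor of the first vertex satisfying \<open>R\<close>
  does not satisfy \<open>R\<close>, hence satisfies \<open>P\<close>. If that first vertex is
  \<open>x\<close>, the pair degenerates to a single vertex.\<close>

lemma conn_switch:
  assumes "conn adj A x y" "P x" "R y" "\<And>z. z \<in> A \<Longrightarrow> P z \<or> R z"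
  shows "\<exists>u\<in>A. \<exists>v\<in>A. (u = v \<or> adj u v) \<and> P u \<and> R v"
proof -
  obtain f n where f: "f 0 = x" "f n = y" "\<And>i. i \<le> n \<Longrightarrow> f i \<in> A"
    and step: "\<And>i. i < n \<Longrightarrow> adj (f i) (f (Suc i))"
    using conn_path[OF assms(1)] by metis
  define j where "j = (LEAST i. R (f i))"
  have j: "R (f j)" "j \<le> n"
    unfolding j_def using f(2) assms(3) by (auto intro: LeastI Least_le)
  show ?thesis
  proof (cases j)
    case 0
    then have "R x" using j f(1) by simp
    moreover have "x \<in> A" using f(1) f(3)[of 0] by simp
    ultimately show ?thesis using assms(2) by blast
  next
    case (Suc i)
    then have "\<not> R (f i)" using not_less_Least[of i "\<lambda>i. R (f i)"] by (simp add: j_def)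
    moreover have "f i \<in> A" "f j \<in> A" "adj (f i) (f j)"
      using f(3)[of i] f(3)[of j] step[of i] j Suc by auto
    ultimately show ?thesis using assms(4)[of "f i"] j by blast
  qed
qed

definition gdist :: "('v \<Rightarrow> 'v \<Rightarrow> bool) \<Rightarrow> 'v \<Rightarrow> 'v \<Rightarrow> nat" where
  "gdist adj u v = (LEAST n. (adj ^^ n) u v)"

locale connected_graph =
  fixes V :: "'v set" and adj :: "'v \<Rightarrow> 'v \<Rightarrow> bool"
  assumes adj_V: "\<And>u v. adj u v \<Longrightarrow> u \<in> V \<and> v \<in> V"
    and adj_sym: "symp adj"
    and adj_irrefl: "\<And>u. \<not> adj u u"
    and connected: "\<And>u v. u \<in> V \<Longrightarrow> v \<in> V \<Longrightarrow> adj\<^sup>*\<^sup>* u v"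
begin

lemma gdist_relpowp:
  assumes "u \<in> V" "v \<in> V"
  shows "(adj ^^ gdist adj u v) u v"
proof -
  obtain n where "(adj ^^ n) u v"
    using connected[OF assms] by (meson rtranclp_imp_relpowp)
  then show ?thesis unfolding gdist_def by (rule LeastI)
qed

lemma gdist_le: "(adj ^^ n) u v \<Longrightarrow> gdist adj u v \<le> n"
  unfolding gdist_def by (rule Least_le)

lemma relpowp_sym: "(adj ^^ n) u v \<Longrightarrow> (adj ^^ n) v u"
proof (induction n arbitrary: v)
  case (Suc n)
  then obtain w where "(adj ^^ n) u w" "adj w v" by auto
  then have "(adj ^^ n) w u" "adj v w" using Suc.IH sympD[OF adj_sym] by auto
  then show ?case by (meson relpowp_Suc_I2)
qed auto

lemma gdist_commute: "gdist adj u v = gdist adj v u"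
  unfolding gdist_def using relpowp_sym by (intro arg_cong[where f = Least] ext) blast

lemma gdist_triangle:
  assumes "u \<in> V" "v \<in> V" "w \<in> V"
  shows "gdist adj u w \<le> gdist adj u v + gdist adj v w"
  using relpowp_trans[OF gdist_relpowp gdist_relpowp] assms by (intro gdist_le) blast

lemma gdist_self [simp]: "gdist adj u u = 0"
  using gdist_le[of 0 u u] by simp

lemma gdist_eq_0: "u \<in> V \<Longrightarrow> v \<in> V \<Longrightarrow> gdist adj u v = 0 \<longleftrightarrow> u = v"
  using gdist_relpowp[of u v] by auto

lemma gdist_adj_le: "adj u v \<Longrightarrow> gdist adj u v \<le> 1"
  using gdist_le[of 1 u v] by (simp add: eq_OO)

lemma gdist_adj:
  assumes "adj u v"
  shows "gdist adj u v = 1"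
proof -
  have "gdist adj u v \<noteq> 0" using gdist_eq_0[of u v] assms adj_V adj_irrefl by auto
  then show ?thesis using gdist_adj_le[OF assms] by simp
qed

lemma gdist_path_le:
  assumes "\<And>i. i \<le> n \<Longrightarrow> f i \<in> V" "\<And>i. i < n \<Longrightarrow> adj (f i) (f (Suc i)) \<or> f i = f (Suc i)"
  shows "gdist adj (f 0) (f n) \<le> n"
  using assms
proof (induction n)
  case (Suc n)
  have "gdist adj (f 0) (f (Suc n)) \<le> gdist adj (f 0) (f n) + gdist adj (f n) (f (Suc n))"
    using Suc.prems(1) by (intro gdist_triangle) auto
  moreover have "gdist adj (f n) (f (Suc n)) \<le> 1"
    using Suc.prems(2)[of n] gdist_adj_le by auto
  moreover have "gdist adj (f 0) (f n) \<le> n"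
    using Suc.IH Suc.prems by simp
  ultimately show ?case by linarith
qed simp

lemma geodesic_path:
  assumes "u \<in> V" "v \<in> V"
  obtains f where "f 0 = u" "f (gdist adj u v) = v"
    "\<And>i. i < gdist adj u v \<Longrightarrow> adj (f i) (f (Suc i))"
    "\<And>i. i \<le> gdist adj u v \<Longrightarrow> f i \<in> V"
    "\<And>i j. i \<le> j \<Longrightarrow> j \<le> gdist adj u v \<Longrightarrow> gdist adj (f i) (f j) = j - i"
proof -
  let ?n = "gdist adj u v"
  obtain f where f: "f 0 = u" "f ?n = v" and step: "\<And>i. i < ?n \<Longrightarrow> adj (f i) (f (Suc i))"
    using gdist_relpowp[OF assms] unfolding relpowp_fun_conv by blast
  have fV: "f i \<in> V" if "i \<le> ?n" for i
  proof (cases "i = ?n")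
    case True
    then show ?thesis using f assms by simp
  next
    case False
    then show ?thesis using step[of i] adj_V that by auto
  qed
  have le: "gdist adj (f i) (f j) \<le> j - i" if "i \<le> j" "j \<le> ?n" for i j
    using gdist_path_le[of "j - i" "\<lambda>k. f (i + k)"] that fV step by auto
  have "gdist adj (f i) (f j) = j - i" if ij: "i \<le> j" "j \<le> ?n" for i j
  proof -
    have "?n \<le> gdist adj (f 0) (f i) + (gdist adj (f i) (f j) + gdist adj (f j) (f ?n))"
      using gdist_triangle[of "f 0" "f i" "f ?n"] gdist_triangle[of "f i" "f j" "f ?n"] fV ij f
      by (metis (no_types, lifting) add_left_mono le_trans order_refl zero_le)
    also have "\<dots> \<le> i + (gdist adj (f i) (f j) + (?n - j))"
      using le[of 0 i] le[of j ?n] ij by simp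
    finally show ?thesis using le[OF ij] ij by linarith
  qed
  then show thesis using that f step fV by blast
qed

end

section \<open>Trees\<close>

text \<open>In the rooted tree of lists, where dropping the last entry leads to the parent, this is
  the Gromov product based at the empty list. So \<open>lcp_len_ultra\<close> is 0-hyperbolicity,
  and \<open>tree_dist\<close> is the path metric.\<close>

definition lcp_len :: "'a list \<Rightarrow> 'a list \<Rightarrow> nat" where
  "lcp_len xs ys = length (longest_common_prefix xs ys)"

lemma le_lcp_len_iff:
  "k \<le> lcp_len xs ys \<longleftrightarrow> k \<le> length xs \<and> k \<le> length ys \<and> take k xs = take k ys"
proof
  obtain us where us: "xs = longest_common_prefix xs ys @ us"
    using longest_common_prefix_prefix1[of xs ys] by (auto simp: prefix_def)
  obtain vs where vs: "ys = longest_common_prefix xs ys @ vs"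
    using longest_common_prefix_prefix2[of xs ys] by (auto simp: prefix_def)
  define ws where "ws = longest_common_prefix xs ys"
  assume "k \<le> lcp_len xs ys"
  then have k: "k \<le> length ws" by (simp add: lcp_len_def ws_def)
  have "xs = ws @ us" "ys = ws @ vs" using us vs by (simp_all add: ws_def)
  then show "k \<le> length xs \<and> k \<le> length ys \<and> take k xs = take k ys"
    using k by simp
next
  assume k: "k \<le> length xs \<and> k \<le> length ys \<and> take k xs = take k ys"
  then have "prefix (take k xs) (longest_common_prefix xs ys)"
    using take_is_prefix[of k xs] take_is_prefix[of k ys]
    by (intro longest_common_prefix_max_prefix) auto
  then have "length (take k xs) \<le> lcp_len xs ys"
    unfolding lcp_len_def by (rule prefix_length_le)
  then show "k \<le> lcp_len xs ys" using k by simp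
qed

lemma lcp_len_le: "lcp_len xs ys \<le> length xs" "lcp_len xs ys \<le> length ys"
  using le_lcp_len_iff[of "lcp_len xs ys" xs ys] by auto

lemma lcp_len_commute: "lcp_len xs ys = lcp_len ys xs"
  using le_lcp_len_iff[of "lcp_len xs ys" ys xs] le_lcp_len_iff[of "lcp_len ys xs" xs ys]
    le_lcp_len_iff[of "lcp_len xs ys" xs ys] le_lcp_len_iff[of "lcp_len ys xs" ys xs] by (simp add: order_antisym)

lemma lcp_len_self [simp]: "lcp_len xs xs = length xs"
  by (rule antisym) (auto simp: lcp_len_le le_lcp_len_iff)

lemma lcp_len_ultra: "min (lcp_len xs ys) (lcp_len ys zs) \<le> lcp_len xs zs" (is "?k \<le> _")
  using le_lcp_len_iff[of ?k xs ys] le_lcp_len_iff[of ?k ys zs] le_lcp_len_iff[of ?k xs zs] by simp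

definition tree_dist :: "'a list \<Rightarrow> 'a list \<Rightarrow> real" where
  "tree_dist xs ys = real (length xs) + real (length ys) - 2 * real (lcp_len xs ys)"

lemma tree_dist_commute: "tree_dist xs ys = tree_dist ys xs"
  by (simp add: tree_dist_def lcp_len_commute)

lemma tree_dist_nonneg: "0 \<le> tree_dist xs ys"
  using lcp_len_le[of xs ys] by (simp add: tree_dist_def)

lemma tree_dist_eq_0: "tree_dist xs ys = 0 \<longleftrightarrow> xs = ys"
proof
  assume "tree_dist xs ys = 0"
  then have "lcp_len xs ys = length xs" "lcp_len xs ys = length ys"
    using lcp_len_le[of xs ys] by (auto simp: tree_dist_def)
  then show "xs = ys" using le_lcp_len_iff[of "lcp_len xs ys" xs ys] by simp
qed (simp add: tree_dist_def)

text \<open>Each of the three sums contains all four lengths once. What remains concerns common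
  prefixes alone and follows from their ultrametric inequality.\<close>

lemma tree_dist_four_point:
  "tree_dist a b + tree_dist c x \<le> max (tree_dist a c + tree_dist b x) (tree_dist a x + tree_dist b c)"
proof -
  have "min (lcp_len a c + lcp_len b x) (lcp_len a x + lcp_len b c) \<le> lcp_len a b + lcp_len c x"
    using lcp_len_ultra[of a c b] lcp_len_ultra[of a x b] lcp_len_ultra[of c a x] lcp_len_ultra[of c b x]
    by (simp add: lcp_len_commute[of c a] lcp_len_commute[of c b] lcp_len_commute[of x b])
  then have "min (real (lcp_len a c) + real (lcp_len b x)) (real (lcp_len a x) + real (lcp_len b c))
      \<le> real (lcp_len a b) + real (lcp_len c x)"
    by linarith
  then show ?thesis unfolding tree_dist_def by linarith
qed

lemma tree_dist_triangle: "tree_dist xs zs \<le> tree_dist xs ys + tree_dist ys zs"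
proof -
  have "lcp_len xs ys + lcp_len ys zs \<le> lcp_len xs zs + length ys"
    using lcp_len_ultra[of xs ys zs] lcp_len_le[of xs ys] lcp_len_le[of ys zs] by linarith
  then show ?thesis unfolding tree_dist_def by linarith
qed

lemma Metric_space_tree_dist:
  assumes "inj_on L N"
  shows "Metric_space N (\<lambda>u v. tree_dist (L u) (L v))"
  using assms
  by unfold_locales
    (auto simp: tree_dist_nonneg tree_dist_commute tree_dist_eq_0 inj_on_eq_iff intro: tree_dist_triangle)

section \<open>Simplicial trees coded by lists\<close>

lemma simple_path_take:
  assumes "simple_path R c p u" "i < length p"
  shows "simple_path R c (take (Suc i) p) (p ! i)"
proof -
  have "successively (\<lambda>a b. (a, b) \<in> R) (take (Suc i) p @ drop (Suc i) p)"
    using assms by (simp add: simple_path_def)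
  then have "successively (\<lambda>a b. (a, b) \<in> R) (take (Suc i) p)"
    unfolding successively_append_iff by blast
  moreover have "hd (take (Suc i) p) = hd p" using assms(2) by (cases p) auto
  moreover have "last (take (Suc i) p) = p ! i" using assms(2) by (simp add: take_Suc_conv_app_nth)
  ultimately show ?thesis using assms by (auto simp: simple_path_def)
qed

lemma simple_path_drop:
  assumes "simple_path R c p u" "i < length p"
  shows "simple_path R (p ! i) (drop i p) u"
proof -
  have "successively (\<lambda>a b. (a, b) \<in> R) (take i p @ drop i p)"
    using assms by (simp add: simple_path_def)
  then have "successively (\<lambda>a b. (a, b) \<in> R) (drop i p)"
    unfolding successively_append_iff by blast
  then show ?thesis using assms by (auto simp: simple_path_def hd_drop_conv_nth)
qed

lemma simple_path_subset:
  assumes "simple_path R c p u" "R \<subseteq> M \<times> M" "c \<in> M"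
  shows "set p \<subseteq> M"
proof
  fix x assume "x \<in> set p"
  then obtain i where i: "i < length p" "x = p ! i" by (auto simp: in_set_conv_nth)
  show "x \<in> M"
  proof (cases i)
    case 0
    then show ?thesis using assms i by (auto simp: simple_path_def hd_conv_nth)
  next
    case (Suc j)
    then have "(p ! j, p ! i) \<in> R"
      using assms(1) i successively_nth[of "\<lambda>a b. (a, b) \<in> R" p j] by (simp add: simple_path_def)
    then show ?thesis using assms(2) i by auto
  qed
qed

lemma tree_metricE:
  assumes "tree_metric T"
  obtains R where "R \<subseteq> mspace T \<times> mspace T" "sym R"
    "\<And>u v. u \<in> mspace T \<Longrightarrow> v \<in> mspace T \<Longrightarrow> \<exists>!p. simple_path R u p v"
    "\<And>u v p. u \<in> mspace T \<Longrightarrow> v \<in> mspace T \<Longrightarrow> simple_path R u p v \<Longrightarrow>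
      mdist T u v = real (length p - 1)"
proof -
  obtain R where R: "R \<subseteq> mspace T \<times> mspace T" "sym R"
    and *: "\<forall>u\<in>mspace T. \<forall>v\<in>mspace T. (\<exists>!p. simple_path R u p v) \<and>
      (\<forall>p. simple_path R u p v \<longrightarrow> mdist T u v = real (length p - 1))"
    using assms unfolding tree_metric_def by - (elim conjE exE, rule that, assumption+)
  show thesis by (rule that[OF R]) (use * in simp_all)
qed

text \<open>A vertex is coded by the simple path to it from a root. The path from \<open>u\<close>
  to \<open>v\<close> goes back to the last common vertex of the two codes and then along the rest
  of the other one. The root at the head of every code cancels in \<open>tree_dist\<close>.\<close>

lemma tree_metric_tree_dist:
  assumes "tree_metric (T :: 'v metric)"
  obtains P :: "'v \<Rightarrow> 'v list" where "\<And>u v. u \<in> mspace T \<Longrightarrow> v \<in> mspace T \<Longrightarrow> mdist T u v = tree_dist (P u) (P v)"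
proof -
  obtain R where R: "R \<subseteq> mspace T \<times> mspace T" "sym R"
    and uniq: "\<And>u v. u \<in> mspace T \<Longrightarrow> v \<in> mspace T \<Longrightarrow> \<exists>!p. simple_path R u p v"
    and dist: "\<And>u v p. u \<in> mspace T \<Longrightarrow> v \<in> mspace T \<Longrightarrow> simple_path R u p v \<Longrightarrow>
      mdist T u v = real (length p - 1)"
    by (rule tree_metricE[OF assms], rule that)
  obtain c where c: "c \<in> mspace T" using assms by (auto simp: tree_metric_def)
  define P where "P u = (THE p. simple_path R c p u)" for u
  have P: "simple_path R c (P u) u" if "u \<in> mspace T" for u
    unfolding P_def by (rule theI'[OF uniq[OF c that]])
  have P_dist: "mdist T u v = tree_dist (P u) (P v)" if uv: "u \<in> mspace T" "v \<in> mspace T" for u v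
  proof -
    define k where "k = lcp_len (P u) (P v)"
    note Pu = P[OF uv(1)] and Pv = P[OF uv(2)]
    have ne: "P u \<noteq> []" "P v \<noteq> []" "hd (P u) = c" "hd (P v) = c" "last (P u) = u" "last (P v) = v"
      "distinct (P u)" "distinct (P v)"
      using Pu Pv by (auto simp: simple_path_def)
    have "1 \<le> k"
      unfolding k_def le_lcp_len_iff using ne by (cases "P u"; cases "P v") auto
    then obtain l where l: "k = Suc l" by (cases k) auto
    have kle: "k \<le> length (P u)" "k \<le> length (P v)" "take k (P u) = take k (P v)"
      using le_lcp_len_iff[of k "P u" "P v"] by (auto simp: k_def)
    have nth_l: "P u ! l = P v ! l"
      using kle(3) l by (metis lessI nth_take)
    \<comment> \<open>The last common vertex has index \<open>l\<close>. It is kept in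
      \<open>A\<close> and left out of \<open>B\<close>, so that the concatenation visits it
      once.\<close>
    define A where "A = drop l (P u)"
    define B where "B = drop k (P v)"
    have A: "A \<noteq> []" "hd A = P u ! l" "last A = u" "distinct A"
      using ne kle(1) l by (auto simp: A_def hd_drop_conv_nth)
    \<comment> \<open>The simple path from the root to a shared vertex is unique, so the codes would
      agree up to that vertex, beyond their longest common prefix.\<close>
    have disj: "set A \<inter> set B = {}"
    proof (rule ccontr)
      assume "set A \<inter> set B \<noteq> {}"
      then obtain x where "x \<in> set A" "x \<in> set B" by blast
      then obtain i j where ij: "i < length A" "j < length B" "x = A ! i" "x = B ! j"
        by (auto simp: in_set_conv_nth)
      define i' where "i' = l + i"
      define j' where "j' = k + j"
      have i': "i' < length (P u)" "x = P u ! i'" using ij(1,3) kle l by (auto simp: A_def i'_def)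
      have j': "j' < length (P v)" "x = P v ! j'" using ij(2,4) kle by (auto simp: B_def j'_def)
      have "x \<in> mspace T"
        using simple_path_subset[OF Pu R(1) c] i' by (auto simp: set_conv_nth)
      then have eq: "take (Suc i') (P u) = take (Suc j') (P v)"
        using uniq[OF c, of x] simple_path_take[OF Pu i'(1)] simple_path_take[OF Pv j'(1)] i' j' by auto
      then have "Suc i' = Suc j'" using i'(1) j'(1) by (metis Suc_leI length_take min.absorb2)
      then have "Suc j' \<le> k"
        unfolding k_def le_lcp_len_iff using eq i'(1) j'(1) by simp
      then show False by (simp add: j'_def)
    qed
    have "simple_path R u (rev A @ B) v"
      unfolding simple_path_def
    proof (intro conjI)
      show "rev A @ B \<noteq> []" "hd (rev A @ B) = u" using A by (auto simp: hd_append hd_rev)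
      show "distinct (rev A @ B)" using A(4) disj ne by (simp add: B_def)
      show "last (rev A @ B) = v"
      proof (cases "B = []")
        case True
        then have "length (P v) = k" using kle by (simp add: B_def)
        then have "v = P v ! l" using ne l by (metis diff_Suc_1 last_conv_nth)
        then show ?thesis using True A nth_l by (simp add: last_rev)
      next
        case False
        then show ?thesis using ne by (simp add: B_def)
      qed
      have sA: "successively (\<lambda>a b. (a, b) \<in> R) A"
        using simple_path_drop[OF Pu, of l] kle l by (simp add: A_def simple_path_def)
      then have "successively (\<lambda>a b. (a, b) \<in> R) (rev A)"
        unfolding successively_rev by (rule successively_mono) (use R(2) in \<open>auto dest: symD\<close>)
      moreover have "successively (\<lambda>a b. (a, b) \<in> R) B"
      proof (cases "B = []")
        case False
        then show ?thesis
          using simple_path_drop[OF Pv, of k] by (simp add: B_def simple_path_def)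
      qed simp
      moreover have "(last (rev A), hd B) \<in> R" if "B \<noteq> []"
      proof -
        have "k < length (P v)" using that by (simp add: B_def)
        then have "(P v ! l, P v ! k) \<in> R"
          using successively_nth[of "\<lambda>a b. (a, b) \<in> R" "P v" l] Pv l by (simp add: simple_path_def)
        then show ?thesis
          using A nth_l \<open>k < length (P v)\<close> by (simp add: last_rev B_def hd_drop_conv_nth)
      qed
      ultimately show "successively (\<lambda>a b. (a, b) \<in> R) (rev A @ B)"
        unfolding successively_append_iff by blast
    qed
    then have "mdist T u v = real (length (rev A @ B) - 1)" by (rule dist[OF uv])
    also have "\<dots> = tree_dist (P u) (P v)"
      using kle(1,2) l by (auto simp: tree_dist_def A_def B_def k_def[symmetric])
    finally show ?thesis .
  qed
  show thesis by (rule that[of P]) (rule P_dist)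
qed

lemma tree_metric_geodesic:
  assumes "tree_metric T" "u \<in> mspace T" "v \<in> mspace T" "real j \<le> mdist T u v"
  obtains c where "c \<in> mspace T" "mdist T u c = real j" "mdist T c v = mdist T u v - real j"
proof -
  obtain R where R: "R \<subseteq> mspace T \<times> mspace T" and "sym R"
    and ex: "\<And>u v. u \<in> mspace T \<Longrightarrow> v \<in> mspace T \<Longrightarrow> \<exists>!p. simple_path R u p v"
    and dist: "\<And>u v p. u \<in> mspace T \<Longrightarrow> v \<in> mspace T \<Longrightarrow> simple_path R u p v \<Longrightarrow>
      mdist T u v = real (length p - 1)"
    by (rule tree_metricE[OF assms(1)], rule that)
  obtain p where p: "simple_path R u p v" using ex[OF assms(2,3)] by blast
  have uv: "mdist T u v = real (length p - 1)" by (rule dist[OF assms(2,3) p])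
  have "p \<noteq> []" using p by (simp add: simple_path_def)
  then have j: "j < length p" using assms(4) uv by (cases p) auto
  have c: "p ! j \<in> mspace T" using simple_path_subset[OF p R assms(2)] j by auto
  have "mdist T u (p ! j) = real j"
    using dist[OF assms(2) c simple_path_take[OF p j]] j by simp
  moreover have "mdist T (p ! j) v = mdist T u v - real j"
    using dist[OF c assms(3) simple_path_drop[OF p j]] j uv by (simp add: of_nat_diff)
  ultimately show thesis using that c by blast
qed

section \<open>Simple paths in the tree of lists\<close>

definition list_adj :: "'a list \<Rightarrow> 'a list \<Rightarrow> bool" where
  "list_adj xs ys \<longleftrightarrow> (\<exists>a. ys = xs @ [a] \<or> xs = ys @ [a])"

definition list_path :: "'a list \<Rightarrow> 'a list list \<Rightarrow> 'a list \<Rightarrow> bool" where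
  "list_path u p v \<longleftrightarrow> p \<noteq> [] \<and> hd p = u \<and> last p = v \<and> distinct p \<and> successively list_adj p"

lemma list_adj_leave:
  assumes "list_adj x y" "prefix w x" "\<not> prefix w y"
  shows "x = w" "y = butlast w"
  using assms by (auto simp: list_adj_def prefix_snoc)

text \<open>The lists with prefix \<open>w\<close> form a subtree joined to the rest by the single
  edge from \<open>w\<close> to \<open>butlast w\<close>. That edge is the only exit here and the
  only entrance in \<open>list_path_stays_off\<close>.\<close>

lemma list_path_stays_above:
  assumes "successively list_adj p" "p \<noteq> []" "prefix w (hd p)" "butlast w \<notin> set p"
  shows "\<forall>x\<in>set p. prefix w x"
  using assms
proof (induction p)
  case (Cons x p)
  show ?case
  proof (cases "p = []")
    case False
    then have "list_adj x (hd p)" using Cons.prems by (simp add: successively_Cons)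
    moreover have "hd p \<noteq> butlast w"
      using Cons.prems(4) hd_in_set[OF False] by (metis list.set_intros(2))
    ultimately have "prefix w (hd p)" using list_adj_leave[of x "hd p" w] Cons.prems by auto
    then show ?thesis using Cons False by (auto simp: successively_Cons)
  qed (use Cons in auto)
qed simp

lemma list_path_stays_off:
  assumes "successively list_adj p" "p \<noteq> []" "\<not> prefix w (hd p)" "w \<notin> set p"
  shows "\<forall>x\<in>set p. \<not> prefix w x"
  using assms
proof (induction p)
  case (Cons x p)
  show ?case
  proof (cases "p = []")
    case False
    then have "list_adj (hd p) x" using Cons.prems by (auto simp: successively_Cons list_adj_def)
    moreover have "hd p \<noteq> w"
      using Cons.prems(4) hd_in_set[OF False] by (metis list.set_intros(2))
    ultimately have "\<not> prefix w (hd p)" using list_adj_leave[of "hd p" x w] Cons.prems by auto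
    then show ?thesis using Cons False by (auto simp: successively_Cons)
  qed (use Cons in auto)
qed simp

text \<open>The first vertex after \<open>u\<close> on the way to \<open>v\<close>; it is a
  neighbour of \<open>u\<close> only if \<open>u \<noteq> v\<close>.\<close>

definition next_node :: "'a list \<Rightarrow> 'a list \<Rightarrow> 'a list" where
  "next_node u v = (if prefix u v then take (Suc (length u)) v else butlast u)"

lemma lcp_len_prefix: "prefix u v \<Longrightarrow> lcp_len u v = length u"
  by (rule antisym) (auto simp: lcp_len_le le_lcp_len_iff prefix_def)

lemma next_node:
  assumes "u \<noteq> v"
  shows "list_adj u (next_node u v)" "tree_dist (next_node u v) v = tree_dist u v - 1"
proof -
  have "list_adj u (next_node u v) \<and> tree_dist (next_node u v) v = tree_dist u v - 1"
  proof (cases "prefix u v")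
    case True
    then obtain a w where v: "v = u @ a # w"
      using assms by (metis append_Nil2 neq_Nil_conv prefixE)
    have "lcp_len (u @ [a]) v = Suc (length u)" using lcp_len_prefix[of "u @ [a]" v] v by simp
    moreover have "lcp_len u v = length u" using lcp_len_prefix[OF True] .
    ultimately show ?thesis using v by (simp add: next_node_def list_adj_def tree_dist_def)
  next
    case False
    then have "u \<noteq> []" by auto
    then obtain w a where u: "u = w @ [a]" by (metis rev_exhaust)
    have "\<not> length u \<le> lcp_len u v"
      using False unfolding le_lcp_len_iff by (metis take_all order_refl take_is_prefix)
    then have "lcp_len u v \<le> length w" using u by simp
    then have "lcp_len w v = lcp_len u v"
      using le_lcp_len_iff[of "lcp_len u v" w v] le_lcp_len_iff[of "lcp_len u v" u v]
        le_lcp_len_iff[of "lcp_len w v" w v] le_lcp_len_iff[of "lcp_len w v" u v] u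
      by (intro antisym) auto
    then show ?thesis using False u by (simp add: next_node_def list_adj_def tree_dist_def)
  qed
  then show "list_adj u (next_node u v)" "tree_dist (next_node u v) v = tree_dist u v - 1" by auto
qed

text \<open>A simple path never returns to \<open>u\<close>. If it starts towards
  \<open>u @ [a]\<close>, it remains among the lists with that prefix, so \<open>v\<close> is one of
  them; if it starts towards the parent, it never enters the lists with prefix \<open>u\<close>. So
  \<open>v\<close> forces the first step, and simple paths are unique by induction.\<close>

lemma list_path_Cons:
  assumes "list_path u (u # p) v" "p \<noteq> []"
  shows "hd p = next_node u v" "list_path (hd p) p v" "u \<noteq> v"
proof -
  have p: "successively list_adj p" "list_adj u (hd p)" "u \<notin> set p" "distinct p" "last p = v"
    using assms by (auto simp: list_path_def successively_Cons)
  have hd_last: "hd p \<in> set p" "v \<in> set p" using assms(2) p(5) by auto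
  show "list_path (hd p) p v" using p assms(2) by (simp add: list_path_def)
  show "u \<noteq> v" using hd_last p(3) by auto
  from p(2) obtain a where "hd p = u @ [a] \<or> u = hd p @ [a]" by (auto simp: list_adj_def)
  then show "hd p = next_node u v"
  proof
    assume q: "hd p = u @ [a]"
    then have "prefix (u @ [a]) v"
      using list_path_stays_above[OF p(1) assms(2), of "u @ [a]"] hd_last p(3) by auto
    then show ?thesis using q by (auto simp: next_node_def prefix_def)
  next
    assume u: "u = hd p @ [a]"
    then have "\<not> prefix u (hd p)" by (auto dest: prefix_length_le)
    then have "\<not> prefix u v"
      using list_path_stays_off[OF p(1) assms(2), of u] hd_last p(3) by auto
    then show ?thesis using u by (simp add: next_node_def)
  qed
qed

lemma list_path_unique: "list_path u p v \<Longrightarrow> list_path u q v \<Longrightarrow> p = q"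
proof (induction p arbitrary: u q)
  case Nil
  then show ?case by (simp add: list_path_def)
next
  case (Cons x p)
  have x: "x = u" using Cons.prems(1) by (simp add: list_path_def)
  obtain q' where q: "q = u # q'" using Cons.prems(2) by (cases q) (auto simp: list_path_def)
  note P = Cons.prems(1)[unfolded x] and Q = Cons.prems(2)[unfolded q]
  show ?case
  proof (cases "p = []")
    case True
    then have "u = v" using P by (simp add: list_path_def)
    then have "q' = []" using list_path_Cons(3)[OF Q] by blast
    then show ?thesis using True x q by simp
  next
    case False
    then have "u \<noteq> v" using list_path_Cons(3)[OF P] by blast
    then have "q' \<noteq> []" using Q by (auto simp: list_path_def)
    then have "p = q'"
      using Cons.IH[of "next_node u v" q'] list_path_Cons(1,2)[OF P False] list_path_Cons(1,2)[OF Q] by simp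
    then show ?thesis using x q by simp
  qed
qed

lemma list_path_length: "list_path u p v \<Longrightarrow> tree_dist u v = real (length p - 1)"
proof (induction p arbitrary: u)
  case Nil
  then show ?case by (simp add: list_path_def)
next
  case (Cons x p)
  have x: "x = u" using Cons.prems by (simp add: list_path_def)
  note P = Cons.prems[unfolded x]
  show ?case
  proof (cases "p = []")
    case True
    then have "u = v" using P by (simp add: list_path_def)
    then show ?thesis using True tree_dist_eq_0[of u v] by simp
  next
    case False
    have "tree_dist (next_node u v) v = real (length p - 1)"
      using Cons.IH list_path_Cons(1,2)[OF P False] by metis
    moreover have "tree_dist (next_node u v) v = tree_dist u v - 1"
      using next_node(2) list_path_Cons(3)[OF P False] .
    ultimately show ?thesis using False by (cases p) auto
  qed
qed

text \<open>The bound on the distance to \<open>v\<close> is carried along for distinctness: the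
  rest of the path is strictly closer to \<open>v\<close> than \<open>u\<close> is.\<close>

lemma list_path_exists:
  assumes "\<And>x y. x \<in> A \<Longrightarrow> prefix y x \<Longrightarrow> y \<in> A" "u \<in> A" "v \<in> A"
  shows "\<exists>p. list_path u p v \<and> set p \<subseteq> A \<and> (\<forall>x\<in>set p. tree_dist x v \<le> tree_dist u v)"
  using assms(2)
proof (induction "nat \<lfloor>tree_dist u v\<rfloor>" arbitrary: u rule: less_induct)
  case less
  show ?case
  proof (cases "u = v")
    case True
    then show ?thesis using less.prems by (intro exI[of _ "[u]"]) (simp add: list_path_def)
  next
    case False
    let ?q = "next_node u v"
    have q: "?q \<in> A"
    proof (cases "prefix u v")
      case True
      then show ?thesis using assms(1)[OF assms(3)] take_is_prefix by (auto simp: next_node_def)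
    next
      case False
      then show ?thesis using assms(1)[OF less.prems] prefixeq_butlast by (auto simp: next_node_def)
    qed
    have d: "tree_dist ?q v = tree_dist u v - 1" by (rule next_node(2)[OF False])
    then have "nat \<lfloor>tree_dist ?q v\<rfloor> < nat \<lfloor>tree_dist u v\<rfloor>"
      using tree_dist_nonneg[of ?q v] by linarith
    then obtain p where p: "list_path ?q p v" "set p \<subseteq> A" "\<forall>x\<in>set p. tree_dist x v \<le> tree_dist ?q v"
      using less.hyps q by blast
    have "u \<notin> set p" using p(3) d by force
    then have "list_path u (u # p) v"
      using p(1) next_node(1)[OF False] by (auto simp: list_path_def successively_Cons)
    moreover have "\<forall>x\<in>set (u # p). tree_dist x v \<le> tree_dist u v" using p(3) d by force
    moreover have "set (u # p) \<subseteq> A" using p(2) less.prems by simp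
    ultimately show ?thesis by blast
  qed
qed

text \<open>Turns a prefix-closed family of codes into a simplicial tree whose vertices may have any
  prescribed type.\<close>

lemma tree_metric_of_lists:
  fixes L :: "'n \<Rightarrow> 'a list"
  assumes "N \<noteq> {}" "inj_on L N" and closed: "\<And>u y. u \<in> N \<Longrightarrow> prefix y (L u) \<Longrightarrow> y \<in> L ` N"
  shows "tree_metric (metric (N, \<lambda>u v. tree_dist (L u) (L v)))" (is "tree_metric ?T")
    and "mspace (metric (N, \<lambda>u v. tree_dist (L u) (L v))) = N"
    and "mdist (metric (N, \<lambda>u v. tree_dist (L u) (L v))) = (\<lambda>u v. tree_dist (L u) (L v))"
proof -
  interpret Metric_space N "\<lambda>u v. tree_dist (L u) (L v)"
    by (rule Metric_space_tree_dist[OF assms(2)])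
  show M: "mspace ?T = N" and d: "mdist ?T = (\<lambda>u v. tree_dist (L u) (L v))"
    by (rule mspace_metric, rule mdist_metric)
  define R where "R = {(x, y). x \<in> N \<and> y \<in> N \<and> list_adj (L x) (L y)}"
  have path_iff: "simple_path R u p v \<longleftrightarrow> list_path (L u) (map L p) (L v) \<and> set p \<subseteq> N"
    if "u \<in> N" "v \<in> N" for u v p
  proof
    assume p: "simple_path R u p v"
    have R: "R \<subseteq> N \<times> N" by (auto simp: R_def)
    have sub: "set p \<subseteq> N" by (rule simple_path_subset[OF p R that(1)])
    have "inj_on L (set p)" using assms(2) sub by (rule inj_on_subset)
    moreover have "successively (\<lambda>x y. list_adj (L x) (L y)) p"
      using p successively_mono[of "\<lambda>a b. (a, b) \<in> R" p "\<lambda>x y. list_adj (L x) (L y)"]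
      by (simp add: simple_path_def R_def)
    ultimately show "list_path (L u) (map L p) (L v) \<and> set p \<subseteq> N"
      using p sub by (auto simp: list_path_def simple_path_def distinct_map hd_map last_map successively_map)
  next
    assume p: "list_path (L u) (map L p) (L v) \<and> set p \<subseteq> N"
    then have ne: "p \<noteq> []" by (auto simp: list_path_def)
    then have "hd p \<in> N" "last p \<in> N" using p by auto
    moreover have "L (hd p) = L u" "L (last p) = L v"
      using p ne by (auto simp: list_path_def hd_map last_map)
    ultimately have "hd p = u" "last p = v" using that assms(2) by (auto dest: inj_onD)
    moreover have "successively (\<lambda>a b. (a, b) \<in> R) p"
      using p unfolding list_path_def successively_map
      using successively_mono[of "\<lambda>x y. list_adj (L x) (L y)" p "\<lambda>a b. (a, b) \<in> R"]
      by (auto simp: R_def)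
    ultimately show "simple_path R u p v" using p ne by (auto simp: list_path_def simple_path_def distinct_map)
  qed
  show "tree_metric ?T"
    unfolding tree_metric_def M d
  proof (intro conjI exI[of _ R] ballI)
    show "N \<noteq> {}" by fact
    show "R \<subseteq> N \<times> N" "sym R" "irrefl R"
      by (auto simp: R_def sym_def irrefl_def list_adj_def)
  next
    fix u v assume uv: "u \<in> N" "v \<in> N"
    obtain p where p: "list_path (L u) p (L v)" "set p \<subseteq> L ` N"
      using list_path_exists[of "L ` N" "L u" "L v"] closed uv by blast
    have "map L (map (inv_into N L) p) = p"
      using p(2) by (auto intro!: map_idI simp: f_inv_into_f subset_iff)
    moreover have "set (map (inv_into N L) p) \<subseteq> N"
      using p(2) by (auto intro: inv_into_into)
    ultimately have ex: "simple_path R u (map (inv_into N L) p) v"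
      using path_iff[OF uv] p(1) by metis
    show "\<exists>!p. simple_path R u p v"
    proof (rule ex1I)
      show "simple_path R u (map (inv_into N L) p) v" by (rule ex)
    next
      fix q assume "simple_path R u q v"
      then have "list_path (L u) (map L q) (L v)" "set q \<subseteq> N" using path_iff[OF uv] by auto
      moreover have "list_path (L u) (map L (map (inv_into N L) p)) (L v)"
        "set (map (inv_into N L) p) \<subseteq> N" using ex path_iff[OF uv] by blast+
      ultimately show "q = map (inv_into N L) p"
        using list_path_unique inj_on_map_eq_map[of L q "map (inv_into N L) p"] assms(2)
        by (metis Un_least inj_on_subset)
    qed
    show "\<forall>p. simple_path R u p v \<longrightarrow> tree_dist (L u) (L v) = real (length p - 1)"
      using path_iff[OF uv] list_path_length by (metis length_map)
  qed
qed

section \<open>Projection families\<close>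

locale projection_family =
  fixes Y :: "'d set" and D :: "'d \<Rightarrow> 'd \<Rightarrow> 'd \<Rightarrow> real" and \<theta> :: real
  assumes \<theta>_pos: "0 < \<theta>"
    and D_sym: "\<And>U X Z. U \<in> Y \<Longrightarrow> X \<in> Y \<Longrightarrow> Z \<in> Y \<Longrightarrow> X \<noteq> U \<Longrightarrow> Z \<noteq> U \<Longrightarrow> D U X Z = D U Z X"
    and D_triangle: "\<And>U X Z W. U \<in> Y \<Longrightarrow> X \<in> Y \<Longrightarrow> Z \<in> Y \<Longrightarrow> W \<in> Y \<Longrightarrow>
      X \<noteq> U \<Longrightarrow> Z \<noteq> U \<Longrightarrow> W \<noteq> U \<Longrightarrow> D U X W \<le> D U X Z + D U Z W"
    and D_refl: "\<And>U X. U \<in> Y \<Longrightarrow> X \<in> Y \<Longrightarrow> X \<noteq> U \<Longrightarrow> D U X X \<le> \<theta>"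
    and behrstock: "\<And>U V X. U \<in> Y \<Longrightarrow> V \<in> Y \<Longrightarrow> X \<in> Y \<Longrightarrow> U \<noteq> V \<Longrightarrow> X \<noteq> U \<Longrightarrow> X \<noteq> V \<Longrightarrow>
      D U X V \<le> \<theta> \<or> D V X U \<le> \<theta>"
begin

text \<open>\<open>behind U X Z\<close>: seen from \<open>U\<close>, the domain \<open>Z\<close> separates \<open>X\<close> from \<open>U\<close> by a definite amount.\<close>

definition behind :: "'d \<Rightarrow> 'd \<Rightarrow> 'd \<Rightarrow> bool" where
  "behind U X Z \<longleftrightarrow> U \<in> Y \<and> X \<in> Y \<and> Z \<in> Y \<and> X \<noteq> Z \<and> X \<noteq> U \<and> Z \<noteq> U \<and> D Z X U > 8 * \<theta>"

definition zigzag :: "'d \<Rightarrow> (nat \<Rightarrow> 'd) \<Rightarrow> nat \<Rightarrow> bool" where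
  "zigzag U f n \<longleftrightarrow> (\<forall>i\<le>n. f i \<in> Y - {U}) \<and>
     (\<forall>i<n. behind U (f i) (f (Suc i)) \<or> behind U (f (Suc i)) (f i))"

text \<open>If \<open>V\<close> sees \<open>X\<close> and \<open>U\<close> far apart, it lies
  between them; hence \<open>X\<close> sees \<open>V\<close> and \<open>U\<close> in the same
  direction.\<close>

lemma order_flip:
  assumes "U \<in> Y" "V \<in> Y" "X \<in> Y" "U \<noteq> V" "X \<noteq> U" "X \<noteq> V" "D V X U > \<theta>"
  shows "D X V U \<le> \<theta>"
  using behrstock[of V X U] D_sym[of V X U] D_sym[of X V U] assms by (auto simp: not_le)

lemma behrstock_imp:
  assumes "U \<in> Y" "V \<in> Y" "X \<in> Y" "U \<noteq> V" "X \<noteq> U" "X \<noteq> V" "D V X U > \<theta>"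
  shows "D U X V \<le> \<theta>"
  using behrstock[of U V X] assms by auto

text \<open>
  The relation \<open>behind U\<close> moves projections to \<open>U\<close> by at most \<open>\<theta>\<close>; the point is that these errors do
  not add up along a zigzag. If the zigzag drifts in \<open>V\<close>, then it starts out behind some \<open>W = f b\<close>
  and ends in front of it. With \<open>b\<close> maximal, the zigzag can only pass \<open>W\<close> by drifting in \<open>W\<close> itself,
  and it does so along a shorter zigzag.
\<close>

lemma zigzag_no_drift:
  assumes U: "U \<in> Y" and V: "V \<in> Y"
    and "zigzag U f n"
    and "V = U \<or> (\<forall>i\<le>n. f i \<noteq> V \<and> D V (f i) U > 2 * \<theta>)"
  shows "D V (f 0) (f n) \<le> 2 * \<theta>"
  using V assms(3,4)
proof (induction n arbitrary: f V rule: less_induct)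
  case (less n)
  note pos = \<theta>_pos
  have fY: "f i \<in> Y" "f i \<noteq> U" if "i \<le> n" for i
    using less.prems(2) that by (auto simp: zigzag_def)
  have step: "behind U (f i) (f (Suc i)) \<or> behind U (f (Suc i)) (f i)" if "i < n" for i
    using less.prems(2) that by (auto simp: zigzag_def)
  have fV: "f i \<noteq> V" if "i \<le> n" for i
    using less.prems(3) fY(2) that by auto
  have V_far: "D (f i) V U \<le> \<theta>" if "i \<le> n" for i
  proof (cases "V = U")
    case True
    then show ?thesis using D_refl[of "f i" U] fY that U by auto
  next
    case False
    then have "D V (f i) U > 2 * \<theta>" using less.prems(3) that by auto
    then show ?thesis
      using order_flip[of U V "f i"] False fY[OF that] fV[OF that] U less.prems(1) pos by auto
  qed
  show ?case
  proof (rule ccontr)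
    assume "\<not> D V (f 0) (f n) \<le> 2 * \<theta>"
    then have contra: "D V (f 0) (f n) > 2 * \<theta>" by simp
    \<comment> \<open>The thresholds 8, 7 and 6 times \<theta> in \<open>behind\<close>,
      \<open>no_upgrade\<close> and here descend because each passage from one to the next costs a
      triangle inequality with error \<theta>.\<close>
    define b where "b = Max {b. b \<le> n \<and> (f b = f 0 \<or> D (f b) (f 0) U > 6 * \<theta>)}"
    have b_in: "b \<in> {b. b \<le> n \<and> (f b = f 0 \<or> D (f b) (f 0) U > 6 * \<theta>)}"
      unfolding b_def by (rule Max_in) auto
    have b_max: "i \<le> b" if "i \<le> n" "f i = f 0 \<or> D (f i) (f 0) U > 6 * \<theta>" for i
      unfolding b_def using that by (intro Max_ge) auto
    define W where "W = f b"
    have bn: "b \<le> n" using b_in by auto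
    have W: "W \<in> Y" "W \<noteq> U" "W \<noteq> V" using fY fV bn by (auto simp: W_def)
    have WVU: "D W V U \<le> \<theta>" using V_far[OF bn] by (simp add: W_def)
    have V_W0: "D V W (f 0) \<le> \<theta>"
    proof (cases "f b = f 0")
      case True
      then show ?thesis using D_refl[of V W] W less.prems(1) by (simp add: W_def)
    next
      case False
      then have "D W (f 0) U > 6 * \<theta>" using b_in by (auto simp: W_def)
      then have "D W (f 0) V > \<theta>"
        using D_triangle[of W "f 0" V U] WVU W fY[of 0] fV[of 0] U less.prems(1) False pos
        by (auto simp: W_def)
      then show ?thesis
        using behrstock_imp[of V W "f 0"] D_sym[of V W "f 0"] W fY[of 0] fV[of 0] less.prems(1) False
        by (auto simp: W_def)
    qed
    have fn_W: "f n \<noteq> W" using contra V_W0 D_sym[of V W "f 0"] less.prems(1) W fY[of 0] fV[of 0] pos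
      by auto
    \<comment> \<open>\<open>V\<close> sees \<open>W\<close> near the start, hence far from the end
      of the zigzag. So \<open>W\<close> sees the end near \<open>V\<close>, and thereby near
      \<open>U\<close>.\<close>
    have end_near: "D W (f n) U \<le> 2 * \<theta>"
    proof -
      have "D V (f n) W > \<theta>"
        using D_triangle[of V "f 0" W "f n"] D_sym[of V W "f 0"] D_sym[of V W "f n"] contra V_W0
          less.prems(1) W fY[of 0] fV[of 0] fY[of n] fV[of n] by auto
      then have "D W (f n) V \<le> \<theta>"
        using behrstock_imp[of W V "f n"] W less.prems(1) fn_W fY[of n] fV[of n] by auto
      then show ?thesis
        using D_triangle[of W "f n" V U] WVU W fn_W fY[of n] U less.prems(1) by auto
    qed
    \<comment> \<open>After \<open>a\<close> the zigzag, seen from \<open>W\<close>, has to come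
      down to within \<open>2 * \<theta>\<close> of \<open>U\<close>. This crossing is what the
      induction hypothesis forbids.\<close>
    define a where "a = Max {i. i \<le> n \<and> (f i = W \<or> D W (f i) U \<ge> 7 * \<theta>)}"
    have a_in: "a \<in> {i. i \<le> n \<and> (f i = W \<or> D W (f i) U \<ge> 7 * \<theta>)}"
      unfolding a_def by (rule Max_in) (use bn in \<open>auto simp: W_def\<close>)
    have a_max: "i \<le> a" if "i \<le> n" "f i = W \<or> D W (f i) U \<ge> 7 * \<theta>" for i
      unfolding a_def using that by (intro Max_ge) auto
    have ba: "b \<le> a" using a_max[of b] bn by (simp add: W_def)
    have an: "a < n"
    proof -
      have "a \<noteq> n" using a_in fn_W end_near pos by auto
      then show ?thesis using a_in by simp
    qed
    \<comment> \<open>Otherwise \<open>f (Suc i)\<close> would be a later candidate for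
      \<open>b\<close>.\<close>
    have no_upgrade: "\<not> D (f (Suc i)) W U > 7 * \<theta>" if "a \<le> i" "i < n" "f (Suc i) \<noteq> W" for i
    proof
      assume up: "D (f (Suc i)) W U > 7 * \<theta>"
      let ?W = "f (Suc i)"
      have W': "?W \<in> Y" "?W \<noteq> U" using fY[of "Suc i"] that by auto
      have "?W = f 0 \<or> D ?W (f 0) U > 6 * \<theta>"
      proof (cases "f b = f 0 \<or> ?W = f 0")
        case True
        then show ?thesis using up pos by (auto simp: W_def)
      next
        case False
        then have 1: "D W (f 0) U > 6 * \<theta>" using b_in by (auto simp: W_def)
        have "D W ?W U \<le> \<theta>"
          using order_flip[of U ?W W] U W W' that(3) up pos by auto
        then have "D W (f 0) ?W > \<theta>"
          using D_triangle[of W "f 0" ?W U] 1 W W' fY[of 0] U False that(3) pos by (auto simp: W_def)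
        then have "D ?W (f 0) W \<le> \<theta>"
          using behrstock_imp[of ?W W "f 0"] W W' fY[of 0] that(3) False by (auto simp: W_def)
        then show ?thesis
          using D_triangle[of ?W W "f 0" U] D_sym[of ?W W "f 0"] up W W' fY[of 0] U False that(3)
          by (auto simp: W_def)
      qed
      then have "Suc i \<le> b" using b_max[of "Suc i"] that by auto
      then show False using ba that by simp
    qed
    have next_W: "f (Suc i) \<noteq> W" if "a \<le> i" "i < n" for i
      using a_max[of "Suc i"] that by auto
    \<comment> \<open>If \<open>f i\<close> is the domain nearer to \<open>U\<close>, it separates
      \<open>f (Suc i)\<close> from \<open>W\<close> as well, so \<open>W\<close> sees the two close
      together. If \<open>f (Suc i)\<close> is nearer, a long step would make it separate
      \<open>W\<close> from \<open>U\<close>, against \<open>no_upgrade\<close>.\<close>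
    have small_step: "D W (f i) (f (Suc i)) \<le> \<theta>"
      if i: "a \<le> i" "i < n" and ne: "f i \<noteq> W" and far: "D W (f i) U > 2 * \<theta>" for i
    proof -
      have mem: "f i \<in> Y" "f i \<noteq> U" "f (Suc i) \<in> Y" "f (Suc i) \<noteq> U" "f (Suc i) \<noteq> W"
        using fY[of i] fY[of "Suc i"] i next_W by auto
      consider "behind U (f (Suc i)) (f i)" | "behind U (f i) (f (Suc i))" using step i by blast
      then show ?thesis
      proof cases
        case 1
        have "D (f i) W U \<le> \<theta>"
          using order_flip[of U W "f i"] U W mem ne far pos by auto
        moreover have "D (f i) (f (Suc i)) U > 8 * \<theta>" "f i \<noteq> f (Suc i)"
          using 1 by (auto simp: behind_def)
        ultimately have "D (f i) (f (Suc i)) W > \<theta>"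
          using D_triangle[of "f i" "f (Suc i)" W U] U W mem ne pos by auto
        then have "D W (f (Suc i)) (f i) \<le> \<theta>"
          using behrstock_imp[of W "f i" "f (Suc i)"] W mem ne \<open>f i \<noteq> f (Suc i)\<close> by auto
        then show ?thesis using D_sym[of W "f i" "f (Suc i)"] W mem ne by auto
      next
        case 2
        then have 3: "D (f (Suc i)) (f i) U > 8 * \<theta>" "f i \<noteq> f (Suc i)"
          by (auto simp: behind_def)
        show ?thesis
        proof (rule ccontr)
          assume "\<not> ?thesis"
          then have "D (f (Suc i)) (f i) W \<le> \<theta>"
            using behrstock[of W "f (Suc i)" "f i"] W mem ne 3 by auto
          then have "D (f (Suc i)) W U > 7 * \<theta>"
            using D_triangle[of "f (Suc i)" "f i" W U] 3 U W mem ne by auto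
          then show False using no_upgrade[OF i] mem by auto
        qed
      qed
    qed
    have fa_W: "f a \<noteq> W"
    proof
      assume eq: "f a = W"
      from step[OF an] show False
      proof
        assume "behind U (f a) (f (Suc a))"
        then have "D (f (Suc a)) W U > 8 * \<theta>" by (simp add: behind_def eq)
        then show False using no_upgrade[of a] an next_W[of a] pos by auto
      next
        assume "behind U (f (Suc a)) (f a)"
        then have "D W (f (Suc a)) U \<ge> 7 * \<theta>" using pos by (simp add: behind_def eq)
        then show False using a_max[of "Suc a"] an by auto
      qed
    qed
    then have fa: "D W (f a) U \<ge> 7 * \<theta>" using a_in by auto
    have start_far: "D W (f (Suc a)) U \<ge> 6 * \<theta>"
    proof -
      have "D W (f a) (f (Suc a)) \<le> \<theta>" using small_step[of a] an fa_W fa pos by auto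
      then show ?thesis
        using D_triangle[of W "f a" "f (Suc a)" U] fa W U fa_W fY[of a] fY[of "Suc a"] an next_W[of a]
        by auto
    qed
    define j where "j = (LEAST j. a < j \<and> j \<le> n \<and> D W (f j) U \<le> 2 * \<theta>)"
    have j: "a < j" "j \<le> n" "D W (f j) U \<le> 2 * \<theta>"
      using LeastI[of "\<lambda>j. a < j \<and> j \<le> n \<and> D W (f j) U \<le> 2 * \<theta>" n] an end_near
      by (auto simp: j_def)
    have before_j: "D W (f i) U > 2 * \<theta>" if "a < i" "i < j" for i
      using not_less_Least[of i "\<lambda>j. a < j \<and> j \<le> n \<and> D W (f j) U \<le> 2 * \<theta>"] that j
      by (auto simp: j_def)
    have "j \<noteq> Suc a" using j start_far pos by auto
    then obtain l where l: "j = Suc (Suc a + l)"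
      using j(1) by (metis Suc_lessI add_Suc_right less_iff_Suc_add add_Suc)
    have not_W: "f i \<noteq> W" if "a < i" "i \<le> n" for i
      using next_W[of "i - 1"] that by auto
    have "D W (f (Suc a + l)) (f j) \<le> \<theta>"
      using small_step[of "Suc a + l"] l j before_j[of "Suc a + l"] not_W[of "Suc a + l"] by auto
    then have last_near: "D W (f (Suc a + l)) U \<le> 3 * \<theta>"
      using D_triangle[of W "f (Suc a + l)" "f j" U] j W U l not_W[of "Suc a + l"] not_W[of j]
        fY[of "Suc a + l"] fY[of j] by auto
    \<comment> \<open>This shorter zigzag stays behind \<open>W\<close> and comes from at least
      \<open>6 * \<theta>\<close> down to at most \<open>3 * \<theta>\<close>, a drift of at least
      \<open>3 * \<theta>\<close>.\<close>
    have "D W (f (Suc a + 0)) (f (Suc a + l)) \<le> 2 * \<theta>"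
    proof (rule less.IH[of l W "\<lambda>i. f (Suc a + i)"])
      show "l < n" using l j by simp
      show "W \<in> Y" by (rule W)
      show "zigzag U (\<lambda>i. f (Suc a + i)) l"
        using less.prems(2) l j by (auto simp: zigzag_def)
      show "W = U \<or> (\<forall>i\<le>l. f (Suc a + i) \<noteq> W \<and> 2 * \<theta> < D W (f (Suc a + i)) U)"
        using not_W before_j l j by auto
    qed
    then show False
      using D_triangle[of W "f (Suc a)" "f (Suc a + l)" U] start_far last_near W U l j pos
        not_W[of "Suc a + l"] not_W[of "Suc a"] fY[of "Suc a + l"] fY[of "Suc a"] by auto
  qed
qed

end

section \<open>The equivalence relation generated by separation\<close>

context projection_family
begin

definition same_side :: "'d \<Rightarrow> 'd \<Rightarrow> 'd \<Rightarrow> bool" where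
  "same_side U = (\<lambda>X Z. behind U X Z \<or> behind U Z X)\<^sup>*\<^sup>*"

lemma same_side_refl: "same_side U X X"
  by (simp add: same_side_def)

lemma same_side_sym: "same_side U X Z \<Longrightarrow> same_side U Z X"
proof -
  have "symp (\<lambda>X Z. behind U X Z \<or> behind U Z X)" by (rule sympI) blast
  then show "same_side U X Z \<Longrightarrow> same_side U Z X"
    unfolding same_side_def by (rule sympD[OF symp_rtranclp])
qed

lemma same_side_trans: "same_side U X Z \<Longrightarrow> same_side U Z W \<Longrightarrow> same_side U X W"
  unfolding same_side_def by (rule rtranclp_trans)

lemma behind_same_side: "behind U X Z \<Longrightarrow> same_side U X Z"
  unfolding same_side_def by (rule r_into_rtranclp) blast

text \<open>The case \<open>V = U\<close> of \<open>zigzag_no_drift\<close>. Its bound does not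
  depend on the number of steps, so it holds for whole equivalence classes.\<close>

lemma same_side_bounded:
  assumes "same_side U X Z" "U \<in> Y" "X \<in> Y" "X \<noteq> U"
  shows "D U X Z \<le> 2 * \<theta>"
proof -
  obtain n where "((\<lambda>X Z. behind U X Z \<or> behind U Z X) ^^ n) X Z"
    using rtranclp_imp_relpowp assms(1) unfolding same_side_def by metis
  then obtain f where f: "f 0 = X" "f n = Z"
    and step: "\<And>i. i < n \<Longrightarrow> behind U (f i) (f (Suc i)) \<or> behind U (f (Suc i)) (f i)"
    unfolding relpowp_fun_conv by blast
  have "f i \<in> Y - {U}" if "i \<le> n" for i
  proof (cases i)
    case 0
    then show ?thesis using f(1) assms(3,4) by simp
  next
    case (Suc j)
    then have "behind U (f j) (f i) \<or> behind U (f i) (f j)" using step[of j] that by simp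
    then show ?thesis unfolding behind_def by blast
  qed
  then have "zigzag U f n" using step unfolding zigzag_def by blast
  then show ?thesis using zigzag_no_drift[of U U f n] assms(2) f by simp
qed

end

text \<open>
  Taking unions turns the coarse equality of projections into an equality of sets, see \<open>Q_exact\<close>.
\<close>

definition saturated_projection ::
  "'d set \<Rightarrow> ('d \<Rightarrow> 'd \<Rightarrow> 'd \<Rightarrow> bool) \<Rightarrow> ('d \<Rightarrow> 'd \<Rightarrow> 'p set) \<Rightarrow> 'd \<Rightarrow> 'd \<Rightarrow> 'p set" where
  "saturated_projection Y rel \<rho> U X = (\<Union>Z\<in>{Z \<in> Y - {U}. rel U X Z}. \<rho> Z U)"

locale metric_projections =
  fixes Y :: "'d set" and C :: "'d \<Rightarrow> 'p metric" and \<rho> :: "'d \<Rightarrow> 'd \<Rightarrow> 'p set" and \<theta> :: real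
  assumes \<theta>_pos: "0 < \<theta>"
    and \<rho>_small: "\<And>U X. U \<in> Y \<Longrightarrow> X \<in> Y \<Longrightarrow> X \<noteq> U \<Longrightarrow> small_set (C U) \<theta> (\<rho> X U)"
    and behrstock: "\<And>U V X. U \<in> Y \<Longrightarrow> V \<in> Y \<Longrightarrow> X \<in> Y \<Longrightarrow> U \<noteq> V \<Longrightarrow> X \<noteq> U \<Longrightarrow> X \<noteq> V \<Longrightarrow>
      sup_dist (C U) (\<rho> X U) (\<rho> V U) \<le> \<theta> \<or> sup_dist (C V) (\<rho> X V) (\<rho> U V) \<le> \<theta>"
    and finite_large: "\<And>X Z. X \<in> Y \<Longrightarrow> Z \<in> Y \<Longrightarrow>
      finite {U \<in> Y - {X, Z}. sup_dist (C U) (\<rho> X U) (\<rho> Z U) > 8 * \<theta>}"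
begin

sublocale projection_family Y "\<lambda>U X Z. sup_dist (C U) (\<rho> X U) (\<rho> Z U)" \<theta>
proof
  fix U X Z W assume "U \<in> Y" "X \<in> Y" "Z \<in> Y" "W \<in> Y" "X \<noteq> U" "Z \<noteq> U" "W \<noteq> U"
  then show "sup_dist (C U) (\<rho> X U) (\<rho> W U)
      \<le> sup_dist (C U) (\<rho> X U) (\<rho> Z U) + sup_dist (C U) (\<rho> Z U) (\<rho> W U)"
    by (intro sup_dist_triangle[OF \<rho>_small \<rho>_small \<rho>_small])
next
  show "0 < \<theta>" by (rule \<theta>_pos)
next
  fix U X Z show "sup_dist (C U) (\<rho> X U) (\<rho> Z U) = sup_dist (C U) (\<rho> Z U) (\<rho> X U)"
    by (rule sup_dist_commute)
next
  fix U X assume "U \<in> Y" "X \<in> Y" "X \<noteq> U"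
  then show "sup_dist (C U) (\<rho> X U) (\<rho> X U) \<le> \<theta>" by (intro sup_dist_self \<rho>_small)
qed (rule behrstock)

abbreviation Q :: "'d \<Rightarrow> 'd \<Rightarrow> 'p set" where
  "Q \<equiv> saturated_projection Y same_side \<rho>"

lemma \<rho>_subset_Q: "X \<in> Y \<Longrightarrow> X \<noteq> U \<Longrightarrow> \<rho> X U \<subseteq> Q U X"
  by (auto simp: saturated_projection_def same_side_refl)

lemma Q_cong:
  assumes "same_side U X Z"
  shows "Q U X = Q U Z"
proof -
  have "same_side U X W \<longleftrightarrow> same_side U Z W" for W
    using assms same_side_sym[of U X Z] same_side_trans[of U X Z W] same_side_trans[of U Z X W]
    by blast
  then show ?thesis by (simp add: saturated_projection_def)
qed

lemma Q_small:
  assumes "U \<in> Y" "X \<in> Y" "X \<noteq> U"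
  shows "small_set (C U) (2 * \<theta>) (Q U X)"
  unfolding small_set_def
proof (intro conjI)
  show "Q U X \<noteq> {}"
    using \<rho>_subset_Q[OF assms(2,3)] \<rho>_small[OF assms] unfolding small_set_def by blast
  show "Q U X \<subseteq> mspace (C U)"
    using \<rho>_small[OF assms(1)] unfolding small_set_def saturated_projection_def by blast
  show "diam_le (C U) (Q U X) (2 * \<theta>)"
    unfolding diam_le_def
  proof (intro ballI)
    fix a b assume "a \<in> Q U X" "b \<in> Q U X"
    then obtain V W where V: "V \<in> Y" "V \<noteq> U" "same_side U X V" "a \<in> \<rho> V U"
      and W: "W \<in> Y" "W \<noteq> U" "same_side U X W" "b \<in> \<rho> W U"
      unfolding saturated_projection_def by blast
    have "mdist (C U) a b \<le> sup_dist (C U) (\<rho> V U) (\<rho> W U)"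
      using sup_dist_upper[OF \<rho>_small[OF assms(1) V(1,2)] \<rho>_small[OF assms(1) W(1,2)] V(4) W(4)] .
    also have "\<dots> \<le> 2 * \<theta>"
      using same_side_bounded[OF same_side_trans[OF same_side_sym[OF V(3)] W(3)] assms(1) V(1,2)] .
    finally show "mdist (C U) a b \<le> 2 * \<theta>" .
  qed
qed

lemma sup_dist_Q_le:
  assumes "U \<in> Y" "X \<in> Y" "X \<noteq> U" "Z \<in> Y" "Z \<noteq> U"
  shows "sup_dist (C U) (Q U X) (Q U Z) \<le> sup_dist (C U) (\<rho> X U) (\<rho> Z U) + 4 * \<theta>"
proof -
  note X = Q_small[OF assms(1-3)] \<rho>_small[OF assms(1-3)] \<rho>_subset_Q[OF assms(2,3)]
  note Z = Q_small[OF assms(1,4,5)] \<rho>_small[OF assms(1,4,5)] \<rho>_subset_Q[OF assms(4,5)]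
  obtain a where a: "a \<in> \<rho> X U" using X by (auto simp: small_set_def)
  obtain b where b: "b \<in> \<rho> Z U" using Z by (auto simp: small_set_def)
  have "sup_dist (C U) (Q U X) (Q U Z) \<le> mdist (C U) a b + 2 * \<theta> + 2 * \<theta>"
    using sup_dist_le_mdist[OF X(1) Z(1), of a b] X(3) Z(3) a b by blast
  then show ?thesis using sup_dist_upper[OF X(2) Z(2) a b] by linarith
qed

text \<open>The threshold is the \<open>8 * \<theta>\<close> of \<open>behind\<close> plus the
  \<open>4 * \<theta>\<close> lost in passing from \<rho> to \<open>Q\<close>. Above it,
  \<open>X\<close> and \<open>V\<close> are in one class for \<open>U\<close>, and
  \<open>Q U\<close> is constant on classes by construction.\<close>

lemma Q_exact:
  assumes "U \<in> Y" "V \<in> Y" "X \<in> Y" "U \<noteq> V" "X \<noteq> V"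
    and "sup_dist (C V) (Q V X) (Q V U) > 12 * \<theta>"
  shows "X \<noteq> U" "Q U X = Q U V"
proof -
  show "X \<noteq> U"
  proof
    assume "X = U"
    then have "sup_dist (C V) (Q V X) (Q V U) \<le> 2 * \<theta>"
      using sup_dist_self[OF Q_small[OF assms(2,1,4)]] by simp
    then show False using assms(6) \<theta>_pos by linarith
  qed
  moreover have "sup_dist (C V) (\<rho> X V) (\<rho> U V) > 8 * \<theta>"
    using sup_dist_Q_le[OF assms(2,3,5,1,4)] assms(6) by linarith
  ultimately have "behind U X V" using assms(1-5) unfolding behind_def by blast
  then show "Q U X = Q U V" by (intro Q_cong behind_same_side)
qed

lemma finite_large_Q:
  assumes "X \<in> Y" "Z \<in> Y"
  shows "finite {U \<in> Y - {X, Z}. sup_dist (C U) (Q U X) (Q U Z) > 12 * \<theta>}"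
proof (rule finite_subset[OF _ finite_large[OF assms]])
  show "{U \<in> Y - {X, Z}. sup_dist (C U) (Q U X) (Q U Z) > 12 * \<theta>}
      \<subseteq> {U \<in> Y - {X, Z}. sup_dist (C U) (\<rho> X U) (\<rho> Z U) > 8 * \<theta>}"
  proof
    fix U assume "U \<in> {U \<in> Y - {X, Z}. sup_dist (C U) (Q U X) (Q U Z) > 12 * \<theta>}"
    then have U: "U \<in> Y" "X \<noteq> U" "Z \<noteq> U" "sup_dist (C U) (Q U X) (Q U Z) > 12 * \<theta>"
      by blast+
    have "sup_dist (C U) (\<rho> X U) (\<rho> Z U) > 8 * \<theta>"
      using sup_dist_Q_le[OF U(1) assms(1) U(2) assms(2) U(3)] U(4) by linarith
    then show "U \<in> {U \<in> Y - {X, Z}. sup_dist (C U) (\<rho> X U) (\<rho> Z U) > 8 * \<theta>}"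
      using U by blast
  qed
qed

end

section \<open>The graph of a projection family\<close>

text \<open>Manning's bottleneck criterion for quasi-trees in discrete form. Chains with jumps
  replace continuous paths because projections of graph paths jump, and \<open>p\<close> need only
  be between the ends up to \<open>r\<close> because projections are sets, not points.\<close>

definition bottleneck :: "'p metric \<Rightarrow> real \<Rightarrow> real \<Rightarrow> real \<Rightarrow> bool" where
  "bottleneck X J r B \<longleftrightarrow>
     (\<forall>p\<in>mspace X. \<forall>f::nat \<Rightarrow> 'p. \<forall>n. (\<forall>i\<le>n. f i \<in> mspace X) \<longrightarrow>
        (\<forall>i<n. mdist X (f i) (f (Suc i)) \<le> J) \<longrightarrow>
        mdist X (f 0) p + mdist X p (f n) \<le> mdist X (f 0) (f n) + r \<longrightarrow>
        (\<exists>i\<le>n. mdist X (f i) p \<le> B))"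

lemma geodesic_chain:
  assumes "geodesic_space X" "p \<in> mspace X" "q \<in> mspace X"
  obtains f :: "nat \<Rightarrow> 'p" where "f 0 = p" "f (nat \<lceil>mdist X p q\<rceil>) = q" "\<And>i. f i \<in> mspace X"
    "\<And>i. mdist X (f i) (f (Suc i)) \<le> 1" "\<And>i. mdist X p (f i) + mdist X (f i) q = mdist X p q"
proof -
  obtain L \<gamma> where L: "L \<ge> 0" "\<gamma> ` {0..L} \<subseteq> mspace X"
    "\<And>s t. s \<in> {0..L} \<Longrightarrow> t \<in> {0..L} \<Longrightarrow> mdist X (\<gamma> s) (\<gamma> t) = \<bar>s - t\<bar>" "\<gamma> 0 = p" "\<gamma> L = q"
    using assms unfolding geodesic_space_def geodesic_segment_def by metis
  have Lpq: "mdist X p q = L" using L(3)[of 0 L] L(1,4,5) by auto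
  define f where "f i = \<gamma> (min (real i) L)" for i
  have in_L: "min (real i) L \<in> {0..L}" for i using L(1) by auto
  have "f 0 = p" using L(1,4) by (simp add: f_def)
  moreover have "f (nat \<lceil>mdist X p q\<rceil>) = q"
    using L(1,5) Lpq real_nat_ceiling_ge[of L] by (simp add: f_def min_absorb2)
  moreover have "f i \<in> mspace X" for i using in_L L(2) by (auto simp: f_def)
  moreover have "mdist X (f i) (f (Suc i)) \<le> 1" for i
    using L(3)[OF in_L in_L, of i "Suc i"] by (auto simp: f_def min_def)
  moreover have "mdist X p (f i) + mdist X (f i) q = mdist X p q" for i
    using L(3)[of 0, OF _ in_L, of i] L(3)[of _ L, OF in_L, of i] L(1,4,5) in_L[of i]
    unfolding Lpq by (auto simp: f_def)
  ultimately show thesis by (rule that)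
qed

locale strong_projections =
  fixes Y :: "'d set" and C :: "'d \<Rightarrow> 'p metric" and Q :: "'d \<Rightarrow> 'd \<Rightarrow> 'p set" and \<kappa> :: real
  assumes \<kappa>_ge1: "1 \<le> \<kappa>"
    and Q_small: "\<And>U X. U \<in> Y \<Longrightarrow> X \<in> Y \<Longrightarrow> X \<noteq> U \<Longrightarrow> small_set (C U) \<kappa> (Q U X)"
    and Q_exact: "\<And>U V X. U \<in> Y \<Longrightarrow> V \<in> Y \<Longrightarrow> X \<in> Y \<Longrightarrow> U \<noteq> V \<Longrightarrow> X \<noteq> V \<Longrightarrow> X \<noteq> U \<Longrightarrow>
      \<kappa> < sup_dist (C V) (Q V X) (Q V U) \<Longrightarrow> Q U X = Q U V"
    and finite_large: "\<And>X Z. X \<in> Y \<Longrightarrow> Z \<in> Y \<Longrightarrow>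
      finite {U \<in> Y - {X, Z}. \<kappa> < sup_dist (C U) (Q U X) (Q U Z)}"
    and geodesic: "\<And>U. U \<in> Y \<Longrightarrow> geodesic_space (C U)"
    and uniform_bottleneck: "\<And>J r. \<exists>B. \<forall>U\<in>Y. bottleneck (C U) J r B"
begin

text \<open>A vertex \<open>(U, p)\<close> is the point \<open>p\<close> of \<open>C U\<close>.\<close>

definition P :: "'d \<Rightarrow> 'd \<times> 'p \<Rightarrow> 'p set" where
  "P U v = (if fst v = U then {snd v} else Q U (fst v))"

definition verts :: "('d \<times> 'p) set" where
  "verts = Sigma Y (\<lambda>U. mspace (C U))"

definition sd :: "'d \<Rightarrow> 'd \<times> 'p \<Rightarrow> 'd \<times> 'p \<Rightarrow> real" where
  "sd U x y = sup_dist (C U) (P U x) (P U y)"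

definition sq :: "'d \<Rightarrow> 'd \<times> 'p \<Rightarrow> 'd \<Rightarrow> real" where
  "sq V x U = sup_dist (C V) (P V x) (Q V U)"

text \<open>The threshold \<open>2 * \<kappa>\<close> leaves room for one triangle inequality with
  error \<kappa> before \<open>exact\<close>, whose threshold is \<kappa>, is applied.\<close>

definition adj :: "'d \<times> 'p \<Rightarrow> 'd \<times> 'p \<Rightarrow> bool" where
  "adj x y \<longleftrightarrow> x \<in> verts \<and> y \<in> verts \<and> x \<noteq> y \<and> (\<forall>U\<in>Y. sd U x y \<le> 2 * \<kappa>)"

lemma vertsI: "U \<in> Y \<Longrightarrow> p \<in> mspace (C U) \<Longrightarrow> (U, p) \<in> verts"
  by (simp add: verts_def)

lemma vertsD: "x \<in> verts \<Longrightarrow> fst x \<in> Y" "x \<in> verts \<Longrightarrow> snd x \<in> mspace (C (fst x))"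
  by (auto simp: verts_def)

lemma P_small: "U \<in> Y \<Longrightarrow> x \<in> verts \<Longrightarrow> small_set (C U) \<kappa> (P U x)"
  unfolding P_def using Q_small[of U "fst x"] vertsD[of x] small_set_singleton[of "snd x" "C U" \<kappa>] \<kappa>_ge1
  by auto

lemma P_mem: "U \<in> Y \<Longrightarrow> x \<in> verts \<Longrightarrow> p \<in> P U x \<Longrightarrow> p \<in> mspace (C U)"
  using P_small[of U x] unfolding small_set_def by blast

lemma P_nonempty: "U \<in> Y \<Longrightarrow> x \<in> verts \<Longrightarrow> \<exists>p. p \<in> P U x"
  using P_small[of U x] unfolding small_set_def by blast

lemma P_own [simp]: "P U (U, p) = {p}"
  by (simp add: P_def)

lemma P_other: "U \<noteq> V \<Longrightarrow> P U (V, p) = Q U V"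
  by (simp add: P_def)

lemma sd_commute: "sd U x y = sd U y x"
  unfolding sd_def by (rule sup_dist_commute)

lemma sd_triangle:
  "U \<in> Y \<Longrightarrow> x \<in> verts \<Longrightarrow> y \<in> verts \<Longrightarrow> z \<in> verts \<Longrightarrow> sd U x z \<le> sd U x y + sd U y z"
  unfolding sd_def by (rule sup_dist_triangle[OF P_small P_small P_small])

lemma sd_self: "U \<in> Y \<Longrightarrow> x \<in> verts \<Longrightarrow> sd U x x \<le> \<kappa>"
  unfolding sd_def by (rule sup_dist_self[OF P_small])

lemma sd_cong: "P U x = P U y \<Longrightarrow> U \<in> Y \<Longrightarrow> y \<in> verts \<Longrightarrow> sd U x y \<le> \<kappa>"
  using sd_self[of U y] by (simp add: sd_def)

lemma adjI:
  "x \<in> verts \<Longrightarrow> y \<in> verts \<Longrightarrow> (\<And>U. U \<in> Y \<Longrightarrow> sd U x y \<le> 2 * \<kappa>) \<Longrightarrow> adj x y \<or> x = y"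
  by (auto simp: adj_def)

lemma adj_symp: "symp adj"
  by (rule sympI) (auto simp: adj_def sd_commute)

text \<open>The last hypothesis says that \<open>V\<close> lies between \<open>x\<close> and \<open>U\<close>.\<close>

lemma exact:
  assumes "U \<in> Y" "V \<in> Y" "U \<noteq> V" "x \<in> verts" "\<kappa> < sq V x U"
  shows "P U x = Q U V"
proof -
  have "fst x \<noteq> U"
  proof
    assume "fst x = U"
    then have "sq V x U = sup_dist (C V) (Q V U) (Q V U)"
      using assms(3) by (simp add: sq_def P_def)
    then show False using assms(5) sup_dist_self[OF Q_small[OF assms(2,1,3)]] by simp
  qed
  then show ?thesis
    using assms Q_exact[of U V "fst x"] vertsD(1)[of x] by (cases "fst x = V") (auto simp: P_def sq_def)
qed

section \<open>Standard paths\<close>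

definition large :: "'d \<times> 'p \<Rightarrow> 'd \<times> 'p \<Rightarrow> 'd set" where
  "large x y = {U \<in> Y. 2 * \<kappa> < sd U x y}"

lemma finite_large_verts:
  assumes "x \<in> verts" "y \<in> verts"
  shows "finite (large x y)"
proof (rule finite_subset)
  show "large x y \<subseteq> {fst x, fst y} \<union>
      {U \<in> Y - {fst x, fst y}. \<kappa> < sup_dist (C U) (Q U (fst x)) (Q U (fst y))}"
    using \<kappa>_ge1 by (auto simp: large_def sd_def P_def)
  show "finite ({fst x, fst y} \<union>
      {U \<in> Y - {fst x, fst y}. \<kappa> < sup_dist (C U) (Q U (fst x)) (Q U (fst y))})"
    using finite_large vertsD(1) assms by simp
qed

text \<open>The slack is the sum of the diameter bounds of the projections of \<open>x\<close> and
  \<open>y\<close>: a point on a geodesic between chosen points of these is measured against the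
  whole sets. The ends are added since their domains need not be large.\<close>

definition between :: "'d \<times> 'p \<Rightarrow> 'd \<times> 'p \<Rightarrow> ('d \<times> 'p) set" where
  "between x y = {x, y} \<union> {z \<in> verts. fst z \<in> large x y \<and>
     sd (fst z) x z + sd (fst z) z y \<le> sd (fst z) x y + 2 * \<kappa>}"

lemma between_commute: "between x y = between y x"
  unfolding between_def large_def by (auto simp: sd_commute add.commute)

text \<open>If \<open>U\<close> still separates \<open>x\<close> from \<open>V\<close>, then
  \<open>V\<close> sees \<open>x\<close> exactly where it sees \<open>U\<close>. As \<open>V\<close>
  sees \<open>y\<close> far from \<open>x\<close>, it lies between \<open>y\<close> and
  \<open>U\<close>, so \<open>U\<close> sees \<open>y\<close> exactly where it sees
  \<open>V\<close>. Hence replacing \<open>y\<close> by \<open>(V, p)\<close> leaves all distances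
  in \<open>U\<close> unchanged.\<close>

lemma large_truncate:
  assumes "x \<in> verts" "y \<in> verts" "V \<in> large x y" "p \<in> P V x"
  shows "large x (V, p) \<subseteq> large x y - {V}" "between x (V, p) \<subseteq> insert (V, p) (between x y)"
proof -
  have V: "V \<in> Y" "2 * \<kappa> < sd V x y" using assms(3) by (auto simp: large_def)
  have p: "p \<in> mspace (C V)" using P_mem V(1) assms by blast
  then have vp: "(V, p) \<in> verts" using V by (simp add: vertsI)
  have "mdist (C V) a p \<le> \<kappa>" if "a \<in> P V x" for a
    using P_small[OF V(1) assms(1)] that assms(4) unfolding small_set_def diam_le_def by blast
  then have "sd V x (V, p) \<le> \<kappa>"
    unfolding sd_def using P_nonempty[OF V(1) assms(1)] by (intro sup_dist_least) auto
  then have notV: "V \<notin> large x (V, p)" using \<kappa>_ge1 by (auto simp: large_def)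
  have eq: "P U (V, p) = P U y" if U: "U \<in> large x (V, p)" for U
  proof -
    have UV: "U \<noteq> V" "U \<in> Y" using U notV by (auto simp: large_def)
    have "\<kappa> < sq U x V" using U UV \<kappa>_ge1 by (auto simp: large_def sd_def sq_def P_other)
    then have "P V x = Q V U" using exact[of V U x] UV V assms by simp
    then have "\<kappa> < sq V y U"
      using V(2) \<kappa>_ge1 by (simp add: sq_def sd_def sup_dist_commute)
    then show ?thesis using exact[of U V y] UV V assms by (simp add: P_other)
  qed
  then have sd_eq: "sd U x (V, p) = sd U x y" "sd U z (V, p) = sd U z y"
    if "U \<in> large x (V, p)" for U z using that by (simp_all add: sd_def)
  show large: "large x (V, p) \<subseteq> large x y - {V}"
  proof
    fix U assume U: "U \<in> large x (V, p)"
    then have "U \<in> Y" "2 * \<kappa> < sd U x y" using sd_eq(1)[OF U] by (simp_all add: large_def)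
    then show "U \<in> large x y - {V}" using U notV by (auto simp: large_def)
  qed
  show "between x (V, p) \<subseteq> insert (V, p) (between x y)"
  proof
    fix z assume z: "z \<in> between x (V, p)"
    show "z \<in> insert (V, p) (between x y)"
    proof (cases "z = x \<or> z = (V, p)")
      case False
      then have zl: "fst z \<in> large x (V, p)" "z \<in> verts"
        "sd (fst z) x z + sd (fst z) z (V, p) \<le> sd (fst z) x (V, p) + 2 * \<kappa>"
        using z by (simp_all add: between_def)
      then have "sd (fst z) x z + sd (fst z) z y \<le> sd (fst z) x y + 2 * \<kappa>"
        using sd_eq(1)[OF zl(1)] sd_eq(2)[OF zl(1), of z] by simp
      then show ?thesis using zl large by (auto simp: between_def)
    qed (auto simp: between_def)
  qed
qed

lemma inner_chain:
  assumes "V \<in> Y" "p \<in> mspace (C V)" "q \<in> mspace (C V)"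
  obtains f :: "nat \<Rightarrow> 'd \<times> 'p" where "f 0 = (V, p)" "f (nat \<lceil>mdist (C V) p q\<rceil>) = (V, q)"
    "\<And>i. f i \<in> verts" "\<And>i. fst (f i) = V" "\<And>i. adj (f i) (f (Suc i)) \<or> f i = f (Suc i)"
    "\<And>i. mdist (C V) p (snd (f i)) + mdist (C V) (snd (f i)) q = mdist (C V) p q"
proof -
  obtain g :: "nat \<Rightarrow> 'p" where g: "g 0 = p" "g (nat \<lceil>mdist (C V) p q\<rceil>) = q" "\<And>i. g i \<in> mspace (C V)"
    "\<And>i. mdist (C V) (g i) (g (Suc i)) \<le> 1"
    "\<And>i. mdist (C V) p (g i) + mdist (C V) (g i) q = mdist (C V) p q"
    using geodesic_chain[OF geodesic[OF assms(1)] assms(2,3)] by blast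
  have verts: "(V, g i) \<in> verts" for i using g(3) assms(1) by (rule vertsI[rotated])
  have "adj (V, g i) (V, g (Suc i)) \<or> (V, g i) = (V, g (Suc i))" for i
  proof (rule adjI[OF verts verts])
    fix U assume U: "U \<in> Y"
    show "sd U (V, g i) (V, g (Suc i)) \<le> 2 * \<kappa>"
    proof (cases "U = V")
      case True
      then show ?thesis using g(4)[of i] \<kappa>_ge1 by (simp add: sd_def)
    next
      case False
      then have "sd U (V, g i) (V, g (Suc i)) \<le> \<kappa>"
        by (intro sd_cong[OF _ U verts]) (simp add: P_other)
      then show ?thesis using \<kappa>_ge1 by simp
    qed
  qed
  then show thesis using that[of "\<lambda>i. (V, g i)"] g verts by auto
qed

text \<open>Any large domain \<open>V\<close> may be chosen: a geodesic in \<open>C V\<close> joins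
  the two projections, and truncation leaves fewer large domains on either side. Vertices without
  large domains are adjacent or equal.\<close>

lemma standard_path:
  assumes "x \<in> verts" "y \<in> verts"
  shows "conn adj (between x y) x y"
  using assms
proof (induction "card (large x y)" arbitrary: x y rule: less_induct)
  case less
  show ?case
  proof (cases "large x y = {}")
    case True
    then have "adj x y \<or> x = y"
      using less.prems by (intro adjI) (auto simp: large_def not_less)
    then show ?thesis
      by (auto simp: between_def intro: conn_step conn_refl)
  next
    case False
    then obtain V where V: "V \<in> large x y" by blast
    then have VY: "V \<in> Y" by (simp add: large_def)
    obtain p where p: "p \<in> P V x" using P_nonempty[OF VY less.prems(1)] by blast
    obtain q where q: "q \<in> P V y" using P_nonempty[OF VY less.prems(2)] by blast
    have pm: "p \<in> mspace (C V)" "q \<in> mspace (C V)" using P_mem VY less.prems p q by blast+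
    have V': "V \<in> large y x" using V by (simp add: large_def sd_commute)
    obtain f where f: "f 0 = (V, p)" "f (nat \<lceil>mdist (C V) p q\<rceil>) = (V, q)"
      "\<And>i. f i \<in> verts" "\<And>i. fst (f i) = V" "\<And>i. adj (f i) (f (Suc i)) \<or> f i = f (Suc i)"
      "\<And>i. mdist (C V) p (snd (f i)) + mdist (C V) (snd (f i)) q = mdist (C V) p q"
      using inner_chain[OF VY pm] by metis
    have in_between: "f i \<in> between x y" for i
    proof -
      have Pf: "P V (f i) = {snd (f i)}" using f(4)[of i] by (simp add: P_def)
      have sm: "small_set (C V) 0 {snd (f i)}"
        using vertsD(2)[OF f(3)[of i]] f(4)[of i] by (intro small_set_singleton) auto
      have "sd V x (f i) \<le> mdist (C V) p (snd (f i)) + \<kappa>"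
        using sup_dist_le_mdist[OF P_small[OF VY less.prems(1)] sm p] by (simp add: sd_def Pf)
      moreover have "sd V (f i) y \<le> mdist (C V) (snd (f i)) q + \<kappa>"
        using sup_dist_le_mdist[OF sm P_small[OF VY less.prems(2)] _ q] by (simp add: sd_def Pf)
      moreover have "mdist (C V) p q \<le> sd V x y"
        unfolding sd_def using sup_dist_upper[OF P_small P_small] VY less.prems p q by blast
      ultimately show ?thesis
        using f(3)[of i] f(4)[of i] f(6)[of i] V by (auto simp: between_def)
    qed
    have pq: "(V, p) \<in> between x y" "(V, q) \<in> between x y"
      using in_between[of 0] in_between[of "nat \<lceil>mdist (C V) p q\<rceil>"] f(1,2) by simp_all
    have "conn adj (between x y) (f 0) (f (nat \<lceil>mdist (C V) p q\<rceil>))"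
      using in_between f(5) by (intro path_conn)
    then have mid: "conn adj (between x y) (V, p) (V, q)" using f(1,2) by simp
    have fin: "finite (large x y)" "finite (large y x)"
      using finite_large_verts less.prems by blast+
    have "large x (V, p) \<subset> large x y"
      using large_truncate(1)[OF less.prems V p] V by blast
    then have "card (large x (V, p)) < card (large x y)" by (intro psubset_card_mono fin)
    then have "conn adj (between x (V, p)) x (V, p)"
      using less.hyps less.prems(1) vertsI[OF VY pm(1)] by blast
    then have 1: "conn adj (between x y) x (V, p)"
      by (rule conn_mono) (use large_truncate(2)[OF less.prems V p] pq in blast)
    have "large y (V, q) \<subset> large y x"
      using large_truncate(1)[OF less.prems(2,1) V' q] V' by blast
    moreover have "large y x = large x y" by (simp add: large_def sd_commute)
    ultimately have "card (large y (V, q)) < card (large x y)"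
      using psubset_card_mono[OF fin(2)] by simp
    then have "conn adj (between y (V, q)) y (V, q)"
      using less.hyps less.prems(2) vertsI[OF VY pm(2)] by blast
    then have "conn adj (between x y) y (V, q)"
      by (rule conn_mono)
        (use large_truncate(2)[OF less.prems(2,1) V' q] pq between_commute[of x y] in blast)
    then have "conn adj (between x y) (V, q) y" by (rule conn_sym[OF adj_symp])
    then show ?thesis using 1 mid conn_trans by metis
  qed
qed

sublocale connected_graph verts adj
proof
  fix u v assume "u \<in> verts" "v \<in> verts"
  then have "conn adj (between u v) u v" by (rule standard_path)
  then have "conn adj UNIV u v" by (rule conn_mono) simp
  then show "adj\<^sup>*\<^sup>* u v" by (simp add: conn_def)
qed (use adj_symp in \<open>auto simp: adj_def\<close>)

section \<open>How projections change along paths\<close>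

lemma gdist_adj_or_eq_le: "adj u v \<or> u = v \<Longrightarrow> gdist adj u v \<le> 1"
  using gdist_adj_le by (elim disjE) simp_all

lemma gdist_inner:
  assumes "V \<in> Y" "p \<in> mspace (C V)" "q \<in> mspace (C V)"
  shows "gdist adj (V, p) (V, q) \<le> nat \<lceil>mdist (C V) p q\<rceil>"
proof -
  obtain f where f: "f 0 = (V, p)" "f (nat \<lceil>mdist (C V) p q\<rceil>) = (V, q)"
    "\<And>i. f i \<in> verts" "\<And>i. fst (f i) = V" "\<And>i. adj (f i) (f (Suc i)) \<or> f i = f (Suc i)"
    "\<And>i. mdist (C V) p (snd (f i)) + mdist (C V) (snd (f i)) q = mdist (C V) p q"
    using inner_chain[OF assms] by metis
  show ?thesis
    using gdist_path_le[of "nat \<lceil>mdist (C V) p q\<rceil>" f] f by simp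
qed

text \<open>The first bound is the length of the detour found in \<open>near_or_same\<close>: an
  edge into some \<open>C W\<close>, at most \<open>3 * \<kappa>\<close> through it, and an edge
  into \<open>C Z\<close>.\<close>

definition near :: "'d \<Rightarrow> 'd \<times> 'p \<Rightarrow> bool" where
  "near Z u \<longleftrightarrow> (\<exists>h\<in>mspace (C Z). gdist adj u (Z, h) \<le> nat \<lceil>3 * \<kappa>\<rceil> + 2 \<and>
     sup_dist (C Z) (P Z u) {h} \<le> \<kappa>)"

text \<open>Here \<open>W1\<close> and \<open>W2\<close> lie in this order between \<open>x\<close> and \<open>Z\<close>. As \<open>W2\<close> does not screen \<open>x'\<close> from \<open>Z\<close>,
  it screens \<open>x'\<close> from \<open>W1\<close>; so \<open>x'\<close> and \<open>Z\<close> agree in \<open>W1\<close>, where \<open>x\<close> is far from them.\<close>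

lemma screens_unique:
  assumes Z: "Z \<in> Y" and x: "x \<in> verts" and x': "adj x x'"
    and W: "W1 \<in> Y" "W1 \<noteq> Z" "2 * \<kappa> < sq W1 x Z" "W2 \<in> Y" "W2 \<noteq> Z" "2 * \<kappa> < sq W2 x Z"
    and small: "sq W2 x' Z \<le> \<kappa>" and ne: "W1 \<noteq> W2" and eq: "P W2 x = Q W2 W1"
  shows False
proof -
  have x'v: "x' \<in> verts" using x' by (simp add: adj_def)
  have QZ: "small_set (C W2) \<kappa> (Q W2 Z)" "small_set (C W2) \<kappa> (Q W2 W1)"
    using Q_small W Z ne by auto
  have far: "2 * \<kappa> < sup_dist (C W2) (Q W2 W1) (Q W2 Z)" using W(6) eq by (simp add: sq_def)
  have "Q W1 Z = Q W1 W2"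
    using Q_exact[of W1 W2 Z] W Z ne far \<kappa>_ge1 by (simp add: sup_dist_commute)
  moreover have "\<kappa> < sq W2 x' W1"
    using sup_dist_triangle[OF QZ(2) P_small[OF W(4) x'v] QZ(1)] far small
    by (simp add: sq_def sup_dist_commute)
  then have "P W1 x' = Q W1 W2" using exact[of W1 W2 x'] W ne x'v by simp
  ultimately have "sq W1 x Z = sd W1 x x'" by (simp add: sq_def sd_def)
  then show False using x' W by (auto simp: adj_def)
qed

text \<open>
  If a domain between \<open>x\<close> and \<open>Z\<close> screens \<open>x'\<close> as well, both have the same projection to \<open>Z\<close>.
  Otherwise at most one domain is between \<open>x\<close> and \<open>Z\<close>, and passing through it gives a short path.
\<close>

lemma near_or_same:
  assumes Z: "Z \<in> Y" and adj: "adj x x'"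
  shows "P Z x = P Z x' \<or> near Z x"
proof (cases "fst x = Z")
  case True
  have "x \<in> verts" using adj by (simp add: adj_def)
  then obtain h where h: "x = (Z, h)" "h \<in> mspace (C Z)" using vertsD(2) True by (metis prod.collapse)
  then have "near Z x"
    unfolding near_def using \<kappa>_ge1 by (intro bexI[of _ h]) (simp_all add: mdist_self)
  then show ?thesis ..
next
  case fst: False
  have x: "x \<in> verts" "x' \<in> verts" using adj by (auto simp: adj_def)
  define A where "A = {W \<in> Y - {Z}. 2 * \<kappa> < sq W x Z}"
  have A_exact: "P Z x = Q Z W" if "W \<in> A" for W
    using exact[of Z W x] that Z x \<kappa>_ge1 by (auto simp: A_def)
  show ?thesis
  proof (cases "\<exists>W\<in>A. \<kappa> < sq W x' Z")
    case True
    then obtain W where W: "W \<in> A" "\<kappa> < sq W x' Z" by blast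
    then have "P Z x' = Q Z W" using exact[of Z W x'] Z x by (auto simp: A_def)
    then show ?thesis using A_exact[OF W(1)] by simp
  next
    case False
    then have unscreened: "sq W x' Z \<le> \<kappa>" if "W \<in> A" for W using that by auto
    have unique: "W1 = W2" if W: "W1 \<in> A" "W2 \<in> A" for W1 W2
    proof (rule ccontr)
      assume ne: "W1 \<noteq> W2"
      have W': "W1 \<in> Y" "W1 \<noteq> Z" "2 * \<kappa> < sq W1 x Z" "W2 \<in> Y" "W2 \<noteq> Z" "2 * \<kappa> < sq W2 x Z"
        using W by (auto simp: A_def)
      \<comment> \<open>The two cases tell which of the two domains comes first on the way from
        \<open>x\<close> to \<open>Z\<close>.\<close>
      show False
      proof (cases "\<kappa> < sq W1 x W2")
        case True
        then have "P W2 x = Q W2 W1" using exact[of W2 W1 x] W' ne x by simp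
        then show False
          using screens_unique[OF Z x(1) adj W' unscreened[OF W(2)] ne] by simp
      next
        case False
        have QW: "small_set (C W1) \<kappa> (Q W1 Z)" "small_set (C W1) \<kappa> (Q W1 W2)"
          using Q_small W' Z ne by auto
        have "\<kappa> < sup_dist (C W1) (Q W1 Z) (Q W1 W2)"
          using sup_dist_triangle[OF P_small[OF W'(1) x(1)] QW(2,1)] False W'(3)
          by (simp add: sq_def sup_dist_commute)
        then have "Q W2 Z = Q W2 W1" using Q_exact[of W2 W1 Z] W' Z ne by simp
        then have "\<kappa> < sq W2 x W1" using W'(6) \<kappa>_ge1 by (simp add: sq_def)
        then have "P W1 x = Q W1 W2" using exact[of W1 W2 x] W' ne x by simp
        then show False
          using screens_unique[OF Z x(1) adj W'(4-6,1-3) unscreened[OF W(1)]] ne by simp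
      qed
    qed
    show ?thesis
    proof (cases "A = {}")
      case True
      obtain h where h: "h \<in> P Z x" using P_nonempty[OF Z x(1)] by blast
      have hm: "h \<in> mspace (C Z)" using P_mem[OF Z x(1) h] .
      have hZ: "sup_dist (C Z) (P Z x) {h} \<le> \<kappa>"
        using P_small[OF Z x(1)] h by (intro sup_dist_least) (auto simp: small_set_def diam_le_def)
      have "adj x (Z, h) \<or> x = (Z, h)"
      proof (rule adjI[OF x(1) vertsI[OF Z hm]])
        fix U assume U: "U \<in> Y"
        show "sd U x (Z, h) \<le> 2 * \<kappa>"
        proof (cases "U = Z")
          case True
          then show ?thesis using hZ \<kappa>_ge1 by (simp add: sd_def)
        next
          case False
          then have "\<not> 2 * \<kappa> < sq U x Z" using U \<open>A = {}\<close> by (auto simp: A_def)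
          then show ?thesis using False by (simp add: sd_def sq_def P_other)
        qed
      qed
      then have "gdist adj x (Z, h) \<le> 1" by (rule gdist_adj_or_eq_le)
      then have "near Z x" unfolding near_def using hm hZ by (intro bexI[of _ h]) auto
      then show ?thesis ..
    next
      case False
      then obtain W where W: "W \<in> A" by blast
      have WY: "W \<in> Y" "W \<noteq> Z" "2 * \<kappa> < sq W x Z" using W by (auto simp: A_def)
      have only: "U = W" if "U \<in> Y" "U \<noteq> Z" "2 * \<kappa> < sq U x Z" for U
        using unique[of U W] W that by (auto simp: A_def)
      have QWZ: "small_set (C W) \<kappa> (Q W Z)" "small_set (C Z) \<kappa> (Q Z W)" using Q_small WY Z by auto
      have "sq W x Z \<le> sd W x x' + sq W x' Z"
        unfolding sd_def sq_def by (rule sup_dist_triangle[OF P_small[OF WY(1) x(1)] P_small[OF WY(1) x(2)] QWZ(1)])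
      \<comment> \<open>\<open>W\<close> does not separate \<open>x'\<close> from \<open>Z\<close>,
        and the edge from \<open>x\<close> to \<open>x'\<close> moves the projection to
        \<open>W\<close> by at most \<open>2 * \<kappa>\<close>.\<close>
      then have len: "sq W x Z \<le> 3 * \<kappa>" using unscreened[OF W] adj WY by (auto simp: adj_def)
      obtain p1 where p1: "p1 \<in> P W x" using P_nonempty[OF WY(1) x(1)] by blast
      obtain p2 where p2: "p2 \<in> Q W Z" using QWZ by (auto simp: small_set_def)
      obtain h where h: "h \<in> Q Z W" using QWZ by (auto simp: small_set_def)
      have pm: "p1 \<in> mspace (C W)" "p2 \<in> mspace (C W)" "h \<in> mspace (C Z)"
        using P_mem[OF WY(1) x(1) p1] p2 h QWZ by (auto simp: small_set_def)
      have hZ: "sup_dist (C Z) (Q Z W) {h} \<le> \<kappa>"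
        using QWZ(2) h by (intro sup_dist_least) (auto simp: small_set_def diam_le_def)
      \<comment> \<open>A domain other than \<open>W\<close> that sees \<open>x\<close> far from
        \<open>W\<close> lies between them. It cannot be \<open>Z\<close>, and any other one would
        also lie between \<open>x\<close> and \<open>Z\<close>, where \<open>W\<close> is the only
        such domain.\<close>
      have "adj x (W, p1) \<or> x = (W, p1)"
      proof (rule adjI[OF x(1) vertsI[OF WY(1) pm(1)]])
        fix U assume U: "U \<in> Y"
        show "sd U x (W, p1) \<le> 2 * \<kappa>"
        proof (cases "U = W")
          case True
          have "sup_dist (C W) (P W x) {p1} \<le> \<kappa>"
            using P_small[OF WY(1) x(1)] p1 by (intro sup_dist_least) (auto simp: small_set_def diam_le_def)
          then show ?thesis using True \<kappa>_ge1 by (simp add: sd_def)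
        next
          case UW: False
          show ?thesis
          proof (rule ccontr)
            assume "\<not> ?thesis"
            then have far: "2 * \<kappa> < sq U x W" using UW by (simp add: sd_def sq_def P_other)
            then have PWx: "P W x = Q W U" using exact[of W U x] U UW WY x \<kappa>_ge1 by simp
            show False
            proof (cases "U = Z")
              case True
              then show False
                using PWx WY(3) sup_dist_self[OF QWZ(1)] \<kappa>_ge1 by (simp add: sq_def)
            next
              case False
              have "Q U Z = Q U W"
                using Q_exact[of U W Z] U UW WY Z False PWx \<kappa>_ge1 by (simp add: sq_def sup_dist_commute)
              then have "2 * \<kappa> < sq U x Z" using far by (simp add: sq_def)
              then show False using only[OF U False] UW by simp
            qed
          qed
        qed
      qed
      then have d1: "gdist adj x (W, p1) \<le> 1" by (rule gdist_adj_or_eq_le)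
      have "mdist (C W) p1 p2 \<le> sq W x Z"
        unfolding sq_def by (rule sup_dist_upper[OF P_small[OF WY(1) x(1)] QWZ(1) p1 p2])
      then have "nat \<lceil>mdist (C W) p1 p2\<rceil> \<le> nat \<lceil>3 * \<kappa>\<rceil>" using len by (intro nat_mono ceiling_mono) simp
      then have d2: "gdist adj (W, p1) (W, p2) \<le> nat \<lceil>3 * \<kappa>\<rceil>"
        using gdist_inner[OF WY(1) pm(1,2)] by linarith
      \<comment> \<open>Likewise, a third domain separating \<open>W\<close> from \<open>Z\<close>
        would also separate \<open>x\<close> from \<open>Z\<close>.\<close>
      have "adj (W, p2) (Z, h) \<or> (W, p2) = (Z, h)"
      proof (rule adjI[OF vertsI[OF WY(1) pm(2)] vertsI[OF Z pm(3)]])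
        fix U assume U: "U \<in> Y"
        consider "U = W" | "U = Z" | "U \<noteq> W" "U \<noteq> Z" by blast
        then show "sd U (W, p2) (Z, h) \<le> 2 * \<kappa>"
        proof cases
          case 1
          have "sup_dist (C W) {p2} (Q W Z) \<le> \<kappa>"
            using QWZ(1) p2 by (intro sup_dist_least) (auto simp: small_set_def diam_le_def)
          then show ?thesis using 1 WY(2) \<kappa>_ge1 by (simp add: sd_def P_other)
        next
          case 2
          then show ?thesis using hZ WY(2) \<kappa>_ge1 by (simp add: sd_def P_other)
        next
          case 3
          show ?thesis
          proof (rule ccontr)
            assume "\<not> ?thesis"
            then have far: "2 * \<kappa> < sup_dist (C U) (Q U W) (Q U Z)" using 3 by (simp add: sd_def P_other)
            then have "Q W Z = Q W U"
              using Q_exact[of W U Z] U 3 WY Z \<kappa>_ge1 by (simp add: sup_dist_commute)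
            then have "\<kappa> < sq W x U" using WY(3) \<kappa>_ge1 by (simp add: sq_def)
            then have "P U x = Q U W" using exact[of U W x] U 3 WY x by simp
            then have "2 * \<kappa> < sq U x Z" using far by (simp add: sq_def)
            then show False using only[OF U 3(2)] 3(1) by simp
          qed
        qed
      qed
      then have d3: "gdist adj (W, p2) (Z, h) \<le> 1" by (rule gdist_adj_or_eq_le)
      have "gdist adj x (Z, h) \<le> nat \<lceil>3 * \<kappa>\<rceil> + 2"
        using gdist_triangle[OF x(1) vertsI[OF WY(1) pm(1)] vertsI[OF Z pm(3)]]
          gdist_triangle[OF vertsI[OF WY(1) pm(1)] vertsI[OF WY(1) pm(2)] vertsI[OF Z pm(3)]] d1 d2 d3
        by linarith
      then have "near Z x"
        unfolding near_def using pm(3) hZ A_exact[OF W] by (intro bexI[of _ h]) auto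
      then show ?thesis ..
    qed
  qed
qed

text \<open>
  A path from \<open>x\<close> to \<open>y\<close> projects to a chain in \<open>C Z\<close>, which passes close to \<open>z\<close> by the bottleneck
  property. The projection only moves while the path is near \<open>Z\<close>, so the path itself passes close to \<open>z\<close>.
\<close>

lemma between_close:
  "\<exists>\<Delta>. \<forall>x\<in>verts. \<forall>y\<in>verts. \<forall>z\<in>between x y. \<forall>A. conn adj A x y \<longrightarrow> (\<exists>a\<in>A. gdist adj a z \<le> \<Delta>)"
proof -
  \<comment> \<open>Edges move projections by at most \<open>2 * \<kappa>\<close>. The excess
    \<open>4 * \<kappa>\<close> is the slack of \<open>between\<close> plus
    \<open>2 * \<kappa>\<close> for replacing the projections of the ends by points in them.\<close>
  obtain B where B: "\<And>U. U \<in> Y \<Longrightarrow> bottleneck (C U) (2 * \<kappa>) (4 * \<kappa>) B"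
    using uniform_bottleneck by blast
  define \<Delta> where "\<Delta> = nat \<lceil>3 * \<kappa>\<rceil> + 2 + nat \<lceil>\<kappa> + B\<rceil>"
  have "\<exists>a\<in>A. gdist adj a z \<le> \<Delta>"
    if xy: "x \<in> verts" "y \<in> verts" and z: "z \<in> between x y" and A: "conn adj A x y" for x y z A
  proof (cases "z = x \<or> z = y")
    case True
    then have "z \<in> A" using A by (auto simp: conn_def)
    then show ?thesis by (intro bexI[of _ z]) auto
  next
    case False
    define Z where "Z = fst z"
    have zv: "z \<in> verts" and Z_large: "Z \<in> large x y"
      and btw: "sd Z x z + sd Z z y \<le> sd Z x y + 2 * \<kappa>"
      using z False by (auto simp: between_def Z_def)
    have Z: "Z \<in> Y" "2 * \<kappa> < sd Z x y" using Z_large by (auto simp: large_def)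
    have Pz: "P Z z = {snd z}" by (simp add: P_def Z_def)
    have zm: "snd z \<in> mspace (C Z)" using vertsD(2)[OF zv] by (simp add: Z_def)
    obtain f n where f: "f 0 = x" "f n = y" and fA: "\<And>i. i \<le> n \<Longrightarrow> f i \<in> A"
      and step: "\<And>i. i < n \<Longrightarrow> adj (f i) (f (Suc i))"
      using conn_path[OF A] by metis
    have fv: "f i \<in> verts" if "i \<le> n" for i
    proof (cases "i = n")
      case False
      then show ?thesis using step[of i] that by (auto simp: adj_def)
    qed (use f xy in simp)
    define p where "p i = (SOME q. q \<in> P Z (f i))" for i
    have p: "p i \<in> P Z (f i)" if "i \<le> n" for i
      unfolding p_def using P_nonempty[OF Z(1) fv[OF that]] by (rule someI_ex)
    have upper: "mdist (C Z) a b \<le> sd Z u v" if "u \<in> verts" "v \<in> verts" "a \<in> P Z u" "b \<in> P Z v" for a b u v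
      unfolding sd_def by (rule sup_dist_upper[OF P_small[OF Z(1) that(1)] P_small[OF Z(1) that(2)] that(3,4)])
    have sm: "small_set (C Z) \<kappa> (P Z x)" "small_set (C Z) \<kappa> (P Z y)" using P_small Z xy by blast+
    have "sd Z x y \<le> mdist (C Z) (p 0) (p n) + 2 * \<kappa>"
      using sup_dist_le_mdist[OF sm, of "p 0" "p n"] p[of 0] p[of n] f by (simp add: sd_def)
    moreover have "mdist (C Z) (p 0) (snd z) \<le> sd Z x z" "mdist (C Z) (snd z) (p n) \<le> sd Z z y"
      using upper[OF xy(1) zv, of "p 0" "snd z"] upper[OF zv xy(2), of "snd z" "p n"] p[of 0] p[of n] f Pz
      by simp_all
    ultimately have "mdist (C Z) (p 0) (snd z) + mdist (C Z) (snd z) (p n)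
        \<le> mdist (C Z) (p 0) (p n) + 4 * \<kappa>"
      using btw by linarith
    moreover have "\<forall>i\<le>n. p i \<in> mspace (C Z)" using P_mem[OF Z(1) fv p] by blast
    moreover have "\<forall>i<n. mdist (C Z) (p i) (p (Suc i)) \<le> 2 * \<kappa>"
    proof (intro allI impI)
      fix i assume i: "i < n"
      then have "mdist (C Z) (p i) (p (Suc i)) \<le> sd Z (f i) (f (Suc i))"
        using upper[OF fv[of i] fv[of "Suc i"]] p[of i] p[of "Suc i"] by simp
      also have "\<dots> \<le> 2 * \<kappa>" using step[OF i] Z(1) by (simp add: adj_def)
      finally show "mdist (C Z) (p i) (p (Suc i)) \<le> 2 * \<kappa>" .
    qed
    ultimately obtain i where i: "i \<le> n" "mdist (C Z) (p i) (snd z) \<le> B"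
      using B[OF Z(1)] zm unfolding bottleneck_def by blast
    \<comment> \<open>Going forwards and backwards from \<open>f i\<close>, the projection cannot
      change before the path is near \<open>Z\<close>. If this never happened, \<open>x\<close> and
      \<open>y\<close> would have equal projections, although \<open>Z\<close> is large for
      them.\<close>
    have "\<exists>j\<le>n. near Z (f j) \<and> P Z (f j) = P Z (f i)"
    proof (rule ccontr)
      assume none: "\<not> ?thesis"
      have up: "P Z (f (i + j)) = P Z (f i)" if "i + j \<le> n" for j
        using that
      proof (induction j)
        case (Suc j)
        then have eq: "P Z (f (i + j)) = P Z (f i)" by simp
        then have "\<not> near Z (f (i + j))" using none Suc.prems by auto
        then have "P Z (f (i + j)) = P Z (f (Suc (i + j)))"
          using near_or_same[OF Z(1) step[of "i + j"]] Suc.prems by simp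
        then show ?case using eq by simp
      qed simp
      have down: "P Z (f (i - j)) = P Z (f i)" if "j \<le> i" for j
        using that
      proof (induction j)
        case (Suc j)
        then have eq: "P Z (f (i - j)) = P Z (f i)" by simp
        then have "\<not> near Z (f (i - j))" using none i by auto
        moreover have "adj (f (i - j)) (f (i - Suc j))"
          using step[of "i - Suc j"] Suc.prems i sympD[OF adj_symp] by (simp add: Suc_diff_Suc)
        ultimately have "P Z (f (i - j)) = P Z (f (i - Suc j))"
          using near_or_same[OF Z(1)] by blast
        then show ?case using eq by simp
      qed simp
      have "P Z x = P Z y"
        using up[of "n - i"] down[of i] i f by simp
      then have "sd Z x y \<le> \<kappa>" using sd_cong Z(1) xy by blast
      then show False using Z(2) \<kappa>_ge1 by simp
    qed
    then obtain j where j: "j \<le> n" "near Z (f j)" "P Z (f j) = P Z (f i)" by blast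
    obtain h where h: "h \<in> mspace (C Z)" "gdist adj (f j) (Z, h) \<le> nat \<lceil>3 * \<kappa>\<rceil> + 2"
      "sup_dist (C Z) (P Z (f j)) {h} \<le> \<kappa>" using j(2) by (auto simp: near_def)
    have pi: "p i \<in> P Z (f j)" "p i \<in> mspace (C Z)" using p[OF i(1)] j(3) P_mem[OF Z(1) fv[OF i(1)]] by auto
    have "mdist (C Z) (p i) h \<le> \<kappa>"
      using sup_dist_upper[OF P_small[OF Z(1) fv[OF j(1)]] small_set_singleton[OF h(1)] pi(1), of 0 h] h(3)
      by simp
    then have "mdist (C Z) h (snd z) \<le> \<kappa> + B"
      using mdist_triangle[OF h(1) pi(2) zm] i(2) mdist_commute[of "C Z" h "p i"] by linarith
    then have "nat \<lceil>mdist (C Z) h (snd z)\<rceil> \<le> nat \<lceil>\<kappa> + B\<rceil>" by (intro nat_mono ceiling_mono)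
    then have "gdist adj (Z, h) (Z, snd z) \<le> nat \<lceil>\<kappa> + B\<rceil>"
      using gdist_inner[OF Z(1) h(1) zm] by (rule order_trans[rotated])
    then have "gdist adj (Z, h) z \<le> nat \<lceil>\<kappa> + B\<rceil>" by (simp add: Z_def)
    then have "gdist adj (f j) z \<le> \<Delta>"
      using gdist_triangle[OF fv[OF j(1)] vertsI[OF Z(1) h(1)] zv] h(2) by (simp add: \<Delta>_def)
    then show ?thesis using fA[OF j(1)] by blast
  qed
  then show ?thesis by blast
qed

end

section \<open>Four-point condition, bottlenecks and coarse medians\<close>

definition four_point :: "'p metric \<Rightarrow> real \<Rightarrow> bool" where
  "four_point X \<eta> \<longleftrightarrow> (\<forall>a\<in>mspace X. \<forall>b\<in>mspace X. \<forall>c\<in>mspace X. \<forall>x\<in>mspace X.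
     mdist X a b + mdist X c x \<le> max (mdist X a c + mdist X b x) (mdist X a x + mdist X b c) + \<eta>)"

lemma tree_metric_four_point:
  assumes "tree_metric (T :: 'a metric)"
  shows "four_point T 0"
proof -
  obtain P :: "'a \<Rightarrow> 'a list" where P: "\<And>u v. u \<in> mspace T \<Longrightarrow> v \<in> mspace T \<Longrightarrow> mdist T u v = tree_dist (P u) (P v)"
    using tree_metric_tree_dist[OF assms] by metis
  show ?thesis
    unfolding four_point_def
  proof (intro ballI)
    fix a b c x assume "a \<in> mspace T" "b \<in> mspace T" "c \<in> mspace T" "x \<in> mspace T"
    then show "mdist T a b + mdist T c x
        \<le> max (mdist T a c + mdist T b x) (mdist T a x + mdist T b c) + 0"
      using tree_dist_four_point[of "P a" "P b" "P c" "P x"] by (simp add: P)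
  qed
qed

text \<open>In terms of Gromov products based at \<open>c\<close>: these are ultrametric, so they stay above \<open>s\<close>
  along a chain that avoids \<open>c\<close>.\<close>

lemma chain_meets_center:
  fixes f :: "nat \<Rightarrow> 'p"
  assumes T: "four_point T 0" and f: "\<And>i. i \<le> n \<Longrightarrow> f i \<in> mspace T"
    and step: "\<And>i. i < n \<Longrightarrow> mdist T (f i) (f (Suc i)) \<le> J" and J: "0 \<le> J"
    and c: "c \<in> mspace T" "mdist T (f 0) c + mdist T c (f n) \<le> mdist T (f 0) (f n) + 2 * s"
  shows "\<exists>i\<le>n. mdist T (f i) c \<le> J / 2 + s"
proof (rule ccontr)
  assume "\<not> ?thesis"
  then have far: "mdist T (f i) c > J / 2 + s" if "i \<le> n" for i using that by auto
  have "mdist T (f 0) c + mdist T (f i) c - mdist T (f 0) (f i) > 2 * s" if "i \<le> n" for i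
    using that
  proof (induction i)
    case 0
    then show ?case using far[of 0] J mdist_self[OF f[of 0]] by simp
  next
    case (Suc i)
    have "mdist T (f 0) (f (Suc i)) + mdist T c (f i)
        \<le> max (mdist T (f 0) c + mdist T (f (Suc i)) (f i)) (mdist T (f 0) (f i) + mdist T (f (Suc i)) c)"
      using T c(1) f[of 0] f[of i] f[of "Suc i"] Suc.prems unfolding four_point_def by fastforce
    moreover have "mdist T (f (Suc i)) (f i) \<le> J"
      using step[of i] Suc.prems by (simp add: mdist_commute)
    moreover have "mdist T c (f i) = mdist T (f i) c" by (rule mdist_commute)
    ultimately show ?case using Suc far[of i] far[of "Suc i"] by (auto simp: max_def split: if_splits)
  qed
  from this[of n] show False using c(2) mdist_commute[of T c "f n"] by simp
qed

text \<open>The center lies on the path from \<open>u\<close> to \<open>v\<close>, at a distance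
  from \<open>u\<close> given by the Gromov product \<open>t\<close>. In a tree this product is an
  integer; rounding it down instead of showing so costs at most 2.\<close>

lemma tree_center:
  assumes T: "tree_metric T" and uvw: "u \<in> mspace T" "v \<in> mspace T" "w \<in> mspace T"
  obtains c where "c \<in> mspace T" "mdist T u c + mdist T c v \<le> mdist T u v + 2"
    "mdist T u c + mdist T c w \<le> mdist T u w + 2" "mdist T v c + mdist T c w \<le> mdist T v w + 2"
proof -
  define t where "t = (mdist T u v + mdist T u w - mdist T v w) / 2"
  define j where "j = nat \<lfloor>t\<rfloor>"
  have t: "0 \<le> t" "t \<le> mdist T u v"
    using mdist_triangle[OF uvw(2,1,3)] mdist_triangle[OF uvw(1,2,3)] mdist_commute[of T u v]
    by (auto simp: t_def)
  then have j: "real j \<le> t" "t \<le> real j + 1" by (auto simp: j_def)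
  obtain c where c: "c \<in> mspace T" "mdist T u c = real j" "mdist T c v = mdist T u v - real j"
    using tree_metric_geodesic[OF T uvw(1,2), of j] j t by auto
  have "mdist T w c + mdist T u v \<le> max (mdist T w u + mdist T c v) (mdist T w v + mdist T c u)"
    using tree_metric_four_point[OF T] uvw c(1) unfolding four_point_def by fastforce
  also have "\<dots> \<le> mdist T u w + mdist T u v - real j"
    using c j mdist_commute[of T w u] mdist_commute[of T w v] mdist_commute[of T c u] by (auto simp: t_def)
  finally have "mdist T c w \<le> mdist T u w - real j" by (simp add: mdist_commute)
  then show thesis
    using that[OF c(1)] c j mdist_commute[of T v c] by (auto simp: t_def)
qed

text \<open>
  In the tree, every coarse path joining two of the images of \<open>a\<close>, \<open>b\<close> and \<open>p\<close> passes close to their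
  center. Two such paths come from geodesics from \<open>p\<close> to \<open>a\<close> and \<open>b\<close>, and as \<open>p\<close> is almost between
  \<open>a\<close> and \<open>b\<close>, they can only meet near \<open>p\<close>.
\<close>

lemma quasi_tree_bottleneck:
  assumes "quasi_tree (X :: 'p metric)"
  shows "\<exists>B. bottleneck X J r B"
proof -
  obtain T :: "('p \<times> nat) metric" and f where geo: "geodesic_space X" and T: "tree_metric T"
    and f: "quasi_isometry X T f"
    using assms unfolding quasi_tree_def by blast
  obtain K c where K: "1 \<le> K" "0 \<le> c" and fX: "f ` mspace X \<subseteq> mspace T"
    and lower: "\<And>x y. x \<in> mspace X \<Longrightarrow> y \<in> mspace X \<Longrightarrow> mdist X x y / K - c \<le> mdist T (f x) (f y)"
    and upper: "\<And>x y. x \<in> mspace X \<Longrightarrow> y \<in> mspace X \<Longrightarrow> mdist T (f x) (f y) \<le> K * mdist X x y + c"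
    using f unfolding quasi_isometry_def by blast
  have fm: "f x \<in> mspace T" if "x \<in> mspace X" for x using fX that by blast
  have pull: "mdist X x y \<le> K * (D + c)"
    if "x \<in> mspace X" "y \<in> mspace X" "mdist T (f x) (f y) \<le> D" for x y D
  proof -
    have "mdist X x y / K \<le> D + c" using lower[OF that(1,2)] that(3) by linarith
    then show ?thesis using K by (simp add: field_simps)
  qed
  note four = tree_metric_four_point[OF T]
  define J' where "J' = max J 0"
  define D where "D = K * ((K + c + 2) + c)"
  define D' where "D' = K * (((K * J' + c) / 2 + 1 + ((K + c) / 2 + 1)) + c)"
  have "bottleneck X J r (D' + (D + r))"
    unfolding bottleneck_def
  proof (intro ballI allI impI)
    fix p and g :: "nat \<Rightarrow> 'p" and n
    assume p: "p \<in> mspace X" and g: "\<forall>i\<le>n. g i \<in> mspace X"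
      and step: "\<forall>i<n. mdist X (g i) (g (Suc i)) \<le> J"
      and btw: "mdist X (g 0) p + mdist X p (g n) \<le> mdist X (g 0) (g n) + r"
    have ab: "g 0 \<in> mspace X" "g n \<in> mspace X" using g by auto
    obtain z where z: "z \<in> mspace T"
      "mdist T (f (g 0)) z + mdist T z (f (g n)) \<le> mdist T (f (g 0)) (f (g n)) + 2"
      "mdist T (f (g 0)) z + mdist T z (f p) \<le> mdist T (f (g 0)) (f p) + 2"
      "mdist T (f (g n)) z + mdist T z (f p) \<le> mdist T (f (g n)) (f p) + 2"
      using tree_center[OF T fm[OF ab(1)] fm[OF ab(2)] fm[OF p]] by blast
    have geod: "\<exists>q\<in>mspace X. mdist X a q + mdist X q p = mdist X a p \<and> mdist T (f q) z \<le> (K + c) / 2 + 1"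
      if a: "a \<in> mspace X" "mdist T (f a) z + mdist T z (f p) \<le> mdist T (f a) (f p) + 2" for a
    proof -
      obtain h :: "nat \<Rightarrow> 'p" where h: "h 0 = a" "h (nat \<lceil>mdist X a p\<rceil>) = p" "\<And>i. h i \<in> mspace X"
        "\<And>i. mdist X (h i) (h (Suc i)) \<le> 1" "\<And>i. mdist X a (h i) + mdist X (h i) p = mdist X a p"
        using geodesic_chain[OF geo a(1) p] by blast
      have "mdist T (f (h i)) (f (h (Suc i))) \<le> K + c" for i
        using upper[OF h(3)[of i] h(3)[of "Suc i"]] mult_left_mono[OF h(4)[of i], of K] K by linarith
      then obtain i where "mdist T (f (h i)) z \<le> (K + c) / 2 + 1"
        using chain_meets_center[OF four, of "nat \<lceil>mdist X a p\<rceil>" "\<lambda>i. f (h i)" "K + c" z 1]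
          fm[OF h(3)] K z(1) a(2) h(1,2) by auto
      then show ?thesis using h(3,5) by blast
    qed
    obtain q1 where q1: "q1 \<in> mspace X" "mdist X (g 0) q1 + mdist X q1 p = mdist X (g 0) p"
      "mdist T (f q1) z \<le> (K + c) / 2 + 1" using geod[OF ab(1) z(3)] by blast
    obtain q2 where q2: "q2 \<in> mspace X" "mdist X (g n) q2 + mdist X q2 p = mdist X (g n) p"
      "mdist T (f q2) z \<le> (K + c) / 2 + 1" using geod[OF ab(2) z(4)] by blast
    have "mdist T (f q1) (f q2) \<le> K + c + 2"
      using mdist_triangle[OF fm[OF q1(1)] z(1) fm[OF q2(1)]] q1(3) q2(3) mdist_commute[of T z "f q2"]
      by (simp add: field_simps)
    then have "mdist X q1 q2 \<le> D" unfolding D_def by (rule pull[OF q1(1) q2(1)])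
    \<comment> \<open>\<open>q1\<close> and \<open>q2\<close> lie on geodesics from the two ends to
      \<open>p\<close>. A shortcut between them has length at most \<open>D\<close> and saves the
      way to \<open>p\<close> and back, so the betweenness of \<open>p\<close> bounds that way by
      \<open>D + r\<close>.\<close>
    then have near_p: "mdist X q1 p \<le> D + r"
      using mdist_triangle[OF ab(1) q1(1) ab(2)] mdist_triangle[OF q1(1) q2(1) ab(2)] btw q1(2) q2(2)
        mdist_commute[of X q2 "g n"] mdist_commute[of X p "g n"] mdist_nonneg[of X q2 p] by linarith
    have "mdist T (f (g i)) (f (g (Suc i))) \<le> K * J' + c" if "i < n" for i
    proof -
      have "mdist X (g i) (g (Suc i)) \<le> J'" using step that by (auto simp: J'_def)
      then have "K * mdist X (g i) (g (Suc i)) \<le> K * J'" using K by simp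
      then show ?thesis using upper[of "g i" "g (Suc i)"] g that by auto
    qed
    then obtain i where i: "i \<le> n" "mdist T (f (g i)) z \<le> (K * J' + c) / 2 + 1"
      using chain_meets_center[OF four, of n "\<lambda>i. f (g i)" "K * J' + c" z 1] fm g K z(1,2)
      by (auto simp: J'_def)
    have gi: "g i \<in> mspace X" using g i(1) by blast
    have "mdist T (f (g i)) (f q1) \<le> (K * J' + c) / 2 + 1 + ((K + c) / 2 + 1)"
      using mdist_triangle[OF fm[OF gi] z(1) fm[OF q1(1)]] i(2) q1(3) mdist_commute[of T z "f q1"]
      by linarith
    then have "mdist X (g i) q1 \<le> D'" unfolding D'_def by (rule pull[OF gi q1(1)])
    then have "mdist X (g i) p \<le> D' + (D + r)"
      using mdist_triangle[OF gi q1(1) p] near_p by linarith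
    then show "\<exists>i\<le>n. mdist X (g i) p \<le> D' + (D + r)" using i(1) by blast
  qed
  then show ?thesis ..
qed

lemma bottleneck_isometry:
  assumes "bottleneck X J r B" "isometry X Z h"
  shows "bottleneck Z J r B"
  unfolding bottleneck_def
proof (intro ballI allI impI)
  have surj: "h ` mspace X = mspace Z"
    and iso: "\<And>x y. x \<in> mspace X \<Longrightarrow> y \<in> mspace X \<Longrightarrow> mdist Z (h x) (h y) = mdist X x y"
    using assms(2) by (auto simp: isometry_def)
  define k where "k = inv_into (mspace X) h"
  have k: "k x \<in> mspace X" "h (k x) = x" if "x \<in> mspace Z" for x
    using that unfolding surj[symmetric] k_def by (auto intro: inv_into_into f_inv_into_f)
  have dk: "mdist X (k x) (k y) = mdist Z x y" if "x \<in> mspace Z" "y \<in> mspace Z" for x y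
    using iso[of "k x" "k y"] k that by simp
  fix p and f :: "nat \<Rightarrow> 'b" and n
  assume *: "p \<in> mspace Z" "\<forall>i\<le>n. f i \<in> mspace Z" "\<forall>i<n. mdist Z (f i) (f (Suc i)) \<le> J"
    "mdist Z (f 0) p + mdist Z p (f n) \<le> mdist Z (f 0) (f n) + r"
  have "\<exists>i\<le>n. mdist X (k (f i)) (k p) \<le> B"
    using assms(1)[unfolded bottleneck_def, rule_format, of "k p" n "\<lambda>i. k (f i)"] * k dk by simp
  then show "\<exists>i\<le>n. mdist Z (f i) p \<le> B" using * dk by auto
qed

section \<open>Coarse medians under the four-point condition\<close>

lemma geodesic_segment_point:
  assumes "geodesic_segment X x y A" "0 \<le> t" "t \<le> mdist X x y"
  obtains p where "p \<in> A" "p \<in> mspace X" "mdist X x p = t" "mdist X p y = mdist X x y - t"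
proof -
  obtain L \<gamma> where L: "L \<ge> 0" "\<gamma> ` {0..L} \<subseteq> mspace X"
    "\<And>s t. s \<in> {0..L} \<Longrightarrow> t \<in> {0..L} \<Longrightarrow> mdist X (\<gamma> s) (\<gamma> t) = \<bar>s - t\<bar>" "\<gamma> 0 = x" "\<gamma> L = y"
    "A = \<gamma> ` {0..L}"
    using assms(1) unfolding geodesic_segment_def by metis
  have xy: "mdist X x y = L" using L(3)[of 0 L] L(1,4,5) by auto
  have "\<gamma> t \<in> mspace X" using L(2) assms(2,3) xy by (simp add: image_subset_iff)
  then show thesis
    using that[of "\<gamma> t"] L(3)[of 0 t] L(3)[of t L] L(1,4,5,6) assms(2,3) xy by auto
qed

lemma geodesic_segment_between:
  assumes "geodesic_segment X x y A" "p \<in> A"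
  shows "p \<in> mspace X" "mdist X x p + mdist X p y = mdist X x y"
proof -
  obtain L \<gamma> where L: "L \<ge> 0" "\<gamma> ` {0..L} \<subseteq> mspace X"
    "\<And>s t. s \<in> {0..L} \<Longrightarrow> t \<in> {0..L} \<Longrightarrow> mdist X (\<gamma> s) (\<gamma> t) = \<bar>s - t\<bar>" "\<gamma> 0 = x" "\<gamma> L = y"
    "A = \<gamma> ` {0..L}"
    using assms(1) unfolding geodesic_segment_def by metis
  obtain t where t: "t \<in> {0..L}" "p = \<gamma> t" using assms(2) L(6) by blast
  show "p \<in> mspace X" using t L(2) by blast
  show "mdist X x p + mdist X p y = mdist X x y"
    using L(3)[of 0 t] L(3)[of t L] L(3)[of 0 L] L(1,4,5) t by auto
qed

lemma four_pointD:
  assumes "four_point X \<eta>" "a \<in> mspace X" "b \<in> mspace X" "c \<in> mspace X" "x \<in> mspace X"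
  shows "mdist X a b + mdist X c x \<le> max (mdist X a c + mdist X b x) (mdist X a x + mdist X b c) + \<eta>"
  using assms unfolding four_point_def by blast

text \<open>Here \<open>t\<close> is the Gromov product at \<open>x\<close>. One application of the
  four-point condition shows that \<open>q\<close> is about as far from \<open>y\<close> as if it
  lay on the side of \<open>p\<close>; a second one then compares \<open>p\<close> with
  \<open>q\<close>. Each costs \<eta>.\<close>

lemma tripod_close:
  assumes "four_point X \<eta>" "0 \<le> \<eta>" "x \<in> mspace X" "y \<in> mspace X" "z \<in> mspace X" "p \<in> mspace X" "q \<in> mspace X"
    and t: "t = (mdist X x y + mdist X x z - mdist X y z) / 2"
    and p: "mdist X x p = t" "mdist X p y = mdist X x y - t"
    and q: "mdist X x q = t" "mdist X q z = mdist X x z - t"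
  shows "mdist X p q \<le> 2 * \<eta>"
proof -
  have "mdist X q y + mdist X x z \<le> max (mdist X q x + mdist X y z) (mdist X q z + mdist X y x) + \<eta>"
    by (rule four_pointD) fact+
  also have "\<dots> \<le> mdist X x z + mdist X x y - t + \<eta>"
    using q mdist_commute[of X q x] mdist_commute[of X y x] t
    by (simp add: max_def field_simps)
  finally have qy: "mdist X q y \<le> mdist X x y - t + \<eta>" by simp
  have "mdist X p q + mdist X x y \<le> max (mdist X p x + mdist X q y) (mdist X p y + mdist X q x) + \<eta>"
    by (rule four_pointD) fact+
  also have "\<dots> \<le> mdist X x y + 2 * \<eta>"
    using qy p q assms(2) mdist_commute[of X p x] mdist_commute[of X q x]
    unfolding max_def by (simp split: if_splits)
  finally show ?thesis by simp
qed

definition center_of :: "'p metric \<Rightarrow> real \<Rightarrow> 'p \<Rightarrow> 'p \<Rightarrow> 'p \<Rightarrow> 'p \<Rightarrow> bool" where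
  "center_of X k x y z p \<longleftrightarrow> p \<in> mspace X \<and>
     (\<exists>A B C. geodesic_triangle X x y z A B C \<and> (\<forall>S\<in>{A, B, C}. \<exists>s\<in>S. mdist X p s \<le> k))"

lemma coarse_median_iff:
  "coarse_median X m \<longleftrightarrow>
     (\<exists>k. \<forall>x\<in>mspace X. \<forall>y\<in>mspace X. \<forall>z\<in>mspace X. center_of X k x y z (m x y z))"
  unfolding coarse_median_def center_of_def by (rule refl)

text \<open>On each side, the Gromov products single out the point that maps to the center of the
  comparison tripod. \<open>tripod_close\<close> at \<open>x\<close> and at \<open>y\<close> shows
  that the point \<open>p\<close> on the first side is close to the other two.\<close>

lemma coarse_median_exists:
  assumes "four_point X \<eta>" "0 \<le> \<eta>" "geodesic_space X"
  shows "\<exists>m. coarse_median X m"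
proof -
  have ex: "\<exists>p. center_of X (2 * \<eta>) x y z p"
    if xyz: "x \<in> mspace X" "y \<in> mspace X" "z \<in> mspace X" for x y z
  proof -
    obtain A where A: "geodesic_segment X x y A" using assms(3) xyz by (auto simp: geodesic_space_def)
    obtain B where B: "geodesic_segment X y z B" using assms(3) xyz by (auto simp: geodesic_space_def)
    obtain C where C: "geodesic_segment X z x C" using assms(3) xyz by (auto simp: geodesic_space_def)
    define t where "t = (mdist X x y + mdist X x z - mdist X y z) / 2"
    have c: "mdist X z y = mdist X y z" "mdist X z x = mdist X x z" "mdist X y x = mdist X x y"
      by (simp_all add: mdist_commute)
    have t: "0 \<le> t" "t \<le> mdist X x y" "t \<le> mdist X x z"
      using mdist_triangle[OF xyz(2,1,3)] mdist_triangle[OF xyz] mdist_triangle[OF xyz(1,3,2)] c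
      by (auto simp: t_def)
    obtain p where p: "p \<in> A" "p \<in> mspace X" "mdist X x p = t" "mdist X p y = mdist X x y - t"
      using geodesic_segment_point[OF A t(1,2)] by blast
    obtain q where q: "q \<in> C" "q \<in> mspace X" "mdist X z q = mdist X x z - t" "mdist X q x = t"
      using geodesic_segment_point[OF C, of "mdist X x z - t"] t c by auto
    obtain r where r: "r \<in> B" "r \<in> mspace X" "mdist X y r = mdist X x y - t"
      "mdist X r z = mdist X y z - (mdist X x y - t)"
      using geodesic_segment_point[OF B, of "mdist X x y - t"] t mdist_triangle[OF xyz(2,3,1)] c
      by (auto simp: t_def field_simps)
    have "mdist X p q \<le> 2 * \<eta>"
      using tripod_close[OF assms(1,2) xyz p(2) q(2) t_def p(3,4)] q mdist_commute[of X x q]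
        mdist_commute[of X q z] by simp
    moreover have "mdist X p r \<le> 2 * \<eta>"
      using tripod_close[OF assms(1,2) xyz(2,1,3) p(2) r(2), of "mdist X x y - t"] p r
        mdist_commute[of X y p] mdist_commute[of X p x] c by (simp add: t_def field_simps)
    moreover have "mdist X p p \<le> 2 * \<eta>" using assms(2) mdist_self[OF p(2)] by simp
    ultimately have "\<forall>S\<in>{A, B, C}. \<exists>s\<in>S. mdist X p s \<le> 2 * \<eta>" using p(1) q(1) r(1) by blast
    moreover have "geodesic_triangle X x y z A B C" using A B C by (simp add: geodesic_triangle_def)
    ultimately show ?thesis using p(2) unfolding center_of_def by blast
  qed
  have "coarse_median X (\<lambda>x y z. SOME p. center_of X (2 * \<eta>) x y z p)"
    unfolding coarse_median_iff
  proof (intro exI[of _ "2 * \<eta>"] ballI)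
    fix x y z assume "x \<in> mspace X" "y \<in> mspace X" "z \<in> mspace X"
    from ex[OF this] show "center_of X (2 * \<eta>) x y z (SOME p. center_of X (2 * \<eta>) x y z p)"
      by (rule someI_ex)
  qed
  then show ?thesis by (intro exI)
qed

text \<open>Closeness to the sides of a triangle implies this condition, which no longer mentions
  geodesics and is preserved exactly by isometries.\<close>

definition near_sides :: "'p metric \<Rightarrow> real \<Rightarrow> 'p \<Rightarrow> 'p \<Rightarrow> 'p \<Rightarrow> 'p \<Rightarrow> bool" where
  "near_sides X k x y z p \<longleftrightarrow> mdist X x p + mdist X p y \<le> mdist X x y + k \<and>
     mdist X y p + mdist X p z \<le> mdist X y z + k \<and> mdist X z p + mdist X p x \<le> mdist X z x + k"

text \<open>Adding two of the inequalities bounds the distance from \<open>p\<close> to a vertex by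
  the Gromov product there, up to \<open>k\<close>. The products at \<open>x\<close> and
  \<open>y\<close> add up to the length of the side between them, so the four-point condition leaves
  no room between \<open>p\<close> and \<open>q\<close>.\<close>

lemma near_sides_unique:
  assumes "four_point X \<eta>" "x \<in> mspace X" "y \<in> mspace X" "z \<in> mspace X" "p \<in> mspace X" "q \<in> mspace X"
    and p: "near_sides X k x y z p" and q: "near_sides X k x y z q"
  shows "mdist X p q \<le> 2 * k + \<eta>"
proof -
  note c = mdist_commute[of X x p] mdist_commute[of X y p] mdist_commute[of X z p]
    mdist_commute[of X x q] mdist_commute[of X y q] mdist_commute[of X z q]
    mdist_commute[of X y z] mdist_commute[of X x z]
  have px: "mdist X p x \<le> (mdist X x y + mdist X z x - mdist X y z) / 2 + k"
    and py: "mdist X p y \<le> (mdist X x y + mdist X y z - mdist X z x) / 2 + k"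
    if "p \<in> mspace X" "near_sides X k x y z p" for p
    using that mdist_triangle[OF assms(3) that(1) assms(4)] mdist_triangle[OF assms(4) that(1) assms(2)]
      mdist_commute[of X x p] mdist_commute[of X y p] mdist_commute[of X z p]
    unfolding near_sides_def by (auto simp: field_simps)
  have "mdist X p q + mdist X x y \<le> max (mdist X p x + mdist X q y) (mdist X p y + mdist X q x) + \<eta>"
    by (rule four_pointD) fact+
  also have "\<dots> \<le> mdist X x y + 2 * k + \<eta>"
    using px[OF assms(5) p] py[OF assms(5) p] px[OF assms(6) q] py[OF assms(6) q] by (simp add: field_simps)
  finally show ?thesis by simp
qed

lemma coarse_median_near_sides:
  assumes "coarse_median X m"
  obtains k where "\<And>x y z. x \<in> mspace X \<Longrightarrow> y \<in> mspace X \<Longrightarrow> z \<in> mspace X \<Longrightarrow>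
    m x y z \<in> mspace X \<and> near_sides X k x y z (m x y z)"
proof -
  obtain k where k: "\<forall>x\<in>mspace X. \<forall>y\<in>mspace X. \<forall>z\<in>mspace X. center_of X k x y z (m x y z)"
    using assms unfolding coarse_median_iff by blast
  have side: "mdist X x p + mdist X p y \<le> mdist X x y + 2 * k"
    if seg: "geodesic_segment X x y A" and ex: "\<exists>s\<in>A. mdist X p s \<le> k"
      and xyp: "x \<in> mspace X" "y \<in> mspace X" "p \<in> mspace X" for x y p A
  proof -
    obtain s where s: "s \<in> A" "mdist X p s \<le> k" using ex by blast
    note b = geodesic_segment_between[OF seg s(1)]
    show ?thesis
      using mdist_triangle[OF xyp(1) b(1) xyp(3)] mdist_triangle[OF xyp(3) b(1) xyp(2)] b(2) s(2)
        mdist_commute[of X s p] by linarith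
  qed
  show thesis
  proof (rule that[of "2 * k"])
    fix x y z assume xyz: "x \<in> mspace X" "y \<in> mspace X" "z \<in> mspace X"
    obtain A B C where m: "m x y z \<in> mspace X" and tri: "geodesic_triangle X x y z A B C"
      and near: "\<forall>S\<in>{A, B, C}. \<exists>s\<in>S. mdist X (m x y z) s \<le> k"
      using k xyz unfolding center_of_def by blast
    have "near_sides X (2 * k) x y z (m x y z)"
      using side[of x y A "m x y z"] side[of y z B "m x y z"] side[of z x C "m x y z"] tri near m xyz
      unfolding near_sides_def geodesic_triangle_def by simp
    then show "m x y z \<in> mspace X \<and> near_sides X (2 * k) x y z (m x y z)" using m by simp
  qed
qed

text \<open>The image of the median and the median of the images are both almost between each two of
  the image points.\<close>

lemma isometry_quasimedian:
  assumes "four_point X \<eta>" "coarse_median X m" "isometry X X \<psi>"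
  shows "quasimedian X m X m \<psi>"
proof -
  obtain k where k: "\<And>x y z. x \<in> mspace X \<Longrightarrow> y \<in> mspace X \<Longrightarrow> z \<in> mspace X \<Longrightarrow>
    m x y z \<in> mspace X \<and> near_sides X k x y z (m x y z)"
    using coarse_median_near_sides[OF assms(2)] by metis
  have \<psi>: "\<psi> x \<in> mspace X" if "x \<in> mspace X" for x
    using assms(3) that unfolding isometry_def by blast
  have d: "mdist X (\<psi> x) (\<psi> y) = mdist X x y" if "x \<in> mspace X" "y \<in> mspace X" for x y
    using assms(3) that unfolding isometry_def by blast
  have "mdist X (\<psi> (m x y z)) (m (\<psi> x) (\<psi> y) (\<psi> z)) \<le> 2 * k + \<eta>"
    if xyz: "x \<in> mspace X" "y \<in> mspace X" "z \<in> mspace X" for x y z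
  proof (rule near_sides_unique[OF assms(1) \<psi>[OF xyz(1)] \<psi>[OF xyz(2)] \<psi>[OF xyz(3)]])
    show "\<psi> (m x y z) \<in> mspace X" using k[OF xyz] \<psi> by blast
    show "near_sides X k (\<psi> x) (\<psi> y) (\<psi> z) (\<psi> (m x y z))"
      using k[OF xyz] xyz d unfolding near_sides_def by simp
  qed (use k[OF \<psi>[OF xyz(1)] \<psi>[OF xyz(2)] \<psi>[OF xyz(3)]] in auto)
  then show ?thesis unfolding quasimedian_def by blast
qed

section \<open>Geometric realisation of a graph\<close>

definition joined :: "'p metric \<Rightarrow> 'p \<Rightarrow> 'p \<Rightarrow> bool" where
  "joined X x y \<longleftrightarrow> (\<exists>A. geodesic_segment X x y A)"

lemma joinedI:
  assumes "0 \<le> L" "\<And>s. 0 \<le> s \<Longrightarrow> s \<le> L \<Longrightarrow> \<gamma> s \<in> mspace X"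
    "\<And>s t. 0 \<le> s \<Longrightarrow> s \<le> t \<Longrightarrow> t \<le> L \<Longrightarrow> mdist X (\<gamma> s) (\<gamma> t) = t - s" "\<gamma> 0 = x" "\<gamma> L = y"
  shows "joined X x y"
proof -
  have "mdist X (\<gamma> s) (\<gamma> t) = \<bar>s - t\<bar>" if "s \<in> {0..L}" "t \<in> {0..L}" for s t
    using assms(3)[of s t] assms(3)[of t s] that mdist_commute[of X "\<gamma> s" "\<gamma> t"]
    by (cases "s \<le> t") auto
  moreover have "\<gamma> ` {0..L} \<subseteq> mspace X" using assms(2) by auto
  ultimately have "geodesic_segment X x y (\<gamma> ` {0..L})"
    unfolding geodesic_segment_def using assms(1,4,5) by blast
  then show ?thesis unfolding joined_def by blast
qed

lemma joinedE:
  assumes "joined X x y"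
  obtains \<gamma> where "\<And>s. 0 \<le> s \<Longrightarrow> s \<le> mdist X x y \<Longrightarrow> \<gamma> s \<in> mspace X"
    "\<And>s t. 0 \<le> s \<Longrightarrow> s \<le> t \<Longrightarrow> t \<le> mdist X x y \<Longrightarrow> mdist X (\<gamma> s) (\<gamma> t) = t - s"
    "\<gamma> 0 = x" "\<gamma> (mdist X x y) = y"
proof -
  obtain L and \<gamma> :: "real \<Rightarrow> 'a" where L: "L \<ge> 0" "\<gamma> ` {0..L} \<subseteq> mspace X"
    "\<forall>s\<in>{0..L}. \<forall>t\<in>{0..L}. mdist X (\<gamma> s) (\<gamma> t) = \<bar>s - t\<bar>" "\<gamma> 0 = x" "\<gamma> L = y"
    using assms unfolding joined_def geodesic_segment_def by blast
  have xy: "mdist X x y = L" using L(3)[rule_format, of 0 L] L(1,4,5) by simp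
  show thesis
  proof (rule that[of \<gamma>])
    show "\<gamma> s \<in> mspace X" if "0 \<le> s" "s \<le> mdist X x y" for s
      using that L(2) xy by (auto simp: image_subset_iff)
    show "mdist X (\<gamma> s) (\<gamma> t) = t - s" if "0 \<le> s" "s \<le> t" "t \<le> mdist X x y" for s t
      using that L(3)[rule_format, of s t] xy by simp
  qed (use L xy in auto)
qed

lemma joined_refl: "x \<in> mspace X \<Longrightarrow> joined X x x"
  by (rule joinedI[of 0 "\<lambda>_. x"]) (auto simp: mdist_self)

lemma joined_sym:
  assumes "joined X x y"
  shows "joined X y x"
proof -
  obtain \<gamma> where \<gamma>: "\<And>s. 0 \<le> s \<Longrightarrow> s \<le> mdist X x y \<Longrightarrow> \<gamma> s \<in> mspace X"
    "\<And>s t. 0 \<le> s \<Longrightarrow> s \<le> t \<Longrightarrow> t \<le> mdist X x y \<Longrightarrow> mdist X (\<gamma> s) (\<gamma> t) = t - s"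
    "\<gamma> 0 = x" "\<gamma> (mdist X x y) = y"
    using joinedE[OF assms] by metis
  show ?thesis
  proof (rule joinedI[of "mdist X x y" "\<lambda>s. \<gamma> (mdist X x y - s)"])
    show "mdist X (\<gamma> (mdist X x y - s)) (\<gamma> (mdist X x y - t)) = t - s"
      if "0 \<le> s" "s \<le> t" "t \<le> mdist X x y" for s t
      using \<gamma>(2)[of "mdist X x y - t" "mdist X x y - s"] that by (simp add: mdist_commute)
  qed (use \<gamma> in auto)
qed

lemma joined_concat:
  assumes "joined X x z" "joined X z y" "mdist X x y = mdist X x z + mdist X z y"
  shows "joined X x y"
proof -
  define a b where "a = mdist X x z" and "b = mdist X z y"
  have nonneg: "0 \<le> a" "0 \<le> b" by (simp_all add: a_def b_def)
  obtain \<gamma> where \<gamma>: "\<And>s. 0 \<le> s \<Longrightarrow> s \<le> a \<Longrightarrow> \<gamma> s \<in> mspace X"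
    "\<And>s t. 0 \<le> s \<Longrightarrow> s \<le> t \<Longrightarrow> t \<le> a \<Longrightarrow> mdist X (\<gamma> s) (\<gamma> t) = t - s"
    "\<gamma> 0 = x" "\<gamma> a = z"
    using joinedE[OF assms(1)] unfolding a_def by metis
  obtain \<beta> where \<beta>: "\<And>s. 0 \<le> s \<Longrightarrow> s \<le> b \<Longrightarrow> \<beta> s \<in> mspace X"
    "\<And>s t. 0 \<le> s \<Longrightarrow> s \<le> t \<Longrightarrow> t \<le> b \<Longrightarrow> mdist X (\<beta> s) (\<beta> t) = t - s"
    "\<beta> 0 = z" "\<beta> b = y"
    using joinedE[OF assms(2)] unfolding b_def by metis
  define \<delta> where "\<delta> s = (if s \<le> a then \<gamma> s else \<beta> (s - a))" for s
  have pts: "x \<in> mspace X" "y \<in> mspace X" "z \<in> mspace X"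
    using \<gamma>(1)[of 0] \<gamma>(3) \<beta>(1)[of b] \<beta>(4) \<gamma>(1)[of a] \<gamma>(4) nonneg by auto
  show ?thesis
  proof (rule joinedI[of "a + b" \<delta>])
    show "0 \<le> a + b" using nonneg by simp
    show "\<delta> s \<in> mspace X" if "0 \<le> s" "s \<le> a + b" for s
      using that \<gamma>(1)[of s] \<beta>(1)[of "s - a"] by (auto simp: \<delta>_def)
    show "\<delta> 0 = x" using \<gamma>(3) nonneg by (simp add: \<delta>_def)
    show "\<delta> (a + b) = y"
      using \<beta>(3,4) \<gamma>(4) nonneg by (cases "b = 0") (auto simp: \<delta>_def)
    show "mdist X (\<delta> s) (\<delta> t) = t - s" if st: "0 \<le> s" "s \<le> t" "t \<le> a + b" for s t
    proof -
      consider "t \<le> a" | "a < s" | "s \<le> a" "a < t" by linarith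
      then show ?thesis
      proof cases
        case 1
        then show ?thesis using \<gamma>(2)[of s t] st by (simp add: \<delta>_def)
      next
        case 2
        then show ?thesis using \<beta>(2)[of "s - a" "t - a"] st by (simp add: \<delta>_def)
      next
        case 3
        have m: "\<gamma> s \<in> mspace X" "\<beta> (t - a) \<in> mspace X"
          using \<gamma>(1)[of s] \<beta>(1)[of "t - a"] st 3 by auto
        have e: "mdist X x (\<gamma> s) = s" "mdist X (\<gamma> s) z = a - s"
          "mdist X z (\<beta> (t - a)) = t - a" "mdist X (\<beta> (t - a)) y = b - (t - a)"
          using \<gamma>(2)[of 0 s] \<gamma>(2)[of s a] \<beta>(2)[of 0 "t - a"] \<beta>(2)[of "t - a" b] \<gamma>(3,4) \<beta>(3,4) st 3
          by auto
        have "mdist X (\<gamma> s) (\<beta> (t - a)) \<le> t - s"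
          using mdist_triangle[OF m(1) pts(3) m(2)] e by simp
        moreover have "a + b \<le> s + mdist X (\<gamma> s) (\<beta> (t - a)) + (b - (t - a))"
          using mdist_triangle[OF pts(1) m(1) pts(2)] mdist_triangle[OF m(1) m(2) pts(2)] e assms(3)
          by (simp add: a_def b_def)
        ultimately show ?thesis using 3 by (simp add: \<delta>_def)
      qed
    qed
  qed
qed

text \<open>Points of the realisation: \<open>(v, v, 0)\<close> is the vertex \<open>v\<close>, and \<open>(v, w, t)\<close> with \<open>0 < t < 1\<close> lies
  at distance \<open>t\<close> from \<open>v\<close> on an edge from \<open>v\<close> to \<open>w\<close>. The edges from \<open>v\<close> to \<open>w\<close> and from \<open>w\<close> to \<open>v\<close>
  are different, so no points have to be identified.\<close>

context connected_graph
begin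

definition points :: "('v \<times> 'v \<times> real) set" where
  "points = {(v, v, 0) | v. v \<in> V} \<union> {(v, w, t) | v w t. adj v w \<and> 0 < t \<and> t < 1}"

abbreviation d :: "'v \<Rightarrow> 'v \<Rightarrow> real" where
  "d u v \<equiv> real (gdist adj u v)"

text \<open>The two terms are the routes through the two ends of the edge. At a vertex
  \<open>(v, v, 0)\<close> the second one is longer by 1, so vertices need no clause of their own,
  neither here nor in \<open>pdist\<close>.\<close>

fun vdist :: "'v \<times> 'v \<times> real \<Rightarrow> 'v \<Rightarrow> real" where
  "vdist (v, w, t) u = min (t + d v u) (1 - t + d w u)"

fun pdist :: "'v \<times> 'v \<times> real \<Rightarrow> 'v \<times> 'v \<times> real \<Rightarrow> real" where
  "pdist (v, w, t) q = (if fst q = v \<and> fst (snd q) = w then \<bar>t - snd (snd q)\<bar>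
     else min (t + vdist q v) (1 - t + vdist q w))"

lemma d_triangle: "u \<in> V \<Longrightarrow> v \<in> V \<Longrightarrow> w \<in> V \<Longrightarrow> d u w \<le> d u v + d v w"
  using gdist_triangle[of u v w] by linarith

lemma d_commute: "d u v = d v u"
  by (simp add: gdist_commute)

lemma points_cases:
  assumes "p \<in> points"
  obtains (vertex) v where "p = (v, v, 0)" "v \<in> V"
  | (edge) v w t where "p = (v, w, t)" "adj v w" "v \<in> V" "w \<in> V" "v \<noteq> w" "d v w = 1" "0 < t" "t < 1"
  using assms gdist_adj adj_V adj_irrefl unfolding points_def by fastforce

lemma vdist_nonneg: "p \<in> points \<Longrightarrow> 0 \<le> vdist p u"
  by (erule points_cases) auto

lemma vdist_vertex [simp]: "vdist (v, v, 0) u = d v u"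
  by simp

lemma vdist_le:
  assumes "p \<in> points" "u \<in> V" "u' \<in> V"
  shows "vdist p u \<le> vdist p u' + d u' u"
  using assms(1)
proof (cases rule: points_cases)
  case (vertex v)
  then show ?thesis using d_triangle[of v u' u] assms by auto
next
  case (edge v w t)
  then show ?thesis using d_triangle[of v u' u] d_triangle[of w u' u] assms by (auto simp: min_def)
qed

lemma d_le_vdist:
  assumes "p \<in> points" "u \<in> V" "u' \<in> V"
  shows "d u u' \<le> vdist p u + vdist p u'"
  using assms(1)
proof (cases rule: points_cases)
  case (vertex v)
  then show ?thesis using d_triangle[of u v u'] d_commute[of u v] assms by auto
next
  case (edge v w t)
  then show ?thesis
    using d_triangle[of u v u'] d_triangle[of u w u'] d_triangle[of v w u'] d_triangle[of w v u']
      d_commute[of u v] d_commute[of u w] d_commute[of w v] assms by (auto simp: min_def)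
qed

lemma pdist_le_vdist:
  assumes "p \<in> points" "q \<in> points" "u \<in> V"
  shows "pdist p q \<le> vdist p u + vdist q u"
  using assms(1)
proof (cases rule: points_cases)
  case (vertex v)
  then show ?thesis
    using vdist_le[OF assms(2), of v u] vdist_nonneg[OF assms(2), of u] d_commute[of v u] assms(2,3)
    by (cases rule: points_cases[OF assms(2)]) (auto simp: min_def)
next
  case (edge v w t)
  show ?thesis
  proof (cases "fst q = v \<and> fst (snd q) = w")
    case True
    then obtain s where q: "q = (v, w, s)" by (cases q) auto
    have "0 < s" "s < 1" using assms(2) edge q by (auto elim: points_cases)
    then show ?thesis
      using edge q d_triangle[of v u w] d_commute[of w u] assms(3) by (auto simp: min_def)
  next
    case False
    then show ?thesis
      using edge vdist_le[OF assms(2), of v u] vdist_le[OF assms(2), of w u] d_commute[of v u]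
        d_commute[of w u] assms(3) by (auto simp: min_def)
  qed
qed

text \<open>Points that do not share an edge are joined through a vertex. This reduces the metric
  axioms to properties of \<open>vdist\<close>, hence to those of the graph distance.\<close>

lemma pdist_exit:
  assumes "p \<in> points" "q \<in> points" "\<not> (fst p = fst q \<and> fst (snd p) = fst (snd q))"
  obtains u where "u \<in> V" "pdist p q = vdist p u + vdist q u"
proof -
  obtain v w t where p: "p = (v, w, t)" by (cases p)
  have vw: "v \<in> V" "w \<in> V" "0 \<le> t" "t \<le> 1"
    using assms(1) p by (auto elim: points_cases)
  have eq: "pdist p q = min (t + vdist q v) (1 - t + vdist q w)" using assms(3) p by auto
  have "vdist p v \<le> t" "vdist p w \<le> 1 - t" using p by auto
  then show thesis
    using that[of v] that[of w] eq vw pdist_le_vdist[OF assms(1,2), of v] pdist_le_vdist[OF assms(1,2), of w]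
    by (auto simp: min_def split: if_splits)
qed

lemma pdist_same_edge:
  assumes "fst p = fst q" "fst (snd p) = fst (snd q)"
  shows "pdist p q = \<bar>snd (snd p) - snd (snd q)\<bar>"
  using assms by (cases p) auto

lemma vdist_le_pdist:
  assumes "p \<in> points" "q \<in> points" "u \<in> V"
  shows "vdist p u \<le> pdist p q + vdist q u"
proof (cases "fst p = fst q \<and> fst (snd p) = fst (snd q)")
  case True
  then show ?thesis by (cases p; cases q) (auto simp: min_def)
next
  case False
  then obtain u0 where "u0 \<in> V" "pdist p q = vdist p u0 + vdist q u0"
    using pdist_exit[OF assms(1,2)] by metis
  then show ?thesis
    using vdist_le[OF assms(1,3), of u0] d_le_vdist[OF assms(2), of u0 u] assms(3) by linarith
qed

lemma pdist_commute:
  assumes "p \<in> points" "q \<in> points"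
  shows "pdist p q = pdist q p"
proof (cases "fst p = fst q \<and> fst (snd p) = fst (snd q)")
  case True
  then show ?thesis using pdist_same_edge[of p q] pdist_same_edge[of q p] by simp
next
  case False
  obtain u where "u \<in> V" "pdist p q = vdist p u + vdist q u"
    using pdist_exit[OF assms] False by metis
  moreover obtain u' where "u' \<in> V" "pdist q p = vdist q u' + vdist p u'"
    using pdist_exit[OF assms(2,1)] False by metis
  ultimately show ?thesis
    using pdist_le_vdist[OF assms, of u'] pdist_le_vdist[OF assms(2,1), of u] by simp
qed

lemma pdist_triangle:
  assumes "p \<in> points" "q \<in> points" "r \<in> points"
  shows "pdist p r \<le> pdist p q + pdist q r"
proof -
  have *: "pdist p r \<le> pdist p q + pdist q r"
    if pqr: "p \<in> points" "q \<in> points" "r \<in> points"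
      and ne: "\<not> (fst q = fst r \<and> fst (snd q) = fst (snd r))" for p q r
  proof -
    obtain u where "u \<in> V" "pdist q r = vdist q u + vdist r u"
      using pdist_exit[OF pqr(2,3) ne] by metis
    then show ?thesis
      using pdist_le_vdist[OF pqr(1,3), of u] vdist_le_pdist[OF pqr(1,2), of u] by linarith
  qed
  consider "\<not> (fst q = fst r \<and> fst (snd q) = fst (snd r))"
    | "\<not> (fst q = fst p \<and> fst (snd q) = fst (snd p))"
    | "fst q = fst r" "fst (snd q) = fst (snd r)" "fst q = fst p" "fst (snd q) = fst (snd p)" by blast
  then show ?thesis
  proof cases
    case 1
    then show ?thesis using * assms by blast
  next
    case 2
    then show ?thesis
      using *[OF assms(3,2,1)] pdist_commute[OF assms(1,2)] pdist_commute[OF assms(2,3)]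
        pdist_commute[OF assms(1,3)] by linarith
  next
    case 3
    then show ?thesis
      using pdist_same_edge[of p r] pdist_same_edge[of p q] pdist_same_edge[of q r] by simp
  qed
qed

lemma vdist_eq_0:
  assumes "p \<in> points" "vdist p u = 0" "u \<in> V"
  shows "p = (u, u, 0)"
  using assms(1)
proof (cases rule: points_cases)
  case (vertex v)
  then show ?thesis using assms gdist_eq_0[of v u] by simp
next
  case (edge v w t)
  then have "0 < t + d v u" "0 < 1 - t + d w u" by auto
  then show ?thesis using assms(2) edge by (auto simp: min_def split: if_splits)
qed

text \<open>Nonnegativity and symmetry are demanded of all arguments, hence the default value 0
  outside \<open>points\<close>.\<close>

lemma Metric_space_points: "Metric_space points (\<lambda>p q. if p \<in> points \<and> q \<in> points then pdist p q else 0)"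
proof
  fix p q
  have nonneg: "0 \<le> pdist p q" if "p \<in> points" "q \<in> points"
  proof (cases "fst p = fst q \<and> fst (snd p) = fst (snd q)")
    case True
    then show ?thesis using pdist_same_edge[of p q] by simp
  next
    case False
    then show ?thesis
      using pdist_exit[OF that] vdist_nonneg[OF that(1)] vdist_nonneg[OF that(2)] by (metis add_nonneg_nonneg)
  qed
  then show "0 \<le> (if p \<in> points \<and> q \<in> points then pdist p q else 0)" by simp
  show "(if p \<in> points \<and> q \<in> points then pdist p q else 0) = (if q \<in> points \<and> p \<in> points then pdist q p else 0)"
    using pdist_commute by simp
  show "((if p \<in> points \<and> q \<in> points then pdist p q else 0) = 0) = (p = q)"
    if pq: "p \<in> points" "q \<in> points"
  proof (cases "fst p = fst q \<and> fst (snd p) = fst (snd q)")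
    case True
    then show ?thesis using pdist_same_edge[of p q] pq by (auto simp: prod_eq_iff)
  next
    case False
    obtain u where u: "u \<in> V" "pdist p q = vdist p u + vdist q u"
      using pdist_exit[OF pq] False by metis
    have "pdist p q \<noteq> 0"
    proof
      assume "pdist p q = 0"
      then have "vdist p u = 0" "vdist q u = 0"
        using u vdist_nonneg[OF pq(1), of u] vdist_nonneg[OF pq(2), of u] by linarith+
      then show False using vdist_eq_0[OF pq(1) _ u(1)] vdist_eq_0[OF pq(2) _ u(1)] False by simp
    qed
    then show ?thesis using False pq by auto
  qed
next
  fix p q r assume "p \<in> points" "q \<in> points" "r \<in> points"
  then show "(if p \<in> points \<and> r \<in> points then pdist p r else 0)
      \<le> (if p \<in> points \<and> q \<in> points then pdist p q else 0) + (if q \<in> points \<and> r \<in> points then pdist q r else 0)"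
    using pdist_triangle by simp
qed

definition realisation :: "('v \<times> 'v \<times> real) metric" where
  "realisation = metric (points, \<lambda>p q. if p \<in> points \<and> q \<in> points then pdist p q else 0)"

lemma mspace_realisation [simp]: "mspace realisation = points"
  unfolding realisation_def by (rule Metric_space.mspace_metric[OF Metric_space_points])

lemma mdist_realisation: "p \<in> points \<Longrightarrow> q \<in> points \<Longrightarrow> mdist realisation p q = pdist p q"
  unfolding realisation_def by (simp add: Metric_space.mdist_metric[OF Metric_space_points])

lemma vertex_point: "v \<in> V \<Longrightarrow> (v, v, 0) \<in> points"
  by (simp add: points_def)

lemma mdist_vertex:
  assumes "p \<in> points" "u \<in> V"
  shows "mdist realisation p (u, u, 0) = vdist p u"
proof -
  have "pdist p (u, u, 0) \<le> vdist p u"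
    using pdist_le_vdist[OF assms(1) vertex_point[OF assms(2)] assms(2)] by simp
  moreover have "vdist p u \<le> pdist p (u, u, 0)"
    using vdist_le_pdist[OF assms(1) vertex_point[OF assms(2)] assms(2)] by simp
  ultimately show ?thesis using mdist_realisation[OF assms(1) vertex_point[OF assms(2)]] by simp
qed

section \<open>Geodesics in the realisation\<close>

definition edge_point :: "'v \<Rightarrow> 'v \<Rightarrow> real \<Rightarrow> 'v \<times> 'v \<times> real" where
  "edge_point v w t = (if t \<le> 0 then (v, v, 0) else if 1 \<le> t then (w, w, 0) else (v, w, t))"

lemma edge_point_mem: "adj v w \<Longrightarrow> edge_point v w t \<in> points"
  using adj_V by (auto simp: edge_point_def points_def)

lemma edge_point_vdist:
  assumes "adj v w" "0 \<le> t" "t \<le> 1"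
  shows "vdist (edge_point v w t) v = t" "vdist (edge_point v w t) w = 1 - t"
  using assms gdist_adj[OF assms(1)] gdist_commute[of w v] by (auto simp: edge_point_def min_def)

lemma edge_point_dist:
  assumes "adj v w" "0 \<le> s" "s \<le> t" "t \<le> 1"
  shows "mdist realisation (edge_point v w s) (edge_point v w t) = t - s"
proof -
  let ?e = "edge_point v w"
  note m = edge_point_mem[OF assms(1)]
  have vw: "v \<in> V" "w \<in> V" using adj_V[OF assms(1)] by auto
  have "vdist (?e t) v \<le> pdist (?e t) (?e s) + vdist (?e s) v"
    by (rule vdist_le_pdist[OF m m vw(1)])
  then have ge: "t - s \<le> pdist (?e s) (?e t)"
    using edge_point_vdist[OF assms(1)] assms pdist_commute[OF m m] by simp
  have "pdist (?e s) (?e t) \<le> t - s"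
  proof (cases "s = 0 \<or> t = 1")
    case True
    then show ?thesis
      using pdist_le_vdist[OF m m vw(1), of s t] pdist_le_vdist[OF m m vw(2), of s t]
        edge_point_vdist[OF assms(1), of s] edge_point_vdist[OF assms(1), of t] assms by auto
  next
    case False
    then have "0 < s" "t < 1" using assms by auto
    then show ?thesis using assms by (auto simp: edge_point_def)
  qed
  then show ?thesis using ge mdist_realisation[OF m m] by simp
qed

lemma joined_edge_points:
  assumes "adj v w" "0 \<le> s" "s \<le> 1" "0 \<le> t" "t \<le> 1"
  shows "joined realisation (edge_point v w s) (edge_point v w t)"
proof -
  have *: "joined realisation (edge_point v w s) (edge_point v w t)" if "0 \<le> s" "s \<le> t" "t \<le> 1" for s t
  proof (rule joinedI[of "t - s" "\<lambda>r. edge_point v w (s + r)"])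
    show "mdist realisation (edge_point v w (s + r)) (edge_point v w (s + r')) = r' - r"
      if "0 \<le> r" "r \<le> r'" "r' \<le> t - s" for r r'
      using edge_point_dist[OF assms(1), of "s + r" "s + r'"] that \<open>0 \<le> s\<close> \<open>t \<le> 1\<close> by simp
  qed (use that edge_point_mem[OF assms(1)] in auto)
  show ?thesis
  proof (cases "s \<le> t")
    case True
    then show ?thesis using * assms by simp
  next
    case False
    then show ?thesis using *[of t s] assms by (simp add: joined_sym)
  qed
qed

lemma joined_vertices:
  assumes "u \<in> V" "v \<in> V"
  shows "joined realisation (u, u, 0) (v, v, 0)"
proof -
  let ?n = "gdist adj u v"
  obtain f where f: "f 0 = u" "f ?n = v" "\<And>i. i < ?n \<Longrightarrow> adj (f i) (f (Suc i))"
    "\<And>i. i \<le> ?n \<Longrightarrow> f i \<in> V" "\<And>i j. i \<le> j \<Longrightarrow> j \<le> ?n \<Longrightarrow> gdist adj (f i) (f j) = j - i"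
    using geodesic_path[OF assms] by metis
  have "joined realisation (f 0, f 0, 0) (f i, f i, 0)" if "i \<le> ?n" for i
    using that
  proof (induction i)
    case 0
    then show ?case using f(4)[of 0] vertex_point by (intro joined_refl) simp
  next
    case (Suc i)
    have mem: "f 0 \<in> V" "f i \<in> V" "f (Suc i) \<in> V" using f(4) Suc.prems by auto
    have "joined realisation (f i, f i, 0) (f (Suc i), f (Suc i), 0)"
      using joined_edge_points[OF f(3)[of i], of 0 1] Suc.prems by (simp add: edge_point_def)
    moreover have "mdist realisation (f 0, f 0, 0) (f (Suc i), f (Suc i), 0) =
        mdist realisation (f 0, f 0, 0) (f i, f i, 0) + mdist realisation (f i, f i, 0) (f (Suc i), f (Suc i), 0)"
      using mdist_vertex vertex_point mem f(5)[of 0 i] f(5)[of 0 "Suc i"] f(5)[of i "Suc i"] Suc.prems by simp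
    ultimately show ?case using joined_concat Suc by simp
  qed
  from this[of ?n] show ?thesis using f(1,2) by simp
qed

lemma joined_vertex:
  assumes "p \<in> points" "u \<in> V"
  shows "joined realisation p (u, u, 0)"
  using assms(1)
proof (cases rule: points_cases)
  case (vertex v)
  then show ?thesis using joined_vertices assms by simp
next
  case (edge v w t)
  have p: "p = edge_point v w t" using edge by (simp add: edge_point_def)
  have j: "joined realisation p (v, v, 0)" "joined realisation p (w, w, 0)"
    using joined_edge_points[OF edge(2), of t 0] joined_edge_points[OF edge(2), of t 1] edge p
    by (auto simp: edge_point_def)
  have e: "vdist p v = t" "vdist p w = 1 - t"
    using edge_point_vdist[OF edge(2), of t] edge(7,8) p by simp_all
  have "vdist p u = t + d v u \<or> vdist p u = 1 - t + d w u" using edge by (auto simp: min_def)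
  then show ?thesis
  proof
    assume "vdist p u = t + d v u"
    then have "mdist realisation p (u, u, 0) = mdist realisation p (v, v, 0) + mdist realisation (v, v, 0) (u, u, 0)"
      using mdist_vertex[OF assms] mdist_vertex[OF assms(1) edge(3)]
        mdist_vertex[OF vertex_point[OF edge(3)] assms(2)] e by simp
    then show ?thesis by (rule joined_concat[OF j(1) joined_vertices[OF edge(3) assms(2)]])
  next
    assume "vdist p u = 1 - t + d w u"
    then have "mdist realisation p (u, u, 0) = mdist realisation p (w, w, 0) + mdist realisation (w, w, 0) (u, u, 0)"
      using mdist_vertex[OF assms] mdist_vertex[OF assms(1) edge(4)]
        mdist_vertex[OF vertex_point[OF edge(4)] assms(2)] e by simp
    then show ?thesis by (rule joined_concat[OF j(2) joined_vertices[OF edge(4) assms(2)]])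
  qed
qed

lemma geodesic_realisation: "geodesic_space realisation"
proof -
  have "joined realisation p q" if pq: "p \<in> points" "q \<in> points" for p q
  proof (cases "fst p = fst q \<and> fst (snd p) = fst (snd q)")
    case True
    show ?thesis
      using pq(1)
    proof (cases rule: points_cases)
      case (vertex v)
      then have "q = p" using pq(2) True adj_irrefl by (cases rule: points_cases[OF pq(2)]) auto
      then show ?thesis using joined_refl[of p realisation] pq by simp
    next
      case (edge v w t)
      then obtain s where q: "q = (v, w, s)" using True by (cases q) auto
      then have "0 < s" "s < 1" using pq(2) edge by (auto elim: points_cases)
      then show ?thesis
        using joined_edge_points[OF edge(2), of t s] edge q by (simp add: edge_point_def)
    qed
  next
    case False
    then obtain u where u: "u \<in> V" "pdist p q = vdist p u + vdist q u"
      using pdist_exit[OF pq] by metis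
    have "mdist realisation p q = mdist realisation p (u, u, 0) + mdist realisation (u, u, 0) q"
      using u mdist_vertex pq mdist_realisation mdist_commute[of realisation q "(u, u, 0)"] by simp
    then show ?thesis
      using joined_concat[OF joined_vertex[OF pq(1) u(1)] joined_sym[OF joined_vertex[OF pq(2) u(1)]]] by simp
  qed
  then show ?thesis unfolding geodesic_space_def joined_def by simp
qed

lemma mdist_first_vertex: "p \<in> points \<Longrightarrow> fst p \<in> V" "p \<in> points \<Longrightarrow> mdist realisation p (fst p, fst p, 0) \<le> 1"
proof -
  assume p: "p \<in> points"
  then show V: "fst p \<in> V" by (cases rule: points_cases) auto
  show "mdist realisation p (fst p, fst p, 0) \<le> 1"
    using p unfolding mdist_vertex[OF p V] by (cases rule: points_cases) auto
qed

lemma mdist_approx: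
  assumes "p \<in> points" "q \<in> points"
  shows "\<bar>mdist realisation p q - d (fst p) (fst q)\<bar> \<le> 2"
proof -
  let ?p = "(fst p, fst p, 0)" and ?q = "(fst q, fst q, 0)"
  note p = mdist_first_vertex[OF assms(1)] and q = mdist_first_vertex[OF assms(2)]
  have m: "?p \<in> mspace realisation" "?q \<in> mspace realisation" "p \<in> mspace realisation" "q \<in> mspace realisation"
    using p q vertex_point assms by auto
  have "mdist realisation ?p ?q = d (fst p) (fst q)"
    using mdist_vertex[OF vertex_point[OF p(1)] q(1)] by simp
  then show ?thesis
    using mdist_triangle[OF m(3,1,4)] mdist_triangle[OF m(1,2,4)] mdist_triangle[OF m(1,3,2)]
      mdist_triangle[OF m(3,4,2)] p(2) q(2) mdist_commute[of realisation p ?p] mdist_commute[of realisation q ?q]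
    by linarith
qed

end

section \<open>Tight graphs are quasi-trees\<close>

context connected_graph
begin

text \<open>The bottleneck property for graphs: \<open>N\<close> is a connection that no other path
  from \<open>x\<close> to \<open>y\<close> can avoid. For a projection graph it is the set
  \<open>between x y\<close>.\<close>

definition tight :: "nat \<Rightarrow> bool" where
  "tight \<Delta> \<longleftrightarrow> (\<forall>x\<in>V. \<forall>y\<in>V. \<exists>N\<subseteq>V. conn adj N x y \<and>
     (\<forall>z\<in>N. \<forall>A. conn adj A x y \<longrightarrow> (\<exists>a\<in>A. gdist adj a z \<le> \<Delta>)))"

section \<open>Components of complements of balls\<close>

definition upper :: "'v \<Rightarrow> nat \<Rightarrow> 'v set" where
  "upper x0 k = {v \<in> V. k \<le> gdist adj x0 v}"

lemma upper_subset: "upper x0 k \<subseteq> V"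
  by (auto simp: upper_def)

lemma upper_antimono: "j \<le> k \<Longrightarrow> upper x0 k \<subseteq> upper x0 j"
  by (auto simp: upper_def)

lemma descend:
  assumes "x0 \<in> V" "u \<in> V" "k \<le> gdist adj x0 u"
  obtains u' where "u' \<in> V" "gdist adj x0 u' = k" "gdist adj u' u = gdist adj x0 u - k"
    "conn adj (upper x0 k) u' u"
proof -
  let ?n = "gdist adj x0 u"
  obtain f where f: "f 0 = x0" "f ?n = u" "\<And>i. i < ?n \<Longrightarrow> adj (f i) (f (Suc i))"
    "\<And>i. i \<le> ?n \<Longrightarrow> f i \<in> V" "\<And>i j. i \<le> j \<Longrightarrow> j \<le> ?n \<Longrightarrow> gdist adj (f i) (f j) = j - i"
    using geodesic_path[OF assms(1,2)] by metis
  have lev: "gdist adj x0 (f i) = i" if "i \<le> ?n" for i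
    using f(5)[of 0 i] f(1) that by simp
  have "conn adj (upper x0 k) (f (k + 0)) (f (k + (?n - k)))"
    using f(3,4) lev assms(3) by (intro path_conn[of "?n - k" "\<lambda>i. f (k + i)"]) (auto simp: upper_def)
  then show thesis
    using that[of "f k"] f(4)[of k] lev[of k] f(5)[of k ?n] f(2) assms(3) by simp
qed

text \<open>The path outside the ball passes close to all of \<open>N\<close>, so \<open>N\<close>
  stays above level \<open>n - \<Delta>\<close>. The geodesics from \<open>x0\<close> to
  \<open>x\<close> and \<open>y\<close> together also pass close to all of \<open>N\<close>. Where
  \<open>N\<close> switches from one geodesic to the other, both have level at least
  \<open>n - 2 * \<Delta>\<close>; so crossing there takes at most
  \<open>3 * \<Delta> + 1 + 3 * \<Delta>\<close> steps.\<close>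

lemma cluster_bounded:
  assumes tight: "tight \<Delta>" and x0: "x0 \<in> V"
    and xy: "gdist adj x0 x = n" "gdist adj x0 y = n" and conn: "conn adj (upper x0 n) x y"
  shows "gdist adj x y \<le> 6 * \<Delta> + 1"
proof -
  have mem: "x \<in> V" "y \<in> V" using conn upper_subset[of x0 n] by (auto simp: conn_def)
  obtain N where N: "N \<subseteq> V" "conn adj N x y"
    and close_all: "\<forall>z\<in>N. \<forall>A. conn adj A x y \<longrightarrow> (\<exists>a\<in>A. gdist adj a z \<le> \<Delta>)"
    using tight[unfolded tight_def, rule_format, OF mem] by - (elim exE conjE, rule that, assumption+)
  have close: "\<exists>a\<in>A. gdist adj a z \<le> \<Delta>" if "z \<in> N" "conn adj A x y" for z A
    using close_all that by blast
  have high: "n \<le> gdist adj x0 z + \<Delta>" if zN: "z \<in> N" for z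
  proof -
    obtain a where a: "a \<in> upper x0 n" "gdist adj a z \<le> \<Delta>" using close[OF zN conn] by blast
    then have aV: "a \<in> V" "n \<le> gdist adj x0 a" by (auto simp: upper_def)
    have zV: "z \<in> V" using zN N(1) by blast
    show ?thesis
      using gdist_triangle[OF x0 zV aV(1)] gdist_commute[of a z] a(2) aV(2) by linarith
  qed
  obtain f where f: "f 0 = x0" "f n = x" "\<And>i. i < n \<Longrightarrow> adj (f i) (f (Suc i))"
    "\<And>i. i \<le> n \<Longrightarrow> f i \<in> V" "\<And>i j. i \<le> j \<Longrightarrow> j \<le> n \<Longrightarrow> gdist adj (f i) (f j) = j - i"
    using geodesic_path[OF x0 mem(1)] unfolding xy by metis
  obtain g where g: "g 0 = x0" "g n = y" "\<And>i. i < n \<Longrightarrow> adj (g i) (g (Suc i))"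
    "\<And>i. i \<le> n \<Longrightarrow> g i \<in> V" "\<And>i j. i \<le> j \<Longrightarrow> j \<le> n \<Longrightarrow> gdist adj (g i) (g j) = j - i"
    using geodesic_path[OF x0 mem(2)] unfolding xy by metis
  define A where "A = f ` {..n} \<union> g ` {..n}"
  have "conn adj A (f 0) (f n)" "conn adj A (g 0) (g n)"
    using f(3) g(3) by (auto simp: A_def intro!: path_conn)
  then have "conn adj A x y" using f(1,2) g(1,2) conn_sym[OF adj_sym] conn_trans by metis
  then have "(\<exists>i\<le>n. gdist adj (f i) z \<le> \<Delta>) \<or> (\<exists>i\<le>n. gdist adj (g i) z \<le> \<Delta>)" if "z \<in> N" for z
    using close[OF that, of A] by (auto simp: A_def)
  moreover have "\<exists>i\<le>n. gdist adj (f i) x \<le> \<Delta>" using f(2) by (intro exI[of _ n]) simp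
  moreover have "\<exists>i\<le>n. gdist adj (g i) y \<le> \<Delta>" using g(2) by (intro exI[of _ n]) simp
  ultimately obtain z z' where zz: "z \<in> N" "z' \<in> N" "z = z' \<or> adj z z'"
    "\<exists>i\<le>n. gdist adj (f i) z \<le> \<Delta>" "\<exists>i\<le>n. gdist adj (g i) z' \<le> \<Delta>"
    using conn_switch[OF N(2), of "\<lambda>z. \<exists>i\<le>n. gdist adj (f i) z \<le> \<Delta>" "\<lambda>z. \<exists>i\<le>n. gdist adj (g i) z \<le> \<Delta>"]
    by blast
  obtain i j where ij: "i \<le> n" "gdist adj (f i) z \<le> \<Delta>" "j \<le> n" "gdist adj (g j) z' \<le> \<Delta>"
    using zz(4,5) by blast
  have zV: "z \<in> V" "z' \<in> V" using zz N(1) by auto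
  have "gdist adj x0 z \<le> i + \<Delta>"
    using gdist_triangle[OF x0 f(4)[OF ij(1)] zV(1)] f(5)[of 0 i] f(1) ij by simp
  then have i: "n - i \<le> 2 * \<Delta>" using high[OF zz(1)] by simp
  have "gdist adj x0 z' \<le> j + \<Delta>"
    using gdist_triangle[OF x0 g(4)[OF ij(3)] zV(2)] g(5)[of 0 j] g(1) ij by simp
  then have j: "n - j \<le> 2 * \<Delta>" using high[OF zz(2)] by simp
  have 1: "gdist adj x z \<le> 3 * \<Delta>"
    using gdist_triangle[OF mem(1) f(4)[OF ij(1)] zV(1)] f(5)[of i n] f(2) ij i gdist_commute[of x "f i"]
    by simp
  have 2: "gdist adj z' y \<le> 3 * \<Delta>"
    using gdist_triangle[OF zV(2) g(4)[OF ij(3)] mem(2)] g(5)[of j n] g(2) ij j gdist_commute[of z' "g j"]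
    by simp
  have 3: "gdist adj z z' \<le> 1" using zz(3) gdist_adj_le by auto
  show ?thesis
    using gdist_triangle[OF mem(1) zV(1) mem(2)] gdist_triangle[OF zV(1,2) mem(2)] 1 2 3 by linarith
qed

text \<open>A vertex \<open>v\<close> at distance \<open>n\<close> from \<open>x0\<close> is encoded by the components of the sets \<open>upper x0 k\<close>
  with \<open>1 \<le> k \<le> n\<close> that contain it. The component for \<open>k = 0\<close> is \<open>V\<close>, so \<open>x0\<close> is the empty list.\<close>

definition clusters :: "'v \<Rightarrow> 'v \<Rightarrow> 'v set list" where
  "clusters x0 v = map (\<lambda>k. {w. conn adj (upper x0 k) v w}) [1..<Suc (gdist adj x0 v)]"

lemma length_clusters [simp]: "length (clusters x0 v) = gdist adj x0 v"
  by (simp add: clusters_def)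

lemma take_clusters:
  "k \<le> gdist adj x0 v \<Longrightarrow> take k (clusters x0 v) = map (\<lambda>k. {w. conn adj (upper x0 k) v w}) [1..<Suc k]"
  by (simp add: clusters_def take_map take_upt del: upt_Suc)

lemma conn_cluster_eq:
  assumes "conn adj (upper x0 k) u v" "j \<le> k"
  shows "{w. conn adj (upper x0 j) u w} = {w. conn adj (upper x0 j) v w}"
proof -
  have uv: "conn adj (upper x0 j) u v" using conn_mono[OF assms(1) upper_antimono[OF assms(2)]] .
  have "conn adj (upper x0 j) u w \<longleftrightarrow> conn adj (upper x0 j) v w" for w
    using conn_trans[OF uv, of w] conn_trans[OF conn_sym[OF adj_sym uv], of w] by blast
  then show ?thesis by simp
qed

lemma conn_lcp:
  assumes "conn adj (upper x0 k) u v"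
  shows "k \<le> lcp_len (clusters x0 u) (clusters x0 v)"
proof -
  have k: "k \<le> gdist adj x0 u" "k \<le> gdist adj x0 v" using assms by (auto simp: conn_def upper_def)
  have "take k (clusters x0 u) = take k (clusters x0 v)"
    unfolding take_clusters[OF k(1)] take_clusters[OF k(2)]
    by (rule map_cong[OF refl], rule conn_cluster_eq[OF assms]) auto
  then show ?thesis using k by (simp add: le_lcp_len_iff)
qed

text \<open>Together with \<open>conn_lcp\<close>: the common prefix measures the highest level down
  to which a path from \<open>u\<close> to \<open>v\<close> has to descend. Level 0 is not recorded
  in the codes and is covered by the connectedness of the graph.\<close>

lemma lcp_conn:
  assumes "u \<in> V" "v \<in> V"
  shows "conn adj (upper x0 (lcp_len (clusters x0 u) (clusters x0 v))) u v"
proof -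
  define k where "k = lcp_len (clusters x0 u) (clusters x0 v)"
  have k: "k \<le> gdist adj x0 u" "k \<le> gdist adj x0 v" "take k (clusters x0 u) = take k (clusters x0 v)"
    using le_lcp_len_iff[of k "clusters x0 u" "clusters x0 v"] by (auto simp: k_def)
  show ?thesis
    unfolding k_def[symmetric]
  proof (cases "k = 0")
    case True
    have "upper x0 0 = V" by (auto simp: upper_def)
    moreover obtain f where "f 0 = u" "f (gdist adj u v) = v"
      "\<And>i. i < gdist adj u v \<Longrightarrow> adj (f i) (f (Suc i))" "\<And>i. i \<le> gdist adj u v \<Longrightarrow> f i \<in> V"
      using geodesic_path[OF assms] by metis
    ultimately show "conn adj (upper x0 k) u v"
      using path_conn[of "gdist adj u v" f V adj] True by simp
  next
    case False
    have "take k (clusters x0 u) ! (k - 1) = take k (clusters x0 v) ! (k - 1)" using k(3) by simp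
    then have "{w. conn adj (upper x0 k) u w} = {w. conn adj (upper x0 k) v w}"
      unfolding take_clusters[OF k(1)] take_clusters[OF k(2)] using False by (simp del: upt_Suc)
    moreover have "conn adj (upper x0 k) v v"
      using assms k(2) by (intro conn_refl) (simp add: upper_def)
    ultimately show "conn adj (upper x0 k) u v" by blast
  qed
qed

text \<open>The lowest vertex of a geodesic cuts it into two pieces, each at least as long as the
  descent from its end to that level; and the common prefix reaches at least this level.\<close>

lemma tree_dist_clusters_le:
  assumes "x0 \<in> V" "u \<in> V" "v \<in> V"
  shows "tree_dist (clusters x0 u) (clusters x0 v) \<le> d u v"
proof -
  let ?n = "gdist adj u v"
  obtain f where f: "f 0 = u" "f ?n = v" "\<And>i. i < ?n \<Longrightarrow> adj (f i) (f (Suc i))"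
    "\<And>i. i \<le> ?n \<Longrightarrow> f i \<in> V" "\<And>i j. i \<le> j \<Longrightarrow> j \<le> ?n \<Longrightarrow> gdist adj (f i) (f j) = j - i"
    using geodesic_path[OF assms(2,3)] by metis
  define k where "k = Min ((\<lambda>i. gdist adj x0 (f i)) ` {..?n})"
  have "k \<in> (\<lambda>i. gdist adj x0 (f i)) ` {..?n}" unfolding k_def by (rule Min_in) auto
  then obtain i where i: "i \<le> ?n" "gdist adj x0 (f i) = k" by auto
  have kle: "k \<le> gdist adj x0 (f j)" if "j \<le> ?n" for j
    unfolding k_def using that by (intro Min_le) auto
  have "conn adj (upper x0 k) (f 0) (f ?n)"
    using f(3,4) kle by (intro path_conn) (auto simp: upper_def)
  then have "k \<le> lcp_len (clusters x0 u) (clusters x0 v)" using f(1,2) conn_lcp by simp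
  moreover have "gdist adj x0 u \<le> k + i"
    using gdist_triangle[OF assms(1) f(4)[OF i(1)] assms(2)] f(5)[of 0 i] f(1) i gdist_commute[of u "f i"]
    by simp
  moreover have "gdist adj x0 v \<le> k + (?n - i)"
    using gdist_triangle[OF assms(1) f(4)[OF i(1)] assms(3)] f(5)[of i ?n] f(2) i by simp
  ultimately show ?thesis using i(1) by (simp add: tree_dist_def)
qed

text \<open>Descents from \<open>u\<close> and \<open>v\<close> to the level of their common prefix
  end in one component, at two vertices that are close by \<open>cluster_bounded\<close>.\<close>

lemma tree_dist_clusters_ge:
  assumes "tight \<Delta>" "x0 \<in> V" "u \<in> V" "v \<in> V"
  shows "d u v \<le> tree_dist (clusters x0 u) (clusters x0 v) + real (6 * \<Delta> + 1)"
proof -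
  define k where "k = lcp_len (clusters x0 u) (clusters x0 v)"
  have k: "k \<le> gdist adj x0 u" "k \<le> gdist adj x0 v"
    using lcp_len_le[of "clusters x0 u" "clusters x0 v"] by (auto simp: k_def)
  have uv: "conn adj (upper x0 k) u v" unfolding k_def by (rule lcp_conn[OF assms(3,4)])
  obtain u' where u': "u' \<in> V" "gdist adj x0 u' = k" "gdist adj u' u = gdist adj x0 u - k"
    "conn adj (upper x0 k) u' u" using descend[OF assms(2,3) k(1)] by metis
  obtain v' where v': "v' \<in> V" "gdist adj x0 v' = k" "gdist adj v' v = gdist adj x0 v - k"
    "conn adj (upper x0 k) v' v" using descend[OF assms(2,4) k(2)] by metis
  have "conn adj (upper x0 k) u' v'"
    using conn_trans[OF u'(4) conn_trans[OF uv conn_sym[OF adj_sym v'(4)]]] .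
  then have "gdist adj u' v' \<le> 6 * \<Delta> + 1"
    by (rule cluster_bounded[OF assms(1,2) u'(2) v'(2)])
  then have "gdist adj u v \<le> (gdist adj x0 u - k) + (6 * \<Delta> + 1) + (gdist adj x0 v - k)"
    using gdist_triangle[OF assms(3) u'(1) assms(4)] gdist_triangle[OF u'(1) v'(1) assms(4)]
      gdist_commute[of u u'] u'(3) v'(3) by linarith
  then show ?thesis using k by (simp add: tree_dist_def k_def[symmetric])
qed

text \<open>The codes satisfy the condition exactly. The error arises from replacing two distances
  on either side, each at the cost of \<open>c\<close>.\<close>

lemma realisation_four_point:
  assumes "tight \<Delta>" "V \<noteq> {}"
  shows "four_point realisation (4 * (real (6 * \<Delta> + 1) + 2))"
proof -
  obtain x0 where x0: "x0 \<in> V" using assms(2) by blast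
  define c where "c = real (6 * \<Delta> + 1) + 2"
  define L where "L p = clusters x0 (fst p)" for p :: "'v \<times> 'v \<times> real"
  have approx: "\<bar>mdist realisation p q - tree_dist (L p) (L q)\<bar> \<le> c" if "p \<in> points" "q \<in> points" for p q
    using mdist_approx[OF that] tree_dist_clusters_le[OF x0, of "fst p" "fst q"]
      tree_dist_clusters_ge[OF assms(1) x0, of "fst p" "fst q"] mdist_first_vertex(1) that
    by (auto simp: c_def L_def)
  show ?thesis
    unfolding four_point_def mspace_realisation c_def[symmetric]
  proof (intro ballI)
    fix p q r s assume m: "p \<in> points" "q \<in> points" "r \<in> points" "s \<in> points"
    show "mdist realisation p q + mdist realisation r s
        \<le> max (mdist realisation p r + mdist realisation q s) (mdist realisation p s + mdist realisation q r) + 4 * c"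
      using tree_dist_four_point[of "L p" "L q" "L r" "L s"] approx[OF m(1,2)] approx[OF m(3,4)]
        approx[OF m(1,3)] approx[OF m(2,4)] approx[OF m(1,4)] approx[OF m(2,3)]
      unfolding max_def abs_le_iff by (auto split: if_splits)
  qed
qed

text \<open>Vertices with the same code become one vertex of the tree, represented by a chosen one
  of them and paired with 0 to fit the vertex type in \<open>quasi_tree\<close>. The codes are
  prefix-closed because descending to a lower level truncates the code.\<close>

lemma realisation_quasi_tree:
  assumes "tight \<Delta>" "V \<noteq> {}"
  shows "quasi_tree realisation"
proof -
  obtain x0 where x0: "x0 \<in> V" using assms(2) by blast
  define rep where "rep v = (SOME u. u \<in> V \<and> clusters x0 u = clusters x0 v)" for v
  have rep: "rep v \<in> V" "clusters x0 (rep v) = clusters x0 v" if "v \<in> V" for v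
    using someI[of "\<lambda>u. u \<in> V \<and> clusters x0 u = clusters x0 v" v] that by (auto simp: rep_def)
  define node :: "'v \<Rightarrow> ('v \<times> 'v \<times> real) \<times> nat" where "node v = ((rep v, rep v, 0), 0)" for v
  define L where "L a = clusters x0 (fst (fst a))" for a :: "('v \<times> 'v \<times> real) \<times> nat"
  define T where "T = metric (node ` V, \<lambda>a b. tree_dist (L a) (L b))"
  have L_node: "L (node v) = clusters x0 v" if "v \<in> V" for v
    using rep[OF that] by (simp add: L_def node_def)
  have inj: "inj_on L (node ` V)"
  proof (rule inj_onI)
    fix a b assume "a \<in> node ` V" "b \<in> node ` V" "L a = L b"
    then obtain u v where "u \<in> V" "v \<in> V" "a = node u" "b = node v" "clusters x0 u = clusters x0 v"
      using L_node by auto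
    then show "a = b" by (simp add: node_def rep_def)
  qed
  have closed: "y \<in> L ` (node ` V)" if aN: "a \<in> node ` V" and prefix: "prefix y (L a)" for a y
  proof -
    obtain u where u: "u \<in> V" "L a = clusters x0 u" using aN L_node by auto
    define k where "k = length y"
    have k: "k \<le> gdist adj x0 u" using prefix_length_le[OF prefix] u(2) by (simp add: k_def)
    have y: "y = take k (clusters x0 u)" using prefix u(2) by (auto simp: prefix_def k_def)
    obtain u' where u': "u' \<in> V" "gdist adj x0 u' = k" "conn adj (upper x0 k) u' u"
      using descend[OF x0 u(1) k] by metis
    have "clusters x0 u' = take k (clusters x0 u)"
      using conn_lcp[OF u'(3)] u'(2) unfolding le_lcp_len_iff by simp
    then show ?thesis using y u'(1) L_node by (metis imageI)
  qed
  have N: "node ` V \<noteq> {}" using assms(2) by simp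
  have T: "tree_metric T" "mspace T = node ` V" "mdist T = (\<lambda>a b. tree_dist (L a) (L b))"
    unfolding T_def
    by (rule tree_metric_of_lists[OF N inj], rule closed, assumption+)+
  define c where "c = real (6 * \<Delta> + 1) + 2"
  have "quasi_isometry realisation T (\<lambda>p. node (fst p))"
    unfolding quasi_isometry_def mspace_realisation
  proof (rule conjI, goal_cases)
    case 1
    show ?case using T(2) mdist_first_vertex(1) by auto
  next
    case 2
    show ?case
    proof (rule exI[of _ 1], rule conjI[OF order_refl], rule exI[of _ c], intro conjI ballI)
    fix p q assume pq: "p \<in> points" "q \<in> points"
    have V: "fst p \<in> V" "fst q \<in> V" using mdist_first_vertex(1) pq by auto
    show "mdist realisation p q / 1 - c \<le> mdist T (node (fst p)) (node (fst q))"
      "mdist T (node (fst p)) (node (fst q)) \<le> 1 * mdist realisation p q + c"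
      using mdist_approx[OF pq] tree_dist_clusters_le[OF x0 V] tree_dist_clusters_ge[OF assms(1) x0 V]
      by (auto simp: T(3) L_node V c_def)
  next
    fix a assume "a \<in> mspace T"
    then obtain v where v: "v \<in> V" "a = node v" using T(2) by auto
    have "mdist T (node v) (node v) = 0" using v T(2) by (intro mdist_self) simp
    then show "\<exists>p\<in>points. mdist T (node (fst p)) a \<le> c"
      using vertex_point[OF v(1)] v(2) by (intro bexI[of _ "(v, v, 0)"]) (auto simp: c_def)
    qed (simp add: c_def)
  qed
  then show ?thesis
    unfolding quasi_tree_def using geodesic_realisation T(1) by blast
qed

end

section \<open>Group actions on realisations\<close>

lemma group_actionI:
  fixes G (structure)
  assumes G: "group G" and closed: "\<And>g x. g \<in> carrier G \<Longrightarrow> x \<in> E \<Longrightarrow> f g x \<in> E"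
    and one: "\<And>x. x \<in> E \<Longrightarrow> f \<one> x = x"
    and mult: "\<And>g h x. g \<in> carrier G \<Longrightarrow> h \<in> carrier G \<Longrightarrow> x \<in> E \<Longrightarrow> f (g \<otimes> h) x = f g (f h x)"
  shows "group_action G E (\<lambda>g. restrict (f g) E)"
proof -
  interpret group G by (rule G)
  have inv: "f g (f (inv g) x) = x" "f (inv g) (f g x) = x" if "g \<in> carrier G" "x \<in> E" for g x
    using mult[of g "inv g" x] mult[of "inv g" g x] one that by simp_all
  have bij: "restrict (f g) E \<in> Bij E" if g: "g \<in> carrier G" for g
  proof -
    have "bij_betw (f g) E E"
      by (rule bij_betw_byWitness[where f' = "f (inv g)"]) (use inv[OF g] closed g in auto)
    then show ?thesis by (auto simp: Bij_def cong: bij_betw_cong)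
  qed
  have "restrict (f (g \<otimes> h)) E = compose E (restrict (f g) E) (restrict (f h) E)"
    if "g \<in> carrier G" "h \<in> carrier G" for g h
    using mult[OF that] closed[OF that(2)] by (auto simp: compose_def fun_eq_iff)
  then have "(\<lambda>g. restrict (f g) E) \<in> hom G (BijGroup E)"
    using bij by (auto simp: hom_def BijGroup_def)
  then have "group_hom G (BijGroup E) (\<lambda>g. restrict (f g) E)"
    by (intro group_hom.intro[OF G group_BijGroup] group_hom_axioms.intro)
  then show ?thesis by (simp add: group_action_def)
qed

text \<open>The last clause compares the displacement of a point with that of its first vertex, at
  distance at most 1 from it; properness rests on this clause.\<close>

theorem (in connected_graph) action_on_realisation:
  fixes G (structure)
  assumes G: "group G" and tight: "tight \<Delta>" and ne: "V \<noteq> {}"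
    and closed: "\<And>g v. g \<in> carrier G \<Longrightarrow> v \<in> V \<Longrightarrow> f g v \<in> V"
    and one: "\<And>v. v \<in> V \<Longrightarrow> f \<one> v = v"
    and mult: "\<And>g h v. g \<in> carrier G \<Longrightarrow> h \<in> carrier G \<Longrightarrow> v \<in> V \<Longrightarrow> f (g \<otimes> h) v = f g (f h v)"
    and adj_f: "\<And>g u v. g \<in> carrier G \<Longrightarrow> adj u v \<Longrightarrow> adj (f g u) (f g v)"
  shows "\<exists>m \<phi>. quasi_tree realisation \<and> coarse_median realisation m \<and> isometric_action G realisation \<phi> \<and>
    (\<forall>g\<in>carrier G. quasimedian realisation m realisation m (\<phi> g)) \<and>
    (\<forall>p\<in>mspace realisation. fst p \<in> V \<and>
       (\<forall>g\<in>carrier G. d (fst p) (f g (fst p)) \<le> mdist realisation p (\<phi> g p) + 2))"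
proof -
  interpret group G by (rule G)
  define \<phi> where "\<phi> g p = (f g (fst p), f g (fst (snd p)), snd (snd p))" for g and p :: "'v \<times> 'v \<times> real"
  have inv_f: "f (inv g) (f g v) = v" if "g \<in> carrier G" "v \<in> V" for g v
    using mult[of "inv g" g v] one that by simp
  have f_eq_iff: "f g u = f g v \<longleftrightarrow> u = v" if "g \<in> carrier G" "u \<in> V" "v \<in> V" for g u v
    using inv_f[OF that(1,2)] inv_f[OF that(1,3)] by metis
  have gdist_le: "gdist adj (f g u) (f g v) \<le> gdist adj u v" if g: "g \<in> carrier G" and uv: "u \<in> V" "v \<in> V" for g u v
  proof -
    obtain h where h: "h 0 = u" "h (gdist adj u v) = v" "\<And>i. i < gdist adj u v \<Longrightarrow> adj (h i) (h (Suc i))"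
      "\<And>i. i \<le> gdist adj u v \<Longrightarrow> h i \<in> V"
      using geodesic_path[OF uv] by metis
    show ?thesis
      using gdist_path_le[of "gdist adj u v" "\<lambda>i. f g (h i)"] h closed[OF g] adj_f[OF g] by simp
  qed
  have gdist_eq: "gdist adj (f g u) (f g v) = gdist adj u v" if "g \<in> carrier G" "u \<in> V" "v \<in> V" for g u v
    using gdist_le[OF that] gdist_le[of "inv g" "f g u" "f g v"] inv_f closed that by simp
  have \<phi>_point: "\<phi> g p \<in> points" if "g \<in> carrier G" "p \<in> points" for g p
    using that(2) adj_f[OF that(1)] closed[OF that(1)] by (auto simp: \<phi>_def points_def)
  have V: "fst p \<in> V" "fst (snd p) \<in> V" if "p \<in> points" for p
    using that by (auto elim: points_cases)
  have vdist_\<phi>: "vdist (\<phi> g p) (f g u) = vdist p u" if "g \<in> carrier G" "p \<in> points" "u \<in> V" for g p u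
    using gdist_eq[OF that(1) V(1)[OF that(2)] that(3)] gdist_eq[OF that(1) V(2)[OF that(2)] that(3)]
    by (cases p) (simp add: \<phi>_def)
  have pdist_\<phi>: "pdist (\<phi> g p) (\<phi> g q) = pdist p q" if g: "g \<in> carrier G" and pq: "p \<in> points" "q \<in> points" for g p q
  proof -
    obtain v w t where p: "p = (v, w, t)" by (cases p)
    have vw: "v \<in> V" "w \<in> V" using V[OF pq(1)] p by auto
    have "fst (\<phi> g q) = f g v \<longleftrightarrow> fst q = v" "fst (snd (\<phi> g q)) = f g w \<longleftrightarrow> fst (snd q) = w"
      using f_eq_iff[OF g V(1)[OF pq(2)] vw(1)] f_eq_iff[OF g V(2)[OF pq(2)] vw(2)] by (simp_all add: \<phi>_def)
    moreover have "\<phi> g p = (f g v, f g w, t)" "snd (snd (\<phi> g q)) = snd (snd q)" by (simp_all add: \<phi>_def p)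
    ultimately show ?thesis using vdist_\<phi>[OF g pq(2) vw(1)] vdist_\<phi>[OF g pq(2) vw(2)] by (simp add: p)
  qed
  have act: "group_action G points (\<lambda>g. restrict (\<phi> g) points)"
  proof (rule group_actionI[OF G])
    show "\<phi> \<one> p = p" if "p \<in> points" for p using one V[OF that] by (simp add: \<phi>_def)
    show "\<phi> (g \<otimes> h) p = \<phi> g (\<phi> h p)" if "g \<in> carrier G" "h \<in> carrier G" "p \<in> points" for g h p
      using mult[OF that(1,2)] V[OF that(3)] by (simp add: \<phi>_def)
  qed (rule \<phi>_point)
  have iso: "isometry realisation realisation (restrict (\<phi> g) points)" if g: "g \<in> carrier G" for g
    unfolding isometry_def mspace_realisation
  proof (intro conjI ballI)
    show "restrict (\<phi> g) points ` points = points"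
      using group_action.surj_prop[OF act g] .
    fix p q assume "p \<in> points" "q \<in> points"
    then show "mdist realisation (restrict (\<phi> g) points p) (restrict (\<phi> g) points q) = mdist realisation p q"
      using pdist_\<phi>[OF g] \<phi>_point[OF g] by (simp add: mdist_realisation)
  qed
  obtain m where m: "coarse_median realisation m"
    using coarse_median_exists[OF realisation_four_point[OF tight ne] _ geodesic_realisation] by auto
  have "isometric_action G realisation (\<lambda>g. restrict (\<phi> g) points)"
    using act iso by (simp add: isometric_action_def)
  moreover have "\<forall>g\<in>carrier G. quasimedian realisation m realisation m (restrict (\<phi> g) points)"
    using isometry_quasimedian[OF realisation_four_point[OF tight ne] m] iso by blast
  moreover have "d (fst p) (f g (fst p)) \<le> mdist realisation p (restrict (\<phi> g) points p) + 2"
    if "p \<in> points" "g \<in> carrier G" for p g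
    using mdist_approx[OF that(1) \<phi>_point[OF that(2,1)]] that by (simp add: \<phi>_def)
  moreover have "quasi_tree realisation" by (rule realisation_quasi_tree[OF tight ne])
  ultimately show ?thesis
    using m V(1) by (intro exI[of _ m] exI[of _ "\<lambda>g. restrict (\<phi> g) points"]) simp
qed

section \<open>Hierarchically hyperbolic groups\<close>

lemma bottleneck_mono:
  assumes "bottleneck X J r B" "B \<le> B'"
  shows "bottleneck X J r B'"
  unfolding bottleneck_def
proof (intro ballI allI impI)
  fix p f n
  assume "p \<in> mspace X" "\<forall>i\<le>n. f i \<in> mspace X" "\<forall>i<n. mdist X (f i) (f (Suc i)) \<le> J"
    "mdist X (f 0) p + mdist X p (f n) \<le> mdist X (f 0) (f n) + r"
  then have "\<exists>i\<le>n. mdist X (f i) p \<le> B"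
    using assms(1)[unfolded bottleneck_def, rule_format, of p n f] by simp
  then show "\<exists>i\<le>n. mdist X (f i) p \<le> B'" using assms(2) by (auto intro: order_trans)
qed

lemma finite_word_ball:
  fixes G (structure)
  assumes "group G" "finite S" "S \<subseteq> carrier G" "generate G S = carrier G"
  shows "finite {g \<in> carrier G. word_dist G S \<one> g \<le> R}"
proof -
  interpret group G by fact
  define A where "A = S \<union> m_inv G ` S"
  define ev where "ev w = foldr (\<otimes>) w \<one>" for w
  have A: "finite A" "A \<subseteq> carrier G" using assms by (auto simp: A_def)
  have ev_closed: "ev w \<in> carrier G" if "set w \<subseteq> A" for w
    using that A(2) by (induction w) (auto simp: ev_def)
  have ev_append: "ev (v @ w) = ev v \<otimes> ev w" if "set v \<subseteq> A" "set w \<subseteq> A" for v w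
    using that
  proof (induction v)
    case (Cons a v)
    then have "a \<in> carrier G" "ev v \<in> carrier G" "ev w \<in> carrier G"
      using A(2) ev_closed by auto
    then show ?case using Cons by (simp add: ev_def m_assoc)
  qed (use ev_closed in \<open>simp add: ev_def\<close>)
  have word: "\<exists>w. set w \<subseteq> A \<and> ev w = g" if "g \<in> generate G S" for g
    using that
  proof (induction rule: generate.induct)
    case one
    show ?case by (intro exI[of _ "[]"]) (simp add: ev_def)
  next
    case (incl h)
    then show ?case using assms(3) by (intro exI[of _ "[h]"]) (auto simp: ev_def A_def)
  next
    case (inv h)
    then have "h \<in> carrier G" using assms(3) by blast
    then show ?case using inv by (intro exI[of _ "[inv h]"]) (simp add: ev_def A_def)
  next
    case (eng h1 h2)
    then obtain v w where "set v \<subseteq> A" "ev v = h1" "set w \<subseteq> A" "ev w = h2" by blast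
    then show ?case using ev_append by (intro exI[of _ "v @ w"]) auto
  qed
  have "{g \<in> carrier G. word_dist G S \<one> g \<le> R} \<subseteq> ev ` {w. set w \<subseteq> A \<and> length w \<le> nat \<lfloor>R\<rfloor>}"
  proof
    fix g assume "g \<in> {g \<in> carrier G. word_dist G S \<one> g \<le> R}"
    then have g: "g \<in> carrier G" "real (word_norm G S g) \<le> R" by (auto simp: word_dist_def)
    obtain w where w: "set w \<subseteq> A" "ev w = g" using word g(1) assms(4) by blast
    \<comment> \<open>The \<open>LEAST\<close> in \<open>word_norm\<close> is attained because some
      word represents \<open>g\<close>.\<close>
    have "\<exists>v. length v = word_norm G S g \<and> set v \<subseteq> S \<union> m_inv G ` S \<and> foldr (\<otimes>) v \<one> = g"
      unfolding word_norm_def by (rule LeastI[of _ "length w"]) (use w in \<open>auto simp: A_def ev_def\<close>)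
    then obtain v where v: "length v = word_norm G S g" "set v \<subseteq> A" "ev v = g"
      by (auto simp: A_def ev_def)
    have "length v \<le> nat \<lfloor>R\<rfloor>" using v(1) g(2) by linarith
    then show "g \<in> ev ` {w. set w \<subseteq> A \<and> length w \<le> nat \<lfloor>R\<rfloor>}" using v by blast
  qed
  then show ?thesis
    by (rule finite_subset) (intro finite_imageI finite_lists_length_le A(1))
qed

section \<open>Nesting, realisation of points, and uniform constants\<close>

context hierarchically_hyperbolic_group
begin

abbreviation chain :: "'d set \<Rightarrow> bool" where
  "chain A \<equiv> A \<subseteq> Dom \<and> (\<forall>U\<in>A. \<forall>V\<in>A. nest U V \<or> nest V U)"

lemma nest_refl: "U \<in> Dom \<Longrightarrow> nest U U"
  using nest_order(1) by (auto simp: reflp_on_def)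

lemma nest_trans: "U \<in> Dom \<Longrightarrow> V \<in> Dom \<Longrightarrow> W \<in> Dom \<Longrightarrow> nest U V \<Longrightarrow> nest V W \<Longrightarrow> nest U W"
  using nest_order(3) by (meson transp_onD)

lemma nest_antisym: "U \<in> Dom \<Longrightarrow> V \<in> Dom \<Longrightarrow> nest U V \<Longrightarrow> nest V U \<Longrightarrow> U = V"
  using nest_order(2) by (meson antisymp_onD)

text \<open>As chains have bounded length, the measure is the room left for extending a chain below
  its least element \<open>W\<close>.\<close>

lemma nest_induct [consumes 1, case_names step]:
  assumes "W \<in> Dom" "\<And>W. W \<in> Dom \<Longrightarrow> (\<And>T. T \<in> Dom \<Longrightarrow> nest T W \<Longrightarrow> T \<noteq> W \<Longrightarrow> P T) \<Longrightarrow> P W"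
  shows "P W"
proof -
  obtain n where n: "\<And>A. chain A \<Longrightarrow> finite A \<and> card A \<le> n"
    using finite_complexity by metis
  have "P W" if "chain A" "W \<in> A" "\<And>U. U \<in> A \<Longrightarrow> nest W U" for A W
    using that
  proof (induction "n - card A" arbitrary: A W rule: less_induct)
    case less
    have W: "W \<in> Dom" using less.prems by blast
    show ?case
    proof (rule assms(2)[OF W])
      fix T assume T: "T \<in> Dom" "nest T W" "T \<noteq> W"
      have TU: "nest T U" if "U \<in> insert T A" for U
        using that T W less.prems nest_refl[OF T(1)] nest_trans[OF T(1) W, of U] by blast
      then have chain: "chain (insert T A)" using less.prems(1) T(1) by blast
      have "T \<notin> A" using less.prems(3)[of T] nest_antisym[OF T(1) W] T by blast
      then have "card A < card (insert T A)" using n[OF less.prems(1)] by simp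
      then have "n - card (insert T A) < n - card A" using n[OF chain] by linarith
      then show "P T" using less.hyps[OF _ chain] TU by blast
    qed
  qed
  from this[of "{W}" W] show ?thesis using assms(1) nest_refl by simp
qed

text \<open>The axiom provides a unique maximal element. That every domain is nested in it follows
  by climbing, which must end because chains have bounded length.\<close>

lemma top_domain:
  obtains M where "M \<in> Dom" "\<And>U. U \<in> Dom \<Longrightarrow> nest U M"
proof -
  obtain M where M: "M \<in> Dom" and unique: "\<And>V. V \<in> Dom \<Longrightarrow> (\<forall>U\<in>Dom. nest V U \<longrightarrow> U = V) \<Longrightarrow> V = M"
    using nest_maximal by blast
  obtain n where n: "\<And>A. chain A \<Longrightarrow> finite A \<and> card A \<le> n"
    using finite_complexity by metis
  have "nest W M" if "chain A" "W \<in> A" "\<And>U. U \<in> A \<Longrightarrow> nest U W" for A W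
    using that
  proof (induction "n - card A" arbitrary: A W rule: less_induct)
    case less
    have W: "W \<in> Dom" using less.prems by blast
    show ?case
    proof (cases "\<forall>U\<in>Dom. nest W U \<longrightarrow> U = W")
      case True
      then show ?thesis using unique[OF W] nest_refl[OF W] by simp
    next
      case False
      then obtain T where T: "T \<in> Dom" "nest W T" "T \<noteq> W" by blast
      have UT: "nest U T" if "U \<in> insert T A" for U
        using that T W less.prems nest_refl[OF T(1)] nest_trans[OF _ W T(1), of U] by blast
      then have chain: "chain (insert T A)" using less.prems(1) T(1) by blast
      have "T \<notin> A" using less.prems(3)[of T] nest_antisym[OF T(1) W] T by blast
      then have "card A < card (insert T A)" using n[OF less.prems(1)] by simp
      then have "n - card (insert T A) < n - card A" using n[OF chain] by linarith
      then have "nest T M" using less.hyps[OF _ chain] UT by blast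
      then show ?thesis using nest_trans[OF W T(1) M T(2)] by blast
    qed
  qed
  then have "nest U M" if "U \<in> Dom" for U using that nest_refl[OF that] by (metis empty_iff empty_subsetI insert_iff insert_subset)
  then show thesis using that M by blast
qed

text \<open>By large links, the far domains properly nested in \<open>W\<close> lie below finitely
  many domains properly nested in \<open>W\<close>. Induction along nesting ends at the top
  domain.\<close>

lemma finite_far_domains:
  assumes "x \<in> carrier G" "y \<in> carrier G"
  shows "finite {U \<in> Dom. E 0 \<le> set_dist (C U) (\<pi> U x) (\<pi> U y)}"
proof -
  let ?far = "\<lambda>W. {U \<in> Dom. nest U W \<and> E 0 \<le> set_dist (C U) (\<pi> U x) (\<pi> U y)}"
  have "finite (?far W)" if "W \<in> Dom" for W
    using that
  proof (induction rule: nest_induct)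
    case (step W)
    obtain L0 where "\<forall>W\<in>Dom. \<forall>x\<in>carrier G. \<forall>x'\<in>carrier G.
          let N = L0 * set_dist (C W) (\<pi> W x) (\<pi> W x') + L0 in
          \<exists>L\<subseteq>{T \<in> Dom. nest T W \<and> T \<noteq> W}. finite L \<and> int (card L) \<le> \<lfloor>N\<rfloor> \<and>
            (\<forall>T\<in>Dom. nest T W \<and> T \<noteq> W \<longrightarrow> (\<exists>T'\<in>L. nest T T') \<or> set_dist (C T) (\<pi> T x) (\<pi> T x') < E 0) \<and>
            (\<forall>T'\<in>L. set_dist (C W) (\<pi> W x) (\<rho> T' W) \<le> N)"
      using large_links by blast
    then have "\<exists>L\<subseteq>{T \<in> Dom. nest T W \<and> T \<noteq> W}. finite L \<and>
        (\<forall>T\<in>Dom. nest T W \<and> T \<noteq> W \<longrightarrow> (\<exists>T'\<in>L. nest T T') \<or> set_dist (C T) (\<pi> T x) (\<pi> T y) < E 0)"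
      using step(1) assms unfolding Let_def by meson
    then obtain L where L: "L \<subseteq> {T \<in> Dom. nest T W \<and> T \<noteq> W}" "finite L"
      "\<forall>T\<in>Dom. nest T W \<and> T \<noteq> W \<longrightarrow> (\<exists>T'\<in>L. nest T T') \<or> set_dist (C T) (\<pi> T x) (\<pi> T y) < E 0"
      by blast
    have "?far W \<subseteq> insert W (\<Union>T\<in>L. ?far T)"
      using L(3) by force
    moreover have "finite (\<Union>T\<in>L. ?far T)" using L(1,2) step(2) by blast
    ultimately show ?case by (meson finite_insert finite_subset)
  qed
  moreover obtain M where M: "M \<in> Dom" "\<And>U. U \<in> Dom \<Longrightarrow> nest U M" using top_domain by metis
  ultimately have "finite (?far M)" by blast
  moreover have "{U \<in> Dom. E 0 \<le> set_dist (C U) (\<pi> U x) (\<pi> U y)} \<subseteq> ?far M" using M(2) by blast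
  ultimately show ?thesis by (rule finite_subset[rotated])
qed

lemma E0_nonneg: "0 \<le> E 0"
  by (rule E_nonneg) simp

lemma \<pi>_small: "U \<in> Dom \<Longrightarrow> x \<in> carrier G \<Longrightarrow> small_set (C U) (E 0) (\<pi> U x)"
  using \<pi>_coarse_map[of U x] by (simp add: small_set_def)

lemma \<rho>_small:
  "U \<in> Dom \<Longrightarrow> V \<in> Dom \<Longrightarrow> transverse nest orth U V \<Longrightarrow> small_set (C V) (E 0) (\<rho> U V)"
  using \<rho>_bounded[of U V] by (simp add: small_set_def)

lemma transverse_sym:
  "U \<in> Dom \<Longrightarrow> V \<in> Dom \<Longrightarrow> transverse nest orth U V \<Longrightarrow> transverse nest orth V U"
  using orth_sym(1) unfolding transverse_def by (metis symp_onD)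

text \<open>Partial realisation applies to points in the image of \<open>\<pi> V\<close>, so
  \<open>p\<close> is first moved by \<open>E 0\<close>. The other summands \<open>E 0\<close> are
  the realisation error and the diameters of the sets.\<close>

lemma realise_point:
  assumes V: "V \<in> Dom" and p: "p \<in> mspace (C V)"
  obtains x where "x \<in> carrier G" "sup_dist (C V) (\<pi> V x) {p} \<le> 3 * E 0"
    "\<And>W. W \<in> Dom \<Longrightarrow> transverse nest orth V W \<Longrightarrow> sup_dist (C W) (\<pi> W x) (\<rho> V W) \<le> 3 * E 0"
proof -
  obtain y q where y: "y \<in> carrier G" "q \<in> \<pi> V y" "mdist (C V) p q \<le> E 0"
    using \<pi>_coarsely_onto[OF V p] by blast
  have q: "q \<in> mspace (C V)" using \<pi>_small[OF V y(1)] y(2) by (auto simp: small_set_def)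
  obtain x where x: "x \<in> carrier G" and near: "\<forall>V'\<in>{V}. set_dist (C V') (\<pi> V' x) {q} \<le> E 0 \<and>
      (\<forall>W\<in>Dom. nest V' W \<and> V' \<noteq> W \<or> transverse nest orth W V' \<longrightarrow> set_dist (C W) (\<pi> W x) (\<rho> V' W) \<le> E 0)"
    using partial_realisation[of "{V}" "\<lambda>_. q"] V y(1,2) by (auto simp: pairwise_def)
  have "sup_dist (C V) (\<pi> V x) {q} \<le> 2 * E 0"
    using sup_dist_le_set_dist[OF \<pi>_small[OF V x] small_set_singleton[OF q order_refl]] near by simp
  then have "sup_dist (C V) (\<pi> V x) {p} \<le> 3 * E 0"
    using sup_dist_triangle[OF \<pi>_small[OF V x] small_set_singleton[OF q order_refl]
        small_set_singleton[OF p order_refl]] y(3) mdist_commute[of "C V" p q] by simp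
  moreover have "sup_dist (C W) (\<pi> W x) (\<rho> V W) \<le> 3 * E 0"
    if "W \<in> Dom" "transverse nest orth V W" for W
    using sup_dist_le_set_dist[OF \<pi>_small[OF that(1) x] \<rho>_small[OF V that]] near
      transverse_sym[OF V that] that(1) by fastforce
  ultimately show thesis using that x by blast
qed

lemma isom_mem: "g \<in> carrier G \<Longrightarrow> U \<in> Dom \<Longrightarrow> p \<in> mspace (C U) \<Longrightarrow> isom g U p \<in> mspace (C (act g U))"
  using iso_isometry[of g U] unfolding isometry_def by blast

lemma act_one: "U \<in> Dom \<Longrightarrow> act \<one> U = U"
  using dom_act.id_eq_one by (metis restrict_apply')

text \<open>Only products are prescribed, so the isometry of \<one> is idempotent; an injective
  idempotent map is the identity.\<close>

lemma isom_one:
  assumes "U \<in> Dom" "p \<in> mspace (C U)"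
  shows "isom \<one> U p = p"
proof -
  have act1: "act \<one> U = U" by (rule act_one[OF assms(1)])
  have q: "isom \<one> U p \<in> mspace (C U)" using isom_mem[OF one_closed assms] act1 by simp
  have "isom \<one> U (isom \<one> U p) = isom \<one> U p"
    using iso_mult[OF one_closed one_closed assms] act1 by simp
  moreover have "mdist (C U) (isom \<one> U (isom \<one> U p)) (isom \<one> U p) = mdist (C U) (isom \<one> U p) p"
    using iso_isometry[OF one_closed assms(1)] act1 q assms(2) unfolding isometry_def by simp
  ultimately show ?thesis using q assms(2) mdist_self[OF q] by (simp add: mdist_zero)
qed

lemma act_mult: "g \<in> carrier G \<Longrightarrow> h \<in> carrier G \<Longrightarrow> U \<in> Dom \<Longrightarrow> act (g \<otimes> h) U = act g (act h U)"
  using dom_act.composition_rule by blast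

lemma act_inv:
  assumes "g \<in> carrier G" "U \<in> Dom"
  shows "act (inv g) (act g U) = U" "act g (act (inv g) U) = U"
  using act_mult[of "inv g" g U] act_mult[of g "inv g" U] act_one assms by simp_all

text \<open>The constants of one representative of each of the finitely many orbits are transported
  to all domains by the isometries.\<close>

lemma uniform_bottleneck:
  assumes "\<And>U. U \<in> Dom \<Longrightarrow> quasi_tree (C U)"
  shows "\<exists>B. \<forall>U\<in>Dom. bottleneck (C U) J r B"
proof -
  define rep where "rep Orb = (SOME U. U \<in> Dom \<and> Orb = orbit G act U)" for Orb
  have rep: "rep Orb \<in> Dom" "Orb = orbit G act (rep Orb)" if "Orb \<in> orbits G Dom act" for Orb
  proof -
    have "\<exists>U. U \<in> Dom \<and> Orb = orbit G act U" using that by (auto simp: orbits_def)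
    then have "rep Orb \<in> Dom \<and> Orb = orbit G act (rep Orb)" unfolding rep_def by (rule someI_ex)
    then show "rep Orb \<in> Dom" "Orb = orbit G act (rep Orb)" by auto
  qed
  have "\<forall>U\<in>Dom. \<exists>B. bottleneck (C U) J r B" using quasi_tree_bottleneck assms by blast
  then obtain B where B: "\<And>U. U \<in> Dom \<Longrightarrow> bottleneck (C U) J r (B U)" by metis
  let ?B = "Max ((\<lambda>Orb. B (rep Orb)) ` orbits G Dom act)"
  have "bottleneck (C U) J r ?B" if U: "U \<in> Dom" for U
  proof -
    have Orb: "orbit G act U \<in> orbits G Dom act" using U by (auto simp: orbits_def)
    define R where "R = rep (orbit G act U)"
    have R: "R \<in> Dom" "orbit G act U = orbit G act R" using rep[OF Orb] by (auto simp: R_def)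
    have "U \<in> orbit G act R" using dom_act.orbit_refl[OF U] R(2) by simp
    then obtain g where g: "g \<in> carrier G" "act g R = U" by (auto simp: orbit_def)
    have "bottleneck (C U) J r (B R)"
      using bottleneck_isometry[OF B[OF R(1)] iso_isometry[OF g(1) R(1)]] g(2) by simp
    moreover have "B R \<le> ?B"
      using Orb finitely_many_orbits by (intro Max_ge) (auto simp: R_def)
    ultimately show ?thesis by (rule bottleneck_mono)
  qed
  then show ?thesis by blast
qed

end

section \<open>A single colour\<close>

locale hhg_colour =
  hierarchically_hyperbolic_group G S E Dom C \<pi> nest orth \<rho> \<rho>map act isom
  for G :: "('g, 'm) monoid_scheme" (structure)
    and S :: "'g set" and E :: "real \<Rightarrow> real" and Dom :: "'d set" and C :: "'d \<Rightarrow> 'p metric"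
    and \<pi> :: "'d \<Rightarrow> 'g \<Rightarrow> 'p set" and nest :: "'d \<Rightarrow> 'd \<Rightarrow> bool" and orth :: "'d \<Rightarrow> 'd \<Rightarrow> bool"
    and \<rho> :: "'d \<Rightarrow> 'd \<Rightarrow> 'p set" and \<rho>map :: "'d \<Rightarrow> 'd \<Rightarrow> 'p \<Rightarrow> 'p set"
    and act :: "'g \<Rightarrow> 'd \<Rightarrow> 'd" and isom :: "'g \<Rightarrow> 'd \<Rightarrow> 'p \<Rightarrow> 'p" +
  fixes Y :: "'d set"
  assumes Y_Dom: "Y \<subseteq> Dom"
    and Y_transverse: "pairwise (transverse nest orth) Y"
    and Y_invariant: "\<And>g. g \<in> carrier G \<Longrightarrow> act g ` Y = Y"
    and Y_quasi_trees: "\<And>U. U \<in> Dom \<Longrightarrow> quasi_tree (C U)"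
begin

lemma Y_tr: "U \<in> Y \<Longrightarrow> V \<in> Y \<Longrightarrow> U \<noteq> V \<Longrightarrow> transverse nest orth U V"
  using Y_transverse by (simp add: pairwise_def)

lemma act_Y: "g \<in> carrier G \<Longrightarrow> U \<in> Y \<Longrightarrow> act g U \<in> Y"
  using Y_invariant by blast

lemma DomI: "U \<in> Y \<Longrightarrow> U \<in> Dom"
  using Y_Dom by blast

text \<open>Behrstock's inequality for domains costs \<open>3 * E 0\<close> for replacing
  \<open>X\<close> by a group element and \<open>3 * E 0\<close> for consistency in terms of
  supremal distances. The summand 1 keeps \<theta> positive.\<close>

definition \<theta> :: real where "\<theta> = 9 * E 0 + 1"

text \<open>A group element standing for the domain \<open>X\<close>: consistency and large links
  speak of group elements, and are carried over to domains in this way.\<close>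

lemma realise_near:
  assumes "X \<in> Y"
  obtains x where "x \<in> carrier G"
    "\<And>U. U \<in> Y \<Longrightarrow> U \<noteq> X \<Longrightarrow> sup_dist (C U) (\<rho> X U) (\<pi> U x) \<le> 3 * E 0"
proof -
  obtain p where p: "p \<in> mspace (C X)"
    using \<pi>_small[OF DomI[OF assms] one_closed] by (auto simp: small_set_def)
  obtain x where x: "x \<in> carrier G" "sup_dist (C X) (\<pi> X x) {p} \<le> 3 * E 0"
    "\<And>W. W \<in> Dom \<Longrightarrow> transverse nest orth X W \<Longrightarrow> sup_dist (C W) (\<pi> W x) (\<rho> X W) \<le> 3 * E 0"
    using realise_point[OF DomI[OF assms] p] by metis
  then show thesis
    using that[OF x(1)] Y_tr[OF assms] DomI sup_dist_commute by metis
qed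

sublocale proj: metric_projections Y C \<rho> \<theta>
proof
  show "0 < \<theta>" using E0_nonneg by (simp add: \<theta>_def)
next
  fix U X assume "U \<in> Y" "X \<in> Y" "X \<noteq> U"
  then show "small_set (C U) \<theta> (\<rho> X U)"
    using small_set_mono[OF \<rho>_small[OF DomI DomI Y_tr]] E0_nonneg by (simp add: \<theta>_def)
next
  fix U V X assume UVX: "U \<in> Y" "V \<in> Y" "X \<in> Y" "U \<noteq> V" "X \<noteq> U" "X \<noteq> V"
  obtain x where x: "x \<in> carrier G"
    "\<And>U. U \<in> Y \<Longrightarrow> U \<noteq> X \<Longrightarrow> sup_dist (C U) (\<rho> X U) (\<pi> U x) \<le> 3 * E 0"
    using realise_near[OF UVX(3)] by metis
  have one_side: "sup_dist (C U) (\<rho> X U) (\<rho> V U) \<le> \<theta>"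
    if "set_dist (C U) (\<pi> U x) (\<rho> V U) \<le> E 0" "U \<in> Y" "V \<in> Y" "U \<noteq> V" "X \<noteq> U" for U V
  proof -
    have r: "small_set (C U) (E 0) (\<rho> X U)" "small_set (C U) (E 0) (\<rho> V U)" "small_set (C U) (E 0) (\<pi> U x)"
      using \<rho>_small[OF DomI[OF UVX(3)] DomI[OF that(2)] Y_tr[OF UVX(3) that(2,5)]]
        \<rho>_small[OF DomI[OF that(3)] DomI[OF that(2)] Y_tr[OF that(3,2)]] that(4)
        \<pi>_small[OF DomI[OF that(2)] x(1)] by auto
    have "sup_dist (C U) (\<pi> U x) (\<rho> V U) \<le> 3 * E 0"
      using sup_dist_le_set_dist[OF r(3,2)] that(1) by linarith
    then show ?thesis
      using sup_dist_triangle[OF r(1,3,2)] x(2)[OF that(2) that(5)[symmetric]] E0_nonneg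
      unfolding \<theta>_def by linarith
  qed
  have "set_dist (C U) (\<pi> U x) (\<rho> V U) \<le> E 0 \<or> set_dist (C V) (\<pi> V x) (\<rho> U V) \<le> E 0"
    using transverse_consistency[OF DomI[OF UVX(1)] DomI[OF UVX(2)] Y_tr[OF UVX(1,2,4)] x(1)]
    unfolding min_le_iff_disj .
  then show "sup_dist (C U) (\<rho> X U) (\<rho> V U) \<le> \<theta> \<or> sup_dist (C V) (\<rho> X V) (\<rho> U V) \<le> \<theta>"
    using one_side[of U V] one_side[of V U] UVX by blast
next
  fix X Z assume XZ: "X \<in> Y" "Z \<in> Y"
  obtain x where x: "x \<in> carrier G"
    "\<And>U. U \<in> Y \<Longrightarrow> U \<noteq> X \<Longrightarrow> sup_dist (C U) (\<rho> X U) (\<pi> U x) \<le> 3 * E 0"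
    using realise_near[OF XZ(1)] by metis
  obtain z where z: "z \<in> carrier G"
    "\<And>U. U \<in> Y \<Longrightarrow> U \<noteq> Z \<Longrightarrow> sup_dist (C U) (\<rho> Z U) (\<pi> U z) \<le> 3 * E 0"
    using realise_near[OF XZ(2)] by metis
  show "finite {U \<in> Y - {X, Z}. 8 * \<theta> < sup_dist (C U) (\<rho> X U) (\<rho> Z U)}"
  proof (rule finite_subset[OF _ finite_far_domains[OF x(1) z(1)]], rule subsetI)
    fix U assume "U \<in> {U \<in> Y - {X, Z}. 8 * \<theta> < sup_dist (C U) (\<rho> X U) (\<rho> Z U)}"
    then have U: "U \<in> Y" "U \<noteq> X" "U \<noteq> Z" "8 * \<theta> < sup_dist (C U) (\<rho> X U) (\<rho> Z U)" by auto
    have r: "small_set (C U) (E 0) (\<rho> X U)" "small_set (C U) (E 0) (\<rho> Z U)"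
      "small_set (C U) (E 0) (\<pi> U x)" "small_set (C U) (E 0) (\<pi> U z)"
      using \<rho>_small[OF DomI[OF XZ(1)] DomI[OF U(1)] Y_tr[OF XZ(1) U(1)]]
        \<rho>_small[OF DomI[OF XZ(2)] DomI[OF U(1)] Y_tr[OF XZ(2) U(1)]] U(2,3)
        \<pi>_small[OF DomI[OF U(1)] x(1)] \<pi>_small[OF DomI[OF U(1)] z(1)] by auto
    have "sup_dist (C U) (\<rho> X U) (\<rho> Z U) \<le> 3 * E 0 + (sup_dist (C U) (\<pi> U x) (\<pi> U z) + 3 * E 0)"
      using sup_dist_triangle[OF r(1,3,2)] sup_dist_triangle[OF r(3,4,2)] x(2)[OF U(1,2)] z(2)[OF U(1,3)]
        sup_dist_commute[of "C U" "\<rho> Z U" "\<pi> U z"] by linarith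
    moreover have "8 * (9 * E 0 + 1) < sup_dist (C U) (\<rho> X U) (\<rho> Z U)" using U(4) by (simp add: \<theta>_def)
    ultimately have "E 0 \<le> set_dist (C U) (\<pi> U x) (\<pi> U z)"
      using sup_dist_le_set_dist[OF r(3,4)] E0_nonneg by (simp add: algebra_simps)
    then show "U \<in> {U \<in> Dom. E 0 \<le> set_dist (C U) (\<pi> U x) (\<pi> U z)}" using DomI[OF U(1)] by simp
  qed
qed

text \<open>The threshold of \<open>proj.Q_exact\<close>; it also exceeds the diameter bound
  \<open>2 * \<theta>\<close> of the saturated projections.\<close>

definition \<kappa> :: real where "\<kappa> = 12 * \<theta>"

sublocale strong: strong_projections Y C proj.Q \<kappa>
proof
  show "1 \<le> \<kappa>" using E0_nonneg by (simp add: \<kappa>_def \<theta>_def)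
next
  fix U X assume "U \<in> Y" "X \<in> Y" "X \<noteq> U"
  then show "small_set (C U) \<kappa> (proj.Q U X)"
    using small_set_mono[OF proj.Q_small] proj.\<theta>_pos by (simp add: \<kappa>_def)
next
  fix U V X assume "U \<in> Y" "V \<in> Y" "X \<in> Y" "U \<noteq> V" "X \<noteq> V" "X \<noteq> U"
    "\<kappa> < sup_dist (C V) (proj.Q V X) (proj.Q V U)"
  then show "proj.Q U X = proj.Q U V" unfolding \<kappa>_def by (intro proj.Q_exact(2))
next
  fix X Z assume "X \<in> Y" "Z \<in> Y"
  then show "finite {U \<in> Y - {X, Z}. \<kappa> < sup_dist (C U) (proj.Q U X) (proj.Q U Z)}"
    unfolding \<kappa>_def by (rule proj.finite_large_Q)
next
  fix U assume "U \<in> Y"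
  then show "geodesic_space (C U)" using hyperbolic DomI by blast
next
  fix J r
  obtain B where "\<forall>U\<in>Dom. bottleneck (C U) J r B"
    using uniform_bottleneck[OF Y_quasi_trees] by metis
  then show "\<exists>B. \<forall>U\<in>Y. bottleneck (C U) J r B" using DomI by blast
qed

lemma strong_tight: "\<exists>\<Delta>. strong.tight \<Delta>"
proof -
  obtain \<Delta> where \<Delta>: "\<forall>x\<in>strong.verts. \<forall>y\<in>strong.verts. \<forall>z\<in>strong.between x y. \<forall>A.
      conn strong.adj A x y \<longrightarrow> (\<exists>a\<in>A. gdist strong.adj a z \<le> \<Delta>)"
    using strong.between_close by (rule exE)
  have "strong.tight \<Delta>"
    unfolding strong.tight_def
  proof (intro ballI)
    fix x y assume xy: "x \<in> strong.verts" "y \<in> strong.verts"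
    then have "strong.between x y \<subseteq> strong.verts" by (auto simp: strong.between_def)
    then show "\<exists>N\<subseteq>strong.verts. conn strong.adj N x y \<and>
        (\<forall>z\<in>N. \<forall>A. conn strong.adj A x y \<longrightarrow> (\<exists>a\<in>A. gdist strong.adj a z \<le> \<Delta>))"
      using strong.standard_path[OF xy] \<Delta>[rule_format, OF xy] by (intro exI[of _ "strong.between x y"]) simp
  qed
  then show ?thesis by blast
qed

section \<open>Equivariance\<close>

lemma act_eq_iff: "g \<in> carrier G \<Longrightarrow> U \<in> Y \<Longrightarrow> V \<in> Y \<Longrightarrow> act g U = act g V \<longleftrightarrow> U = V"
  using act_inv(1)[of g U] act_inv(1)[of g V] DomI by metis

lemma \<rho>_act:
  assumes "g \<in> carrier G" "U \<in> Y" "X \<in> Y" "X \<noteq> U"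
  shows "\<rho> (act g X) (act g U) = isom g U ` \<rho> X U"
  using \<rho>_equivariant[of g X U] Y_tr[of X U] assms DomI by simp

lemma D_act:
  assumes g: "g \<in> carrier G" and "U \<in> Y" "X \<in> Y" "Z \<in> Y" "X \<noteq> U" "Z \<noteq> U"
  shows "sup_dist (C (act g U)) (\<rho> (act g X) (act g U)) (\<rho> (act g Z) (act g U)) =
    sup_dist (C U) (\<rho> X U) (\<rho> Z U)"
  using sup_dist_isometry[OF iso_isometry[OF g DomI], of U "\<rho> X U" "\<rho> Z U"] \<rho>_act[OF g] assms
    proj.\<rho>_small[of U X] proj.\<rho>_small[of U Z] by (simp add: small_set_def)

lemma behind_act:
  assumes "g \<in> carrier G" "proj.behind U X Z"
  shows "proj.behind (act g U) (act g X) (act g Z)"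
proof -
  have m: "U \<in> Y" "X \<in> Y" "Z \<in> Y" "X \<noteq> Z" "X \<noteq> U" "Z \<noteq> U"
    "8 * \<theta> < sup_dist (C Z) (\<rho> X Z) (\<rho> U Z)"
    using assms(2) unfolding proj.behind_def by auto
  have "8 * \<theta> < sup_dist (C (act g Z)) (\<rho> (act g X) (act g Z)) (\<rho> (act g U) (act g Z))"
    using D_act[OF assms(1) m(3,2,1,4)] m(6,7) by simp
  then show ?thesis
    unfolding proj.behind_def using m act_Y[OF assms(1)] act_eq_iff[OF assms(1)] by simp
qed

lemma same_side_act:
  assumes g: "g \<in> carrier G" and "proj.same_side U X Z"
  shows "proj.same_side (act g U) (act g X) (act g Z)"
  using assms(2) unfolding proj.same_side_def
proof (induction rule: rtranclp_induct)
  case (step Z W)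
  then have "proj.behind (act g U) (act g Z) (act g W) \<or> proj.behind (act g U) (act g W) (act g Z)"
    using behind_act[OF g] by blast
  then show ?case by (rule rtranclp.rtrancl_into_rtrancl[OF step.IH])
qed simp

text \<open>Saturation is a union over a class defined by distances alone, so it is equivariant
  without error; \<open>inv g\<close> transports the class back.\<close>

lemma Q_act:
  assumes g: "g \<in> carrier G" and U: "U \<in> Y" and X: "X \<in> Y" "X \<noteq> U"
  shows "proj.Q (act g U) (act g X) = isom g U ` proj.Q U X"
proof -
  have "{Z \<in> Y - {act g U}. proj.same_side (act g U) (act g X) Z} =
      act g ` {Z \<in> Y - {U}. proj.same_side U X Z}"
  proof (intro equalityI subsetI)
    fix Z assume "Z \<in> {Z \<in> Y - {act g U}. proj.same_side (act g U) (act g X) Z}"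
    then have Z: "Z \<in> Y" "Z \<noteq> act g U" "proj.same_side (act g U) (act g X) Z" by auto
    define W where "W = act (inv g) Z"
    have W: "W \<in> Y" "Z = act g W"
      using act_Y[of "inv g" Z] act_inv(2)[of g Z] g Z(1) DomI by (auto simp: W_def)
    have "proj.same_side U X W"
      using same_side_act[of "inv g", OF _ Z(3)] g act_inv(1)[of g U] act_inv(1)[of g X] DomI U X
      by (simp add: W_def)
    then show "Z \<in> act g ` {Z \<in> Y - {U}. proj.same_side U X Z}" using W Z(2) by blast
  next
    fix Z assume "Z \<in> act g ` {Z \<in> Y - {U}. proj.same_side U X Z}"
    then show "Z \<in> {Z \<in> Y - {act g U}. proj.same_side (act g U) (act g X) Z}"
      using act_Y[OF g] act_eq_iff[OF g _ U] same_side_act[OF g] by auto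
  qed
  then have "proj.Q (act g U) (act g X) =
      (\<Union>Z\<in>{Z \<in> Y - {U}. proj.same_side U X Z}. \<rho> (act g Z) (act g U))"
    by (simp add: saturated_projection_def)
  also have "\<dots> = (\<Union>Z\<in>{Z \<in> Y - {U}. proj.same_side U X Z}. isom g U ` \<rho> Z U)"
    using \<rho>_act[OF g U] by (intro SUP_cong refl) simp
  also have "\<dots> = isom g U ` proj.Q U X" by (simp add: saturated_projection_def image_UN)
  finally show ?thesis .
qed

definition move :: "'g \<Rightarrow> 'd \<times> 'p \<Rightarrow> 'd \<times> 'p" where
  "move g v = (act g (fst v), isom g (fst v) (snd v))"

lemma move_verts: "g \<in> carrier G \<Longrightarrow> v \<in> strong.verts \<Longrightarrow> move g v \<in> strong.verts"
  using act_Y[of g "fst v"] isom_mem[of g "fst v" "snd v"] strong.vertsD[of v] DomI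
  by (auto simp: move_def strong.verts_def)

lemma move_one: "v \<in> strong.verts \<Longrightarrow> move \<one> v = v"
  using act_one[of "fst v"] isom_one[of "fst v" "snd v"] strong.vertsD[of v] DomI
  by (simp add: move_def)

lemma move_mult:
  assumes "g \<in> carrier G" "h \<in> carrier G" "v \<in> strong.verts"
  shows "move (g \<otimes> h) v = move g (move h v)"
  using act_mult[OF assms(1,2), of "fst v"] iso_mult[OF assms(1,2), of "fst v" "snd v"]
    strong.vertsD[OF assms(3)] DomI by (simp add: move_def)

lemma P_move:
  assumes "g \<in> carrier G" "U \<in> Y" "v \<in> strong.verts"
  shows "strong.P (act g U) (move g v) = isom g U ` strong.P U v"
  using act_eq_iff[OF assms(1) strong.vertsD(1)[OF assms(3)] assms(2)]
    Q_act[OF assms(1,2) strong.vertsD(1)[OF assms(3)]] by (auto simp: strong.P_def move_def)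

lemma sd_move:
  assumes "g \<in> carrier G" "U \<in> Y" "v \<in> strong.verts" "w \<in> strong.verts"
  shows "strong.sd (act g U) (move g v) (move g w) = strong.sd U v w"
  using P_move[OF assms(1,2)] assms(3,4)
    sup_dist_isometry[OF iso_isometry[OF assms(1) DomI[OF assms(2)]], of "strong.P U v" "strong.P U w"]
    strong.P_small[OF assms(2,3)] strong.P_small[OF assms(2,4)]
  by (simp add: strong.sd_def small_set_def)

lemma act_surj:
  assumes "g \<in> carrier G" "U \<in> Y"
  obtains W where "W \<in> Y" "act g W = U"
proof -
  have "U \<in> act g ` Y" using Y_invariant[OF assms(1)] assms(2) by simp
  then show thesis using that by (elim imageE) simp
qed

lemma adj_move:
  assumes g: "g \<in> carrier G" and "strong.adj v w"
  shows "strong.adj (move g v) (move g w)"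
proof -
  have vw: "v \<in> strong.verts" "w \<in> strong.verts" "v \<noteq> w" "\<And>U. U \<in> Y \<Longrightarrow> strong.sd U v w \<le> 2 * \<kappa>"
    using assms(2) by (auto simp: strong.adj_def)
  have "move (inv g) (move g u) = u" if "u \<in> strong.verts" for u
    using move_mult[of "inv g" g u] move_one[OF that] g that by simp
  then have "move g v \<noteq> move g w" using vw by metis
  moreover have "strong.sd U (move g v) (move g w) \<le> 2 * \<kappa>" if U: "U \<in> Y" for U
  proof -
    obtain W where "W \<in> Y" "act g W = U" using act_surj[OF g U] .
    then show ?thesis using sd_move[OF g _ vw(1,2), of W] vw(4)[of W] by simp
  qed
  ultimately show ?thesis
    using move_verts[OF g] vw(1,2) by (simp add: strong.adj_def)
qed

section \<open>Displacement in the graph and in the group\<close>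

lemma sd_le_gdist:
  assumes "v \<in> strong.verts" "w \<in> strong.verts" "U \<in> Y"
  shows "strong.sd U v w \<le> 2 * \<kappa> * real (gdist strong.adj v w) + \<kappa>"
proof -
  let ?n = "gdist strong.adj v w"
  obtain f where f: "f 0 = v" "f ?n = w" "\<And>i. i < ?n \<Longrightarrow> strong.adj (f i) (f (Suc i))"
    "\<And>i. i \<le> ?n \<Longrightarrow> f i \<in> strong.verts"
    "\<And>i j. i \<le> j \<Longrightarrow> j \<le> ?n \<Longrightarrow> gdist strong.adj (f i) (f j) = j - i"
    by (rule strong.geodesic_path[OF assms(1,2)], rule that)
  have "strong.sd U v (f i) \<le> 2 * \<kappa> * real i + \<kappa>" if "i \<le> ?n" for i
    using that
  proof (induction i)
    case 0
    then show ?case using strong.sd_self[OF assms(3,1)] f(1) by simp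
  next
    case (Suc i)
    have "strong.sd U (f i) (f (Suc i)) \<le> 2 * \<kappa>"
      using f(3)[of i] Suc.prems assms(3) by (simp add: strong.adj_def)
    moreover have "strong.sd U v (f (Suc i)) \<le> strong.sd U v (f i) + strong.sd U (f i) (f (Suc i))"
      using strong.sd_triangle[OF assms(3,1)] f(4) Suc.prems by simp
    moreover have "strong.sd U v (f i) \<le> 2 * \<kappa> * real i + \<kappa>" using Suc by simp
    moreover have "2 * \<kappa> * real (Suc i) = 2 * \<kappa> * real i + 2 * \<kappa>" by (simp add: algebra_simps)
    ultimately show ?case by linarith
  qed
  from this[of ?n] show ?thesis using f(2) by simp
qed

text \<open>In every \<open>C U\<close> the projections of \<one> and \<open>g\<close> are joined
  through those of \<open>x\<close>, \<open>v\<close>, \<open>move g v\<close> and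
  \<open>g \<otimes> x\<close>, where \<open>x\<close> realises \<open>v\<close>. Only the step from
  \<open>v\<close> to \<open>move g v\<close> depends on \<open>g\<close>; equivariance and the
  Lipschitz condition bound the others for all \<open>g\<close> and \<open>U\<close> at
  once.\<close>

lemma \<pi>_displacement:
  assumes v: "v \<in> strong.verts"
  obtains R where "\<And>g U. g \<in> carrier G \<Longrightarrow> U \<in> Y \<Longrightarrow>
    set_dist (C U) (\<pi> U \<one>) (\<pi> U g) \<le> R + 2 * \<kappa> * real (gdist strong.adj v (move g v))"
proof -
  define V where "V = fst v"
  define p where "p = snd v"
  have V: "V \<in> Y" "p \<in> mspace (C V)" using strong.vertsD[OF v] by (auto simp: V_def p_def)
  obtain x where x: "x \<in> carrier G" "sup_dist (C V) (\<pi> V x) {p} \<le> 3 * E 0"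
    and near: "\<And>W. W \<in> Dom \<Longrightarrow> transverse nest orth V W \<Longrightarrow> sup_dist (C W) (\<pi> W x) (\<rho> V W) \<le> 3 * E 0"
    using realise_point[OF DomI[OF V(1)] V(2)] by metis
  have x_v: "sup_dist (C U) (\<pi> U x) (strong.P U v) \<le> 3 * E 0 + \<kappa>" if U: "U \<in> Y" for U
  proof (cases "U = V")
    case True
    have "strong.P V v = {p}" by (simp add: strong.P_def V_def p_def)
    then show ?thesis using x(2) True strong.\<kappa>_ge1 by simp
  next
    case False
    have P: "strong.P U v = proj.Q U V" using False by (simp add: strong.P_def V_def)
    have sm: "small_set (C U) (E 0) (\<pi> U x)" "small_set (C U) \<kappa> (proj.Q U V)"
      using \<pi>_small[OF DomI[OF U] x(1)] strong.Q_small[OF U V(1)] False by auto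
    \<comment> \<open>The point \<open>b\<close> links the two sets: \<open>\<rho> V U\<close> is
      near \<open>\<pi> U x\<close> by the choice of \<open>x\<close>, and it is part of the
      saturated projection.\<close>
    obtain b where b: "b \<in> \<rho> V U" using proj.\<rho>_small[OF U V(1)] False by (auto simp: small_set_def)
    have bQ: "b \<in> proj.Q U V" using proj.\<rho>_subset_Q[OF V(1), of U] b False by blast
    show ?thesis
      unfolding P
    proof (rule sup_dist_least)
      fix a c assume a: "a \<in> \<pi> U x" and c: "c \<in> proj.Q U V"
      have "mdist (C U) a b \<le> 3 * E 0"
        using sup_dist_upper[OF sm(1) proj.\<rho>_small[OF U V(1)] a b] near[OF DomI[OF U] Y_tr[OF V(1) U]] False
        by simp
      moreover have "mdist (C U) b c \<le> \<kappa>"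
        using sm(2) bQ c unfolding small_set_def diam_le_def by blast
      moreover have "mdist (C U) a c \<le> mdist (C U) a b + mdist (C U) b c"
        using sm a bQ c by (intro mdist_triangle) (auto simp: small_set_def)
      ultimately show "mdist (C U) a c \<le> 3 * E 0 + \<kappa>" by linarith
    qed (use sm in \<open>auto simp: small_set_def\<close>)
  qed
  \<comment> \<open>By left invariance \<open>g\<close> and \<open>g \<otimes> x\<close> are as far
    apart as \<one> and \<open>x\<close>. Two of the three summands \<open>E 0\<close> come from
    passing to supremal distances.\<close>
  define w where "w = E 0 * word_dist G S \<one> x + 3 * E 0"
  have move_\<pi>: "sup_dist (C U) (\<pi> U g) (\<pi> U (g \<otimes> x)) \<le> w" if "g \<in> carrier G" "U \<in> Y" for g U
  proof -
    have "inv g \<otimes> (g \<otimes> x) = inv \<one> \<otimes> x" using that(1) x(1) by (simp add: m_assoc[symmetric])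
    then have "word_dist G S g (g \<otimes> x) = word_dist G S \<one> x" by (simp add: word_dist_def)
    then have "set_dist (C U) (\<pi> U g) (\<pi> U (g \<otimes> x)) \<le> E 0 * word_dist G S \<one> x + E 0"
      using \<pi>_coarsely_Lipschitz[OF DomI[OF that(2)] that(1), of "g \<otimes> x"] that(1) x(1) by simp
    then show ?thesis
      using sup_dist_le_set_dist[OF \<pi>_small[OF DomI[OF that(2)] that(1)] \<pi>_small[OF DomI[OF that(2)], of "g \<otimes> x"]]
        that(1) x(1) by (simp add: w_def)
  qed
  show thesis
  proof (rule that[of "2 * w + 2 * (3 * E 0 + \<kappa>) + \<kappa>"])
    fix g U assume g: "g \<in> carrier G" and U: "U \<in> Y"
    have gx: "g \<otimes> x \<in> carrier G" and gv: "move g v \<in> strong.verts" using g x(1) move_verts v by auto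
    obtain W where W: "W \<in> Y" "act g W = U" using act_surj[OF g U] .
    have "sup_dist (C U) (\<pi> U (g \<otimes> x)) (strong.P U (move g v)) = sup_dist (C W) (\<pi> W x) (strong.P W v)"
      using sup_dist_isometry[OF iso_isometry[OF g DomI[OF W(1)]], of "\<pi> W x" "strong.P W v"]
        \<pi>_equivariant[OF g DomI[OF W(1)] x(1)] P_move[OF g W(1) v] W(2)
        \<pi>_small[OF DomI[OF W(1)] x(1)] strong.P_small[OF W(1) v] by (simp add: small_set_def)
    then have gx_gv: "sup_dist (C U) (\<pi> U (g \<otimes> x)) (strong.P U (move g v)) \<le> 3 * E 0 + \<kappa>"
      using x_v[OF W(1)] by simp
    note sm = \<pi>_small[OF DomI[OF U] one_closed] \<pi>_small[OF DomI[OF U] x(1)] strong.P_small[OF U v]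
      strong.P_small[OF U gv] \<pi>_small[OF DomI[OF U] gx] \<pi>_small[OF DomI[OF U] g]
    have "sup_dist (C U) (\<pi> U \<one>) (\<pi> U g) \<le> sup_dist (C U) (\<pi> U \<one>) (\<pi> U x) +
        (sup_dist (C U) (\<pi> U x) (strong.P U v) + (sup_dist (C U) (strong.P U v) (strong.P U (move g v)) +
        (sup_dist (C U) (strong.P U (move g v)) (\<pi> U (g \<otimes> x)) + sup_dist (C U) (\<pi> U (g \<otimes> x)) (\<pi> U g))))"
      using sup_dist_triangle[OF sm(1,2,6)] sup_dist_triangle[OF sm(2,3,6)] sup_dist_triangle[OF sm(3,4,6)]
        sup_dist_triangle[OF sm(4,5,6)] by linarith
    moreover have "sup_dist (C U) (\<pi> U \<one>) (\<pi> U x) \<le> w" using move_\<pi>[OF one_closed U] x(1) by simp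
    moreover have "sup_dist (C U) (\<pi> U (g \<otimes> x)) (\<pi> U g) \<le> w"
      using move_\<pi>[OF g U] by (simp add: sup_dist_commute)
    moreover have "sup_dist (C U) (strong.P U v) (strong.P U (move g v))
        \<le> 2 * \<kappa> * real (gdist strong.adj v (move g v)) + \<kappa>"
      using sd_le_gdist[OF v gv U] by (simp add: strong.sd_def)
    moreover have "sup_dist (C U) (strong.P U (move g v)) (\<pi> U (g \<otimes> x)) \<le> 3 * E 0 + \<kappa>"
      using gx_gv by (simp add: sup_dist_commute)
    ultimately have "sup_dist (C U) (\<pi> U \<one>) (\<pi> U g)
        \<le> w + ((3 * E 0 + \<kappa>) + ((2 * \<kappa> * real (gdist strong.adj v (move g v)) + \<kappa>) + ((3 * E 0 + \<kappa>) + w)))"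
      using x_v[OF U] by linarith
    then show "set_dist (C U) (\<pi> U \<one>) (\<pi> U g)
        \<le> 2 * w + 2 * (3 * E 0 + \<kappa>) + \<kappa> + 2 * \<kappa> * real (gdist strong.adj v (move g v))"
      using set_dist_le_sup_dist[OF sm(1,6)] by (simp add: algebra_simps)
  qed
qed

end

section \<open>The product over the colours\<close>

definition tame_action ::
  "('g, 'm) monoid_scheme \<Rightarrow> 'p metric \<Rightarrow> ('p \<Rightarrow> 'p \<Rightarrow> 'p \<Rightarrow> 'p) \<Rightarrow> ('g \<Rightarrow> 'p \<Rightarrow> 'p) \<Rightarrow> bool" where
  "tame_action G T m \<phi> \<longleftrightarrow> quasi_tree T \<and> coarse_median T m \<and> isometric_action G T \<phi> \<and>
     (\<forall>g\<in>carrier G. quasimedian T m T m (\<phi> g))"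

text \<open>The factor for an empty colour.\<close>

lemma trivial_tame_action:
  fixes G (structure)
  assumes "group G"
  shows "\<exists>(T :: ('v \<times> 'v \<times> real) metric) m \<phi>. tame_action G T m \<phi>"
proof -
  interpret connected_graph "{undefined :: 'v}" "\<lambda>_ _. False"
    by unfold_locales (auto intro: sympI)
  have "tight 0"
    unfolding tight_def
  proof (intro ballI exI[of _ "{undefined}"] conjI allI impI)
    fix x y z A
    assume "x \<in> {undefined :: 'v}" "y \<in> {undefined :: 'v}" "z \<in> {undefined :: 'v}"
      "conn (\<lambda>_ _. False) A x y"
    then have "z \<in> A" by (simp add: conn_def)
    then show "\<exists>a\<in>A. gdist (\<lambda>_ _. False) a z \<le> 0" using gdist_self[of z] by (intro bexI[of _ z]) simp_all
  qed (simp_all add: conn_refl)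
  then show ?thesis
    using action_on_realisation[OF assms, of 0 "\<lambda>_ v. v"] unfolding tame_action_def by auto
qed

text \<open>The second clause is the contribution of one colour to properness. Its bound
  \<open>R\<close> serves all domains of the colour, so that finitely many colours lead to one bound
  for all domains.\<close>

lemma (in hhg_colour) tame_action_of_colour:
  "\<exists>(T :: ('d, 'p) graph_point metric) m \<phi>. tame_action G T m \<phi> \<and>
     (\<forall>x\<in>mspace T. \<forall>r. \<exists>R. \<forall>g\<in>carrier G. mdist T x (\<phi> g x) \<le> r \<longrightarrow>
        (\<forall>U\<in>Y. set_dist (C U) (\<pi> U \<one>) (\<pi> U g) \<le> R))"
proof (cases "Y = {}")
  case True
  then show ?thesis using trivial_tame_action[OF is_group] by (metis empty_iff)
next
  case False
  then obtain V where V: "V \<in> Y" by blast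
  obtain p where "p \<in> mspace (C V)"
    using \<pi>_small[OF DomI[OF V] one_closed] by (auto simp: small_set_def)
  then have ne: "strong.verts \<noteq> {}" using strong.vertsI[OF V] by blast
  obtain \<Delta> where tight: "strong.tight \<Delta>" using strong_tight by blast
  let ?T = "strong.realisation"
  have "\<exists>m \<phi>. quasi_tree ?T \<and> coarse_median ?T m \<and> isometric_action G ?T \<phi> \<and>
    (\<forall>g\<in>carrier G. quasimedian ?T m ?T m (\<phi> g)) \<and>
    (\<forall>x\<in>mspace ?T. fst x \<in> strong.verts \<and>
       (\<forall>g\<in>carrier G. real (gdist strong.adj (fst x) (move g (fst x))) \<le> mdist ?T x (\<phi> g x) + 2))"
    by (rule strong.action_on_realisation[OF is_group tight ne])
      (use move_verts move_one move_mult adj_move in auto)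
  then obtain m \<phi> where tame: "tame_action G ?T m \<phi>"
    and disp: "\<forall>x\<in>mspace ?T. fst x \<in> strong.verts \<and>
       (\<forall>g\<in>carrier G. real (gdist strong.adj (fst x) (move g (fst x))) \<le> mdist ?T x (\<phi> g x) + 2)"
    unfolding tame_action_def by blast
  have "\<exists>R. \<forall>g\<in>carrier G. mdist ?T x (\<phi> g x) \<le> r \<longrightarrow> (\<forall>U\<in>Y. set_dist (C U) (\<pi> U \<one>) (\<pi> U g) \<le> R)"
    if x: "x \<in> mspace ?T" for x r
  proof -
    have v: "fst x \<in> strong.verts" using disp x by blast
    obtain R where R: "\<And>g U. g \<in> carrier G \<Longrightarrow> U \<in> Y \<Longrightarrow>
        set_dist (C U) (\<pi> U \<one>) (\<pi> U g) \<le> R + 2 * \<kappa> * real (gdist strong.adj (fst x) (move g (fst x)))"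
      by (rule \<pi>_displacement[OF v], rule that)
    have "set_dist (C U) (\<pi> U \<one>) (\<pi> U g) \<le> R + 2 * \<kappa> * (r + 2)"
      if "g \<in> carrier G" "mdist ?T x (\<phi> g x) \<le> r" "U \<in> Y" for g U
    proof -
      have "real (gdist strong.adj (fst x) (move g (fst x))) \<le> mdist ?T x (\<phi> g x) + 2"
        using disp x that(1) by blast
      then have "real (gdist strong.adj (fst x) (move g (fst x))) \<le> r + 2" using that(2) by linarith
      then have "2 * \<kappa> * real (gdist strong.adj (fst x) (move g (fst x))) \<le> 2 * \<kappa> * (r + 2)"
        using strong.\<kappa>_ge1 by (intro mult_left_mono) auto
      then show ?thesis using R[OF that(1,3)] by linarith
    qed
    then show ?thesis by blast
  qed
  then show ?thesis using tame by blast
qed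

text \<open>The outer \<open>restrict\<close> makes the maps extensional, as
  \<open>group_action\<close> demands. The errors of the medians in the factors add up in the l1
  metric.\<close>

lemma product_tame_action:
  fixes G (structure) and n :: nat
  assumes G: "group G" and tame: "\<And>i. i < n \<Longrightarrow> tame_action G (T i) (m i) (\<phi> i)"
  defines "\<Phi> \<equiv> \<lambda>g. restrict (\<lambda>x. \<lambda>i\<in>{..<n}. \<phi> i g (x i)) (mspace (l1_product n T))"
  shows "isometric_action G (l1_product n T) \<Phi>"
    and "\<forall>g\<in>carrier G. quasimedian (l1_product n T) (product_median n m)
      (l1_product n T) (product_median n m) (\<Phi> g)"
proof -
  interpret group G by (rule G)
  have act: "group_action G (mspace (T i)) (\<phi> i)"
    and iso: "\<And>g. g \<in> carrier G \<Longrightarrow> isometry (T i) (T i) (\<phi> i g)"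
    and median: "coarse_median (T i) (m i)"
    and quasi: "\<And>g. g \<in> carrier G \<Longrightarrow> quasimedian (T i) (m i) (T i) (m i) (\<phi> i g)"
    if "i < n" for i
    using tame[OF that] unfolding tame_action_def isometric_action_def by blast+
  have mem: "\<phi> i g x \<in> mspace (T i)" if "i < n" "g \<in> carrier G" "x \<in> mspace (T i)" for i g x
    using group_action.element_image[OF act[OF that(1)] that(2,3)] by blast
  have act_\<Phi>: "group_action G (mspace (l1_product n T)) \<Phi>"
    unfolding \<Phi>_def
  proof (rule group_actionI[OF G])
    fix g x assume "g \<in> carrier G" "x \<in> mspace (l1_product n T)"
    then show "(\<lambda>i\<in>{..<n}. \<phi> i g (x i)) \<in> mspace (l1_product n T)" using mem by auto
  next
    fix x assume x: "x \<in> mspace (l1_product n T)"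
    have "\<phi> i \<one> (x i) = x i" if "i < n" for i
      using group_action.id_eq_one[OF act[OF that]] PiE_mem[of x "{..<n}" "\<lambda>i. mspace (T i)" i] x that
      by (metis lessThan_iff mspace_l1_product restrict_apply')
    then show "(\<lambda>i\<in>{..<n}. \<phi> i \<one> (x i)) = x"
      using x by (auto simp: fun_eq_iff PiE_def extensional_def)
  next
    fix g h x assume gh: "g \<in> carrier G" "h \<in> carrier G" and x: "x \<in> mspace (l1_product n T)"
    have "\<phi> i (g \<otimes> h) (x i) = \<phi> i g (\<phi> i h (x i))" if "i < n" for i
      using group_action.composition_rule[OF act[OF that] _ gh] x that by (auto simp: PiE_iff)
    then show "(\<lambda>i\<in>{..<n}. \<phi> i (g \<otimes> h) (x i)) = (\<lambda>i\<in>{..<n}. \<phi> i g ((\<lambda>i\<in>{..<n}. \<phi> i h (x i)) i))"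
      by (auto simp: fun_eq_iff)
  qed
  have "isometry (l1_product n T) (l1_product n T) (\<Phi> g)" if g: "g \<in> carrier G" for g
    unfolding isometry_def
  proof (intro conjI ballI)
    show "\<Phi> g ` mspace (l1_product n T) = mspace (l1_product n T)"
      by (rule group_action.surj_prop[OF act_\<Phi> g])
    fix x y assume xy: "x \<in> mspace (l1_product n T)" "y \<in> mspace (l1_product n T)"
    have "mdist (T i) (\<phi> i g (x i)) (\<phi> i g (y i)) = mdist (T i) (x i) (y i)" if "i < n" for i
      using iso[OF that g] xy that unfolding isometry_def by (auto simp: PiE_iff)
    then show "mdist (l1_product n T) (\<Phi> g x) (\<Phi> g y) = mdist (l1_product n T) x y"
      unfolding mdist_l1_product \<Phi>_def using xy by (intro sum.cong) auto
  qed
  then show "isometric_action G (l1_product n T) \<Phi>"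
    using act_\<Phi> by (simp add: isometric_action_def)
  show "\<forall>g\<in>carrier G. quasimedian (l1_product n T) (product_median n m)
      (l1_product n T) (product_median n m) (\<Phi> g)"
  proof
    fix g assume g: "g \<in> carrier G"
    have "\<forall>i\<in>{..<n}. \<exists>D. \<forall>x\<in>mspace (T i). \<forall>y\<in>mspace (T i). \<forall>z\<in>mspace (T i).
        mdist (T i) (\<phi> i g (m i x y z)) (m i (\<phi> i g x) (\<phi> i g y) (\<phi> i g z)) \<le> D"
      using quasi[OF _ g] unfolding quasimedian_def by simp
    then obtain D where D: "\<forall>i\<in>{..<n}. \<forall>x\<in>mspace (T i). \<forall>y\<in>mspace (T i). \<forall>z\<in>mspace (T i).
        mdist (T i) (\<phi> i g (m i x y z)) (m i (\<phi> i g x) (\<phi> i g y) (\<phi> i g z)) \<le> D i"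
      by (auto simp: bchoice_iff)
    have "mdist (l1_product n T) (\<Phi> g (product_median n m x y z))
        (product_median n m (\<Phi> g x) (\<Phi> g y) (\<Phi> g z)) \<le> sum D {..<n}"
      if xyz: "x \<in> mspace (l1_product n T)" "y \<in> mspace (l1_product n T)" "z \<in> mspace (l1_product n T)" for x y z
    proof -
      have m_mem: "m i (x i) (y i) (z i) \<in> mspace (T i)" if "i < n" for i
        using median[OF that] xyz that unfolding coarse_median_def by (auto simp: PiE_iff)
      then have "product_median n m x y z \<in> mspace (l1_product n T)"
        by (simp add: product_median_def)
      then have eq: "\<Phi> g (product_median n m x y z) i = \<phi> i g (m i (x i) (y i) (z i))"
        "product_median n m (\<Phi> g x) (\<Phi> g y) (\<Phi> g z) i = m i (\<phi> i g (x i)) (\<phi> i g (y i)) (\<phi> i g (z i))"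
        if "i < n" for i
        using that xyz by (simp_all add: \<Phi>_def product_median_def)
      show ?thesis
        unfolding mdist_l1_product
      proof (rule sum_mono)
        fix i assume i: "i \<in> {..<n}"
        then have "x i \<in> mspace (T i)" "y i \<in> mspace (T i)" "z i \<in> mspace (T i)"
          using xyz by (auto simp: PiE_iff)
        then show "mdist (T i) (\<Phi> g (product_median n m x y z) i)
            (product_median n m (\<Phi> g x) (\<Phi> g y) (\<Phi> g z) i) \<le> D i"
          using D i eq[of i] by simp
      qed
    qed
    then show "quasimedian (l1_product n T) (product_median n m) (l1_product n T) (product_median n m) (\<Phi> g)"
      unfolding quasimedian_def by blast
  qed
qed

lemma (in hierarchically_hyperbolic_group) finite_bounded_displacement:
  "finite {g \<in> carrier G. \<forall>U\<in>Dom. set_dist (C U) (\<pi> U \<one>) (\<pi> U g) \<le> R}"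
proof (rule finite_subset[OF _ finite_word_ball[OF is_group generating_set]])
  show "{g \<in> carrier G. \<forall>U\<in>Dom. set_dist (C U) (\<pi> U \<one>) (\<pi> U g) \<le> R}
      \<subseteq> {g \<in> carrier G. word_dist G S \<one> g \<le> E (\<bar>R\<bar> + 1)}"
  proof
    fix g assume "g \<in> {g \<in> carrier G. \<forall>U\<in>Dom. set_dist (C U) (\<pi> U \<one>) (\<pi> U g) \<le> R}"
    then have g: "g \<in> carrier G" "\<And>U. U \<in> Dom \<Longrightarrow> set_dist (C U) (\<pi> U \<one>) (\<pi> U g) \<le> R" by auto
    \<comment> \<open>\<open>uniqueness\<close> asks for a nonnegative bound and strict
      inequalities, hence \<open>\<bar>R\<bar> + 1\<close>.\<close>
    have "set_dist (C U) (\<pi> U \<one>) (\<pi> U g) < \<bar>R\<bar> + 1" if "U \<in> Dom" for U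
      using g(2)[OF that] by linarith
    then have "word_dist G S \<one> g < E (\<bar>R\<bar> + 1)" by (intro uniqueness g(1) one_closed) auto
    then show "g \<in> {g \<in> carrier G. word_dist G S \<one> g \<le> E (\<bar>R\<bar> + 1)}" using g(1) by simp
  qed
qed

theorem corollary1p1:
  fixes G :: "('g, 'm) monoid_scheme"
    and S :: "'g set"
    and E :: "real \<Rightarrow> real"
    and Dom :: "'d set"
    and C :: "'d \<Rightarrow> 'p metric"
    and \<pi> :: "'d \<Rightarrow> 'g \<Rightarrow> 'p set"
    and nest orth :: "'d \<Rightarrow> 'd \<Rightarrow> bool"
    and \<rho> :: "'d \<Rightarrow> 'd \<Rightarrow> 'p set"
    and \<rho>map :: "'d \<Rightarrow> 'd \<Rightarrow> 'p \<Rightarrow> 'p set"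
    and act :: "'g \<Rightarrow> 'd \<Rightarrow> 'd"
    and isom :: "'g \<Rightarrow> 'd \<Rightarrow> 'p \<Rightarrow> 'p"
    and k :: nat
    and D :: "nat \<Rightarrow> 'd set"
  assumes "hierarchically_hyperbolic_group G S E Dom C \<pi> nest orth \<rho> \<rho>map act isom"
    and "BBF_colouring G Dom nest orth act k D"
    and "\<And>U. U \<in> Dom \<Longrightarrow> quasi_tree (C U)"
  shows "\<exists>(n::nat) (T :: nat \<Rightarrow> ('d, 'p) graph_point metric) m \<phi>.
           (\<forall>i<n. quasi_tree (T i) \<and> coarse_median (T i) (m i)) \<and>
           isometric_action G (l1_product n T) \<phi> \<and>
           metrically_proper G (l1_product n T) \<phi> \<and>
           (\<forall>g\<in>carrier G.
              quasimedian (l1_product n T) (product_median n m)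
                          (l1_product n T) (product_median n m) (\<phi> g))"
proof -
  interpret hierarchically_hyperbolic_group G S E Dom C \<pi> nest orth \<rho> \<rho>map act isom by fact
  have D: "Dom = (\<Union>i\<in>{1..k}. D i)" "\<And>i. i \<in> {1..k} \<Longrightarrow> pairwise (transverse nest orth) (D i)"
    "\<And>i g. i \<in> {1..k} \<Longrightarrow> g \<in> carrier G \<Longrightarrow> act g ` D i = D i"
    using assms(2) unfolding BBF_colouring_def by blast+
  \<comment> \<open>Colours are numbered from 1 and factors from 0, hence
    \<open>Suc i\<close>.\<close>
  define good where "good i T m \<phi> \<longleftrightarrow> tame_action G T m \<phi> \<and>
     (\<forall>x\<in>mspace T. \<forall>r. \<exists>R. \<forall>g\<in>carrier G. mdist T x (\<phi> g x) \<le> r \<longrightarrow>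
        (\<forall>U\<in>D (Suc i). set_dist (C U) (\<pi> U \<one>\<^bsub>G\<^esub>) (\<pi> U g) \<le> R))"
    for i and T :: "('d, 'p) graph_point metric" and m \<phi>
  have "\<exists>T m \<phi>. good i T m \<phi>" if i: "i < k" for i
  proof -
    have i': "Suc i \<in> {1..k}" using i by simp
    have colour: "hhg_colour G S E Dom C \<pi> nest orth \<rho> \<rho>map act isom (D (Suc i))"
    proof (intro hhg_colour.intro hhg_colour_axioms.intro)
      show "hierarchically_hyperbolic_group G S E Dom C \<pi> nest orth \<rho> \<rho>map act isom" by fact
      show "D (Suc i) \<subseteq> Dom" using D(1) i' by blast
    qed (use D(2,3)[OF i'] assms(3) in auto)
    show ?thesis
      using hhg_colour.tame_action_of_colour[OF colour] unfolding good_def .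
  qed
  then obtain T m \<phi> where good: "\<And>i. i < k \<Longrightarrow> good i (T i) (m i) (\<phi> i)" by metis
  define \<Phi> where "\<Phi> = (\<lambda>g. restrict (\<lambda>x. \<lambda>i\<in>{..<k}. \<phi> i g (x i)) (mspace (l1_product k T)))"
  have tame: "tame_action G (T i) (m i) (\<phi> i)" if "i < k" for i
    using good[OF that] by (simp add: good_def)
  have product: "isometric_action G (l1_product k T) \<Phi>"
    "\<forall>g\<in>carrier G. quasimedian (l1_product k T) (product_median k m)
      (l1_product k T) (product_median k m) (\<Phi> g)"
    unfolding \<Phi>_def
    by (rule product_tame_action(1)[OF is_group tame], assumption)
      (rule product_tame_action(2)[OF is_group tame], assumption)
  have "metrically_proper G (l1_product k T) \<Phi>"
    unfolding metrically_proper_def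
  proof (intro ballI allI)
    fix x r assume x: "x \<in> mspace (l1_product k T)"
    have "\<forall>i\<in>{..<k}. \<exists>R. \<forall>g\<in>carrier G. mdist (T i) (x i) (\<phi> i g (x i)) \<le> 2 * r \<longrightarrow>
        (\<forall>U\<in>D (Suc i). set_dist (C U) (\<pi> U \<one>\<^bsub>G\<^esub>) (\<pi> U g) \<le> R)"
      using good x unfolding good_def by (auto simp: PiE_iff)
    then obtain R where R: "\<forall>i\<in>{..<k}. \<forall>g\<in>carrier G. mdist (T i) (x i) (\<phi> i g (x i)) \<le> 2 * r \<longrightarrow>
        (\<forall>U\<in>D (Suc i). set_dist (C U) (\<pi> U \<one>\<^bsub>G\<^esub>) (\<pi> U g) \<le> R i)"
      by (auto simp: bchoice_iff)
    have "{g \<in> carrier G. \<Phi> g ` mball_of (l1_product k T) x r \<inter> mball_of (l1_product k T) x r \<noteq> {}}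
        \<subseteq> {g \<in> carrier G. \<forall>U\<in>Dom. set_dist (C U) (\<pi> U \<one>\<^bsub>G\<^esub>) (\<pi> U g) \<le> Max (R ` {..<k})}"
    proof
      fix g assume "g \<in> {g \<in> carrier G. \<Phi> g ` mball_of (l1_product k T) x r \<inter> mball_of (l1_product k T) x r \<noteq> {}}"
      then obtain y where g: "g \<in> carrier G" and y: "y \<in> mball_of (l1_product k T) x r"
        "\<Phi> g y \<in> mball_of (l1_product k T) x r" by blast
      have y': "y \<in> mspace (l1_product k T)" "mdist (l1_product k T) x y < r"
        "\<Phi> g y \<in> mspace (l1_product k T)" "mdist (l1_product k T) x (\<Phi> g y) < r"
        using y unfolding in_mball_of by blast+
      have iso: "isometry (l1_product k T) (l1_product k T) (\<Phi> g)"
        using product(1) g by (simp add: isometric_action_def)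
      have gx: "\<Phi> g x \<in> mspace (l1_product k T)" using iso x unfolding isometry_def by blast
      have "mdist (l1_product k T) (\<Phi> g y) (\<Phi> g x) = mdist (l1_product k T) y x"
        using iso x y'(1) unfolding isometry_def by blast
      \<comment> \<open>Both \<open>y\<close> and its image are within \<open>r\<close> of
        \<open>x\<close>, and the image of \<open>x\<close> is as far from the image of
        \<open>y\<close> as \<open>x\<close> is from \<open>y\<close>.\<close>
      then have disp: "mdist (l1_product k T) x (\<Phi> g x) \<le> 2 * r"
        using mdist_triangle[OF x y'(3) gx] y'(2,4) mdist_commute[of "l1_product k T" x y] by linarith
      have "set_dist (C U) (\<pi> U \<one>\<^bsub>G\<^esub>) (\<pi> U g) \<le> Max (R ` {..<k})" if "U \<in> Dom" for U
      proof -
        obtain j where j: "j \<in> {1..k}" "U \<in> D j" using \<open>U \<in> Dom\<close> D(1) by blast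
        define i where "i = j - 1"
        have i: "i < k" "U \<in> D (Suc i)" using j by (auto simp: i_def)
        have "mdist (T i) (x i) (\<Phi> g x i) \<le> (\<Sum>i<k. mdist (T i) (x i) (\<Phi> g x i))"
          using i(1) by (intro member_le_sum) auto
        also have "\<dots> \<le> 2 * r" using disp by simp
        finally have "mdist (T i) (x i) (\<phi> i g (x i)) \<le> 2 * r" using i(1) x by (simp add: \<Phi>_def)
        then have "set_dist (C U) (\<pi> U \<one>\<^bsub>G\<^esub>) (\<pi> U g) \<le> R i" using R g i by blast
        also have "R i \<le> Max (R ` {..<k})" using i(1) by (intro Max_ge) auto
        finally show ?thesis .
      qed
      then show "g \<in> {g \<in> carrier G. \<forall>U\<in>Dom. set_dist (C U) (\<pi> U \<one>\<^bsub>G\<^esub>) (\<pi> U g) \<le> Max (R ` {..<k})}"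
        using g by blast
    qed
    then show "finite {g \<in> carrier G. \<Phi> g ` mball_of (l1_product k T) x r \<inter> mball_of (l1_product k T) x r \<noteq> {}}"
      by (rule finite_subset) (rule finite_bounded_displacement)
  qed
  then show ?thesis
    using product tame unfolding tame_action_def
    by (intro exI[of _ k] exI[of _ T] exI[of _ m] exI[of _ \<Phi>]) blast
qed

end
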